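(* Let $x \in \mathfrak{M}$ be a self-adjoint operator. If $m = \mathrm{med}(x)$, then for any $\lambda \in \mathbb{R}$ and $\alpha \in \mathbb{R}$, $$\tau\left( e_{\lambda}^{\perp} (x - m)\right) \leq 2\, \tau \left(e_{\lambda}^{\perp}(\widehat{x})\right)$$ and $$\tau \left( e_{\lambda}^{\perp}(|x - m|)\right) \leq 2\, \tau \left(e_{\lambda}^{\perp}(|\widehat{x}|)\right) \leq 4\, \tau \left( e_{\frac{\lambda}{2}}^{\perp}(|x - \alpha |)\right).$$ In particular, $$\tau \left( e_{\lambda}^{\perp}(|x - m|)\right) \leq 2\, \tau \left(e_{\lambda}^{\perp}(|\widehat{x}|)\right) \leq 4\, \tau \left( e_{\frac{\lambda}{2}}^{\perp}(|x - m |)\right).$$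
   Context: $\mathfrak{M}$ is a von Neumann algebra on a Hilbert space with unit $\mathbf{1}$, equipped with a normal faithful tracial state $\tau$. For a self-adjoint $x$ and a Borel set $B\subseteq\mathbb{R}$, $e_B(x)$ is the spectral projection of $x$ corresponding to $B$; for $t\in\mathbb{R}$, $e_t(x)=e_{(-\infty,t)}(x)$ and $e_t^{\perp}(x)=\mathbf{1}-e_t(x)=e_{[t,\infty)}(x)$. Scalars are identified with scalar multiples of the unit. A median of self-adjoint $x$, denoted $\mathrm{med}(x)$, is a real number $m$ with $\tau(e_{(-\infty,m]}(x))\geq \frac12$ and $\tau(e_m^{\perp}(x))\geq\frac12$ (such $m$ always exists; $\mathrm{med}(x)$ stands for any choice). Symmetrization: $\mathfrak{M}\otimes\mathfrak{M}$ denotes the von Neumann algebra tensor product with the tensor product trace $\overline{\tau}$ determined by $\overline{\tau}(x\otimes y)=\tau(x)\tau(y)$. An element $x\in\mathfrak{M}$ is identified with $x\otimes \mathbf{1}$, its copy is $x'=\mathbf{1}\otimes x$, $\overline{\tau}$ is again written $\tau$, and $\widehat{x}:=x-x'=x\otimes \mathbf{1}-\mathbf{1}\otimes x\in\mathfrak{M}\otimes\mathfrak{M}$. *)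

theory Defs
  imports "HOL-Analysis.Analysis"
begin

section \<open>Complex Hilbert spaces\<close>

text \<open>
  The real structure (\<open>scaleR\<close>, \<open>inner\<close>, \<open>norm\<close>) is the one underlying the complex structure:
  the real inner product is the real part of the complex one, so that the norm is
  the Hilbert space norm. The complex inner product is linear in the first argument.
\<close>

class chilbert_space = real_inner + complete_space +
  fixes scaleC :: "complex \<Rightarrow> 'a \<Rightarrow> 'a"  (infixr \<open>*\<^sub>C\<close> 75)
    and cinner :: "'a \<Rightarrow> 'a \<Rightarrow> complex"
  assumes scaleC_add_right: "c *\<^sub>C (x + y) = c *\<^sub>C x + c *\<^sub>C y"
    and scaleC_add_left: "(c + d) *\<^sub>C x = c *\<^sub>C x + d *\<^sub>C x"
    and scaleC_scaleC: "c *\<^sub>C (d *\<^sub>C x) = (c * d) *\<^sub>C x"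
    and scaleC_of_real: "complex_of_real r *\<^sub>C x = r *\<^sub>R x"
    and cinner_commute: "cinner x y = cnj (cinner y x)"
    and cinner_add_left: "cinner (x + y) z = cinner x z + cinner y z"
    and cinner_scaleC_left: "cinner (c *\<^sub>C x) y = c * cinner x y"
    and Re_cinner: "Re (cinner x y) = inner x y"


section \<open>Bounded operators\<close>

text \<open>
  Bounded operators on a complex Hilbert space are the complex-linear elements of the
  library type of bounded real-linear maps.
\<close>

definition bounded_ops :: "('h::chilbert_space \<Rightarrow>\<^sub>L 'h) set" where
  "bounded_ops = {x. \<forall>c \<xi>. blinfun_apply x (c *\<^sub>C \<xi>) = c *\<^sub>C blinfun_apply x \<xi>}"

lemma norm_scaleC: "norm (c *\<^sub>C (\<xi>::'h::chilbert_space)) = cmod c * norm \<xi>"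
proof -
  have "cinner (c *\<^sub>C \<xi>) (c *\<^sub>C \<xi>) = c * cnj (c * cinner \<xi> \<xi>)"
    by (metis cinner_commute cinner_scaleC_left)
  also have "\<dots> = complex_of_real ((cmod c)\<^sup>2) * cinner \<xi> \<xi>"
    by (metis cinner_commute complex_cnj_mult complex_norm_square mult.assoc)
  finally have "inner (c *\<^sub>C \<xi>) (c *\<^sub>C \<xi>) = (cmod c)\<^sup>2 * inner \<xi> \<xi>"
    by (simp flip: Re_cinner)
  then show ?thesis
    by (simp add: norm_eq_sqrt_inner real_sqrt_mult)
qed

lift_definition scalar_op :: "complex \<Rightarrow> 'h::chilbert_space \<Rightarrow>\<^sub>L 'h" is "\<lambda>c \<xi>. c *\<^sub>C \<xi>"
proof
  fix c and \<xi> \<eta> :: 'h and r :: real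
  show "c *\<^sub>C (\<xi> + \<eta>) = c *\<^sub>C \<xi> + c *\<^sub>C \<eta>"
    by (rule scaleC_add_right)
  show "c *\<^sub>C (r *\<^sub>R \<xi>) = r *\<^sub>R (c *\<^sub>C \<xi>)"
    by (metis mult.commute scaleC_of_real scaleC_scaleC)
  show "\<exists>K. \<forall>\<xi>::'h. norm (c *\<^sub>C \<xi>) \<le> norm \<xi> * K"
    by (metis mult.commute norm_scaleC order_refl)
qed

definition adj :: "('h::chilbert_space \<Rightarrow>\<^sub>L 'h) \<Rightarrow> ('h \<Rightarrow>\<^sub>L 'h)" where
  "adj x = (THE y. \<forall>\<xi> \<eta>. cinner (blinfun_apply x \<xi>) \<eta> = cinner \<xi> (blinfun_apply y \<eta>))"

definition selfadjoint :: "('h::chilbert_space \<Rightarrow>\<^sub>L 'h) \<Rightarrow> bool" where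
  "selfadjoint x \<longleftrightarrow> x \<in> bounded_ops \<and>
     (\<forall>\<xi> \<eta>. cinner (blinfun_apply x \<xi>) \<eta> = cinner \<xi> (blinfun_apply x \<eta>))"

definition positive_op :: "('h::chilbert_space \<Rightarrow>\<^sub>L 'h) \<Rightarrow> bool" where
  "positive_op x \<longleftrightarrow> x \<in> bounded_ops \<and> (\<forall>\<xi>. cinner (blinfun_apply x \<xi>) \<xi> \<in> \<real>\<^sub>\<ge>\<^sub>0)"

definition op_le :: "('h::chilbert_space \<Rightarrow>\<^sub>L 'h) \<Rightarrow> ('h \<Rightarrow>\<^sub>L 'h) \<Rightarrow> bool" where
  "op_le x y \<longleftrightarrow> positive_op (y - x)"

definition projection :: "('h::chilbert_space \<Rightarrow>\<^sub>L 'h) \<Rightarrow> bool" where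
  "projection p \<longleftrightarrow> selfadjoint p \<and> p o\<^sub>L p = p"

text \<open>The absolute value \<open>|x|\<close> is the positive square root of \<open>x\<^sup>* x\<close>.\<close>

definition op_abs :: "('h::chilbert_space \<Rightarrow>\<^sub>L 'h) \<Rightarrow> ('h \<Rightarrow>\<^sub>L 'h)" where
  "op_abs x = (THE y. positive_op y \<and> y o\<^sub>L y = adj x o\<^sub>L x)"


section \<open>Spectral projections\<close>

text \<open>Projection-valued measures on the Borel sets of the line, countably additive in the
  strong operator topology.\<close>

definition projection_valued_measure :: "(real set \<Rightarrow> ('h::chilbert_space \<Rightarrow>\<^sub>L 'h)) \<Rightarrow> bool" where
  "projection_valued_measure E \<longleftrightarrow>
     (\<forall>B\<in>sets borel. projection (E B)) \<and>
     E UNIV = id_blinfun \<and>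
     (\<forall>A\<in>sets borel. \<forall>B\<in>sets borel. E (A \<inter> B) = E A o\<^sub>L E B) \<and>
     (\<forall>A::nat \<Rightarrow> real set. range A \<subseteq> sets borel \<longrightarrow> disjoint_family A \<longrightarrow>
        (\<forall>\<xi>. (\<lambda>i. blinfun_apply (E (A i)) \<xi>) sums blinfun_apply (E (\<Union>i. A i)) \<xi>))"

definition scalar_measure ::
  "(real set \<Rightarrow> ('h::chilbert_space \<Rightarrow>\<^sub>L 'h)) \<Rightarrow> 'h \<Rightarrow> real measure" where
  "scalar_measure E \<xi> =
     measure_of UNIV (sets borel) (\<lambda>B. ennreal (Re (cinner (blinfun_apply (E B) \<xi>) \<xi>)))"

text \<open>\<open>x = \<integral> t dE(t)\<close>, in the weak sense. Since \<open>x\<close> is bounded, integrability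
  for every vector forces \<open>E\<close> to have compact support.\<close>

definition spectral_measure ::
  "('h::chilbert_space \<Rightarrow>\<^sub>L 'h) \<Rightarrow> (real set \<Rightarrow> ('h \<Rightarrow>\<^sub>L 'h)) \<Rightarrow> bool" where
  "spectral_measure x E \<longleftrightarrow>
     projection_valued_measure E \<and>
     (\<forall>\<xi>. integrable (scalar_measure E \<xi>) (\<lambda>t. t) \<and>
          cinner (blinfun_apply x \<xi>) \<xi> = complex_of_real (\<integral>t. t \<partial>scalar_measure E \<xi>))"

text \<open>\<open>e\<^sub>B(x)\<close>; meaningful for self-adjoint \<open>x\<close> and Borel \<open>B\<close>. The description ranges over the
  value at \<open>B\<close>, because a spectral measure is determined on Borel sets only.\<close>

definition spectral_projection ::
  "real set \<Rightarrow> ('h::chilbert_space \<Rightarrow>\<^sub>L 'h) \<Rightarrow> ('h \<Rightarrow>\<^sub>L 'h)" where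
  "spectral_projection B x = (THE p. \<exists>E. spectral_measure x E \<and> p = E B)"

definition e_below :: "real \<Rightarrow> ('h::chilbert_space \<Rightarrow>\<^sub>L 'h) \<Rightarrow> ('h \<Rightarrow>\<^sub>L 'h)" where
  "e_below t x = spectral_projection {..<t} x"

definition e_perp :: "real \<Rightarrow> ('h::chilbert_space \<Rightarrow>\<^sub>L 'h) \<Rightarrow> ('h \<Rightarrow>\<^sub>L 'h)" where
  "e_perp t x = id_blinfun - e_below t x"


section \<open>Von Neumann algebras and traces\<close>

definition commutant :: "('h::chilbert_space \<Rightarrow>\<^sub>L 'h) set \<Rightarrow> ('h \<Rightarrow>\<^sub>L 'h) set" where
  "commutant S = {y \<in> bounded_ops. \<forall>x\<in>S. x o\<^sub>L y = y o\<^sub>L x}"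

definition von_neumann_algebra :: "('h::chilbert_space \<Rightarrow>\<^sub>L 'h) set \<Rightarrow> bool" where
  "von_neumann_algebra M \<longleftrightarrow>
     M \<subseteq> bounded_ops \<and> (\<forall>x\<in>M. adj x \<in> M) \<and> commutant (commutant M) = M"

text \<open>A functional on \<open>M\<close> is a function on all operators, of which only the
  values on \<open>M\<close> are relevant.\<close>

definition state_on ::
  "('h::chilbert_space \<Rightarrow>\<^sub>L 'h) set \<Rightarrow> (('h \<Rightarrow>\<^sub>L 'h) \<Rightarrow> complex) \<Rightarrow> bool" where
  "state_on M \<tau> \<longleftrightarrow>
     (\<forall>x\<in>M. \<forall>y\<in>M. \<tau> (x + y) = \<tau> x + \<tau> y) \<and>
     (\<forall>x\<in>M. \<forall>c. \<tau> (scalar_op c o\<^sub>L x) = c * \<tau> x) \<and>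
     (\<forall>x\<in>M. \<tau> (adj x o\<^sub>L x) \<in> \<real>\<^sub>\<ge>\<^sub>0) \<and>
     \<tau> id_blinfun = 1"

definition tracial_on ::
  "('h::chilbert_space \<Rightarrow>\<^sub>L 'h) set \<Rightarrow> (('h \<Rightarrow>\<^sub>L 'h) \<Rightarrow> complex) \<Rightarrow> bool" where
  "tracial_on M \<tau> \<longleftrightarrow> (\<forall>x\<in>M. \<forall>y\<in>M. \<tau> (x o\<^sub>L y) = \<tau> (y o\<^sub>L x))"

definition faithful_on ::
  "('h::chilbert_space \<Rightarrow>\<^sub>L 'h) set \<Rightarrow> (('h \<Rightarrow>\<^sub>L 'h) \<Rightarrow> complex) \<Rightarrow> bool" where
  "faithful_on M \<tau> \<longleftrightarrow> (\<forall>x\<in>M. \<tau> (adj x o\<^sub>L x) = 0 \<longrightarrow> x = 0)"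

text \<open>Normality: \<open>\<tau>\<close> preserves suprema of bounded upward directed sets (equivalently,
  increasing nets) of positive elements.\<close>

definition normal_on ::
  "('h::chilbert_space \<Rightarrow>\<^sub>L 'h) set \<Rightarrow> (('h \<Rightarrow>\<^sub>L 'h) \<Rightarrow> complex) \<Rightarrow> bool" where
  "normal_on M \<tau> \<longleftrightarrow>
     (\<forall>D s. D \<noteq> {} \<longrightarrow> D \<subseteq> M \<longrightarrow> (\<forall>d\<in>D. positive_op d) \<longrightarrow>
        (\<forall>a\<in>D. \<forall>b\<in>D. \<exists>d\<in>D. op_le a d \<and> op_le b d) \<longrightarrow>
        s \<in> M \<longrightarrow> (\<forall>d\<in>D. op_le d s) \<longrightarrow>
        (\<forall>u\<in>M. (\<forall>d\<in>D. op_le d u) \<longrightarrow> op_le s u) \<longrightarrow>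
        \<tau> s = complex_of_real (SUP d\<in>D. Re (\<tau> d)))"

definition normal_tracial_state ::
  "('h::chilbert_space \<Rightarrow>\<^sub>L 'h) set \<Rightarrow> (('h \<Rightarrow>\<^sub>L 'h) \<Rightarrow> complex) \<Rightarrow> bool" where
  "normal_tracial_state M \<tau> \<longleftrightarrow> state_on M \<tau> \<and> tracial_on M \<tau> \<and> normal_on M \<tau>"

text \<open>A median is not unique in general, hence a predicate. Values of \<open>\<tau>\<close> at projections are
  real, so taking real parts loses nothing.\<close>

definition is_median ::
  "(('h::chilbert_space \<Rightarrow>\<^sub>L 'h) \<Rightarrow> complex) \<Rightarrow> ('h \<Rightarrow>\<^sub>L 'h) \<Rightarrow> real \<Rightarrow> bool" where
  "is_median \<tau> x m \<longleftrightarrow>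
     Re (\<tau> (spectral_projection {..m} x)) \<ge> 1 / 2 \<and> Re (\<tau> (e_perp m x)) \<ge> 1 / 2"


section \<open>Tensor products and symmetrization\<close>

text \<open>
  \<open>T\<close> exhibits \<open>'k\<close> as the Hilbert space tensor product of \<open>'a\<close> and \<open>'b\<close>, where
  \<open>T \<xi> \<eta>\<close> is the elementary tensor of \<open>\<xi>\<close> and \<open>\<eta>\<close>. This determines \<open>T\<close> up to a unique unitary.
  The real span suffices, since elementary tensors are stable under complex scalars.
\<close>

definition hilbert_tensor ::
  "('a::chilbert_space \<Rightarrow> 'b::chilbert_space \<Rightarrow> 'k::chilbert_space) \<Rightarrow> bool" where
  "hilbert_tensor T \<longleftrightarrow>
     (\<forall>\<xi> \<xi>' \<eta>. T (\<xi> + \<xi>') \<eta> = T \<xi> \<eta> + T \<xi>' \<eta>) \<and>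
     (\<forall>\<xi> \<eta> \<eta>'. T \<xi> (\<eta> + \<eta>') = T \<xi> \<eta> + T \<xi> \<eta>') \<and>
     (\<forall>c \<xi> \<eta>. T (c *\<^sub>C \<xi>) \<eta> = c *\<^sub>C T \<xi> \<eta> \<and> T \<xi> (c *\<^sub>C \<eta>) = c *\<^sub>C T \<xi> \<eta>) \<and>
     (\<forall>\<xi> \<eta> \<xi>' \<eta>'. cinner (T \<xi> \<eta>) (T \<xi>' \<eta>') = cinner \<xi> \<xi>' * cinner \<eta> \<eta>') \<and>
     closure (span {T \<xi> \<eta> |\<xi> \<eta>. True}) = UNIV"

definition op_tensor ::
  "('a::chilbert_space \<Rightarrow> 'b::chilbert_space \<Rightarrow> 'k::chilbert_space) \<Rightarrow>
   ('a \<Rightarrow>\<^sub>L 'a) \<Rightarrow> ('b \<Rightarrow>\<^sub>L 'b) \<Rightarrow> ('k \<Rightarrow>\<^sub>L 'k)" where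
  "op_tensor T x y =
     (THE z. \<forall>\<xi> \<eta>. blinfun_apply z (T \<xi> \<eta>) = T (blinfun_apply x \<xi>) (blinfun_apply y \<eta>))"

definition vn_tensor ::
  "('a::chilbert_space \<Rightarrow> 'b::chilbert_space \<Rightarrow> 'k::chilbert_space) \<Rightarrow>
   ('a \<Rightarrow>\<^sub>L 'a) set \<Rightarrow> ('b \<Rightarrow>\<^sub>L 'b) set \<Rightarrow> ('k \<Rightarrow>\<^sub>L 'k) set" where
  "vn_tensor T M N = commutant (commutant {op_tensor T x y |x y. x \<in> M \<and> y \<in> N})"

text \<open>The tensor product trace is the unique normal state on the von Neumann algebra tensor
  product with the product formula on elementary tensors.\<close>

definition tensor_trace ::
  "('a::chilbert_space \<Rightarrow> 'b::chilbert_space \<Rightarrow> 'k::chilbert_space) \<Rightarrow>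
   ('a \<Rightarrow>\<^sub>L 'a) set \<Rightarrow> (('a \<Rightarrow>\<^sub>L 'a) \<Rightarrow> complex) \<Rightarrow>
   ('b \<Rightarrow>\<^sub>L 'b) set \<Rightarrow> (('b \<Rightarrow>\<^sub>L 'b) \<Rightarrow> complex) \<Rightarrow>
   (('k \<Rightarrow>\<^sub>L 'k) \<Rightarrow> complex) \<Rightarrow> bool" where
  "tensor_trace T M \<tau> N \<sigma> \<rho> \<longleftrightarrow>
     normal_tracial_state (vn_tensor T M N) \<rho> \<and>
     (\<forall>x\<in>M. \<forall>y\<in>N. \<rho> (op_tensor T x y) = \<tau> x * \<sigma> y)"

definition symmetrization ::
  "('h::chilbert_space \<Rightarrow> 'h \<Rightarrow> 'k::chilbert_space) \<Rightarrow> ('h \<Rightarrow>\<^sub>L 'h) \<Rightarrow> ('k \<Rightarrow>\<^sub>L 'k)" where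
  "symmetrization T x = op_tensor T x id_blinfun - op_tensor T id_blinfun x"

end

theory Submission
  imports Defs "HOL-Probability.Distribution_Functions"
begin

text \<open>
  Write \<open>\<mu>(B) = \<tau>(e\<^sub>B(x))\<close>. Since \<open>x \<otimes> 1\<close> and \<open>1 \<otimes> x\<close> commute, the inequalities are the classical ones
  for the product measure \<open>\<mu> \<otimes> \<mu>\<close>, namely
  \<open>{s - m \<ge> \<lambda>} \<times> {t \<le> m} \<subseteq> {s - t \<ge> \<lambda>}\<close>, its two-sided version, and
  \<open>{|s - \<alpha>| < \<lambda> / 2} \<times> {|t - \<alpha>| < \<lambda> / 2} \<subseteq> {|s - t| < \<lambda>}\<close>. No joint spectral measure is needed:
  each inclusion becomes an inequality between a projection \<open>p \<otimes> q\<close> and a spectral projection \<open>e\<close> of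
  the symmetrization or of its modulus. The two commute, so it suffices to compare the values of the
  quadratic form on the ranges of \<open>p \<otimes> q\<close> and of \<open>e\<close> or \<open>1 - e\<close>.

  That spectral projections exist and are determined by such bounds is the spectral theorem for bounded
  self-adjoint operators. Modulus and half-line projections are obtained in the bicommutant of the
  operator by elementary iterations (square root, mean ergodic theorem), so they are available on the
  underlying real Hilbert space; Stieltjes measures and a Dynkin argument extend them to Borel sets.
\<close>

section \<open>Operators on a real Hilbert space\<close>

text \<open>Adjoint, modulus, operator tensor product and spectral projection are definite
  descriptions, so each of them needs a uniqueness argument besides a construction. For spectral
  projections the rival is an arbitrary spectral measure, which is only known to commute with
  \<open>x\<close>; the constructed one lies in the bicommutant of \<open>x\<close> and hence
  commutes with the rival. For commuting projections, \<open>q p = p\<close> as soon as no nonzero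
  vector lies both in the range of \<open>p\<close> and in the kernel of \<open>q\<close>, and such
  vectors are excluded by opposite bounds on a quadratic form, one of them strict. This is why
  strict and non-strict bounds are tracked throughout. Lying in the bicommutant also yields complex
  linearity and membership in the von Neumann algebra. The constants: a median supplies a second
  factor of trace at least 1/2, and removing it costs the factor 2; the bound 1 - (1 - a)^2 <= 2 a
  doubles this to 4.\<close>

definition symm :: "('a::real_inner \<Rightarrow>\<^sub>L 'a) \<Rightarrow> bool" where
  "symm x \<longleftrightarrow> (\<forall>\<xi> \<eta>. inner (x \<xi>) \<eta> = inner \<xi> (x \<eta>))"

definition posop :: "('a::real_inner \<Rightarrow>\<^sub>L 'a) \<Rightarrow> bool" where
  "posop x \<longleftrightarrow> symm x \<and> (\<forall>\<xi>. 0 \<le> inner (x \<xi>) \<xi>)"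

definition proj :: "('a::real_inner \<Rightarrow>\<^sub>L 'a) \<Rightarrow> bool" where
  "proj p \<longleftrightarrow> symm p \<and> p o\<^sub>L p = p"

definition commuting :: "('a::real_normed_vector \<Rightarrow>\<^sub>L 'a) \<Rightarrow> ('a \<Rightarrow>\<^sub>L 'a) \<Rightarrow> bool" where
  "commuting x u \<longleftrightarrow> x o\<^sub>L u = u o\<^sub>L x"

text \<open>This is the bicommutant of a single operator, taken among all bounded real-linear maps.
  Multiplication by a complex scalar is an admissible \<open>u\<close>, which later makes
  \<open>p\<close> complex-linear whenever \<open>x\<close> is.\<close>

definition bicommuting :: "('a::real_normed_vector \<Rightarrow>\<^sub>L 'a) \<Rightarrow> ('a \<Rightarrow>\<^sub>L 'a) \<Rightarrow> bool" where
  "bicommuting x p \<longleftrightarrow> (\<forall>u. commuting x u \<longrightarrow> commuting p u)"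

lemma symmD: "symm x \<Longrightarrow> inner (x \<xi>) \<eta> = inner \<xi> (x \<eta>)"
  by (simp add: symm_def)

lemma symm_inner: "symm x \<Longrightarrow> inner (x \<xi>) \<eta> = inner (x \<eta>) \<xi>"
  by (simp add: symm_def inner_commute)

lemma commuting_iff: "commuting x u \<longleftrightarrow> (\<forall>\<xi>. x (u \<xi>) = u (x \<xi>))"
  unfolding commuting_def by (metis blinfun_apply_blinfun_compose blinfun_eqI)

lemma commutingD: "commuting x u \<Longrightarrow> x (u \<xi>) = u (x \<xi>)"
  by (simp add: commuting_iff)

lemma commuting_sym: "commuting x u \<Longrightarrow> commuting u x"
  by (simp add: commuting_def)

lemma commuting_refl [simp]: "commuting x x"
  by (simp add: commuting_def)

lemma commuting_id [simp]: "commuting id_blinfun u" "commuting u id_blinfun"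
  by (simp_all add: commuting_iff)

lemma commuting_add: "commuting x u \<Longrightarrow> commuting y u \<Longrightarrow> commuting (x + y) u"
  by (simp add: commuting_iff blinfun.bilinear_simps)

lemma commuting_diff: "commuting x u \<Longrightarrow> commuting y u \<Longrightarrow> commuting (x - y) u"
  by (simp add: commuting_iff blinfun.bilinear_simps)

lemma commuting_minus: "commuting x u \<Longrightarrow> commuting (- x) u"
  by (simp add: commuting_iff blinfun.bilinear_simps)

lemma commuting_scaleR: "commuting x u \<Longrightarrow> commuting (r *\<^sub>R x) u"
  by (simp add: commuting_iff blinfun.bilinear_simps)

lemma commuting_compose: "commuting x u \<Longrightarrow> commuting y u \<Longrightarrow> commuting (x o\<^sub>L y) u"
  by (simp add: commuting_iff)

lemma bicommutingD: "bicommuting x p \<Longrightarrow> commuting x u \<Longrightarrow> commuting p u"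
  by (simp add: bicommuting_def)

lemma bicommuting_self: "bicommuting x p \<Longrightarrow> commuting p x"
  by (simp add: bicommuting_def)

lemma bicommuting_trans: "bicommuting x y \<Longrightarrow> bicommuting y z \<Longrightarrow> bicommuting x z"
  by (simp add: bicommuting_def)

lemma symm_id [simp]: "symm id_blinfun"
  by (simp add: symm_def)

lemma symm_0 [simp]: "symm 0"
  by (simp add: symm_def)

lemma symm_add: "symm x \<Longrightarrow> symm y \<Longrightarrow> symm (x + y)"
  by (simp add: symm_def blinfun.bilinear_simps inner_simps)

lemma symm_diff: "symm x \<Longrightarrow> symm y \<Longrightarrow> symm (x - y)"
  by (simp add: symm_def blinfun.bilinear_simps inner_simps)

lemma symm_minus: "symm x \<Longrightarrow> symm (- x)"
  by (simp add: symm_def blinfun.bilinear_simps inner_simps)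

lemma symm_scaleR: "symm x \<Longrightarrow> symm (r *\<^sub>R x)"
  by (simp add: symm_def blinfun.bilinear_simps)

lemma symm_compose: "symm x \<Longrightarrow> symm y \<Longrightarrow> commuting x y \<Longrightarrow> symm (x o\<^sub>L y)"
  by (simp add: symm_def commuting_iff)

lemma symm_square: "symm x \<Longrightarrow> symm (x o\<^sub>L x)"
  by (simp add: symm_compose)

lemma inner_square: "symm x \<Longrightarrow> inner (x (x \<xi>)) \<xi> = (norm (x \<xi>))\<^sup>2"
  by (simp add: symm_def power2_norm_eq_inner)

lemma posop_square: "symm x \<Longrightarrow> posop (x o\<^sub>L x)"
  by (simp add: posop_def symm_square inner_square)

section \<open>Positive contractions and square roots\<close>

lemma norm_blinfun_le_square_bound:
  fixes x :: "'a::real_inner \<Rightarrow>\<^sub>L 'a"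
  assumes "0 \<le> K" "\<And>\<xi>. (norm (x \<xi>))\<^sup>2 \<le> (K * norm \<xi>)\<^sup>2"
  shows "norm x \<le> K"
  by (rule norm_blinfun_bound) (use assms in \<open>auto intro: power2_le_imp_le\<close>)

lemma inner_le_norm_blinfun:
  fixes x :: "'a::real_inner \<Rightarrow>\<^sub>L 'a"
  shows "\<bar>inner (x \<xi>) \<xi>\<bar> \<le> norm x * (norm \<xi>)\<^sup>2"
proof -
  have "\<bar>inner (x \<xi>) \<xi>\<bar> \<le> norm (x \<xi>) * norm \<xi>"
    by (rule Cauchy_Schwarz_ineq2)
  also have "\<dots> \<le> norm x * norm \<xi> * norm \<xi>"
    by (intro mult_right_mono norm_blinfun norm_ge_zero)
  finally show ?thesis
    by (simp add: power2_eq_square mult.assoc)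
qed

text \<open>This is c^2 <= c for 0 <= c <= 1, read off from positivity of the form at
  \<open>\<xi> - c \<xi>\<close>, because no square root of \<open>c\<close> is available
  yet.\<close>

lemma posop_contraction_ineq:
  assumes c: "posop c" and n: "norm c \<le> 1"
  shows "(norm (c \<xi>))\<^sup>2 \<le> inner (c \<xi>) \<xi>"
proof -
  have s: "symm c"
    using c by (simp add: posop_def)
  have "0 \<le> inner (c (\<xi> - c \<xi>)) (\<xi> - c \<xi>)"
    using c by (simp add: posop_def)
  also have "\<dots> = inner (c \<xi>) \<xi> - 2 * (norm (c \<xi>))\<^sup>2 + inner (c (c \<xi>)) (c \<xi>)"
    using inner_square[OF s, of \<xi>]
    by (simp add: blinfun.bilinear_simps inner_simps power2_norm_eq_inner symmD[OF s])
  finally have "2 * (norm (c \<xi>))\<^sup>2 \<le> inner (c \<xi>) \<xi> + inner (c (c \<xi>)) (c \<xi>)"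
    by simp
  moreover have "inner (c (c \<xi>)) (c \<xi>) \<le> (norm (c \<xi>))\<^sup>2"
    using inner_le_norm_blinfun[of c "c \<xi>"] mult_right_mono[OF n, of "(norm (c \<xi>))\<^sup>2"] by simp
  ultimately show ?thesis
    by simp
qed

lemma posop_contraction_complement:
  assumes c: "posop c" and n: "norm c \<le> 1"
  shows "norm (id_blinfun - c) \<le> 1"
proof (rule norm_blinfun_le_square_bound)
  fix \<xi>
  have "(norm ((id_blinfun - c) \<xi>))\<^sup>2 = (norm \<xi>)\<^sup>2 - 2 * inner (c \<xi>) \<xi> + (norm (c \<xi>))\<^sup>2"
    by (simp add: blinfun.bilinear_simps power2_norm_eq_inner inner_simps inner_commute)
  moreover have "0 \<le> inner (c \<xi>) \<xi>"
    using c by (simp add: posop_def)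
  ultimately show "(norm ((id_blinfun - c) \<xi>))\<^sup>2 \<le> (1 * norm \<xi>)\<^sup>2"
    using posop_contraction_ineq[OF c n, of \<xi>] by simp
qed simp

lemma symm_limit:
  fixes L :: "'a::real_inner \<Rightarrow>\<^sub>L 'a"
  assumes "\<And>n. symm (Y n)" "\<And>\<xi>. (\<lambda>n::nat. Y n \<xi>) \<longlonglongrightarrow> L \<xi>"
  shows "symm L"
  unfolding symm_def
proof (intro allI)
  fix \<xi> \<eta>
  have "(\<lambda>n. inner (Y n \<xi>) \<eta>) \<longlonglongrightarrow> inner (L \<xi>) \<eta>"
    by (intro tendsto_intros assms)
  moreover have "(\<lambda>n. inner \<xi> (Y n \<eta>)) \<longlonglongrightarrow> inner \<xi> (L \<eta>)"
    by (intro tendsto_intros assms)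
  ultimately show "inner (L \<xi>) \<eta> = inner \<xi> (L \<eta>)"
    using LIMSEQ_unique assms(1) by (simp add: symm_def)
qed

lemma commuting_limit:
  fixes L :: "'a::real_normed_vector \<Rightarrow>\<^sub>L 'a"
  assumes "\<And>n. commuting (Y n) u" "\<And>\<xi>. (\<lambda>n::nat. Y n \<xi>) \<longlonglongrightarrow> L \<xi>"
  shows "commuting L u"
  unfolding commuting_iff
proof
  fix \<xi>
  have "(\<lambda>n. u (Y n \<xi>)) \<longlonglongrightarrow> u (L \<xi>)"
    by (intro tendsto_intros assms)
  moreover have "(\<lambda>n. Y n (u \<xi>)) \<longlonglongrightarrow> L (u \<xi>)"
    by (rule assms)
  ultimately show "L (u \<xi>) = u (L \<xi>)"
    using LIMSEQ_unique assms(1) by (simp add: commuting_iff)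
qed

text \<open>With a = 1 - c and z = 1 - L, the equation z^2 = c becomes the fixed-point equation L =
  (a + L^2) / 2, solved by iteration from 0. The iterates are polynomials in \<open>a\<close>, so
  the limit is symmetric and in the bicommutant of \<open>c\<close>.\<close>

lemma posop_contraction_sqrt:
  fixes c :: "'a::{real_inner,banach} \<Rightarrow>\<^sub>L 'a"
  assumes c: "posop c" and n: "norm c \<le> 1"
  shows "\<exists>z. posop z \<and> z o\<^sub>L z = c \<and> bicommuting c z"
proof -
  define a where "a = id_blinfun - c"
  have a: "norm a \<le> 1" "symm a"
    using posop_contraction_complement[OF c n] c by (simp_all add: a_def posop_def symm_diff)
  define Y where "Y = rec_nat 0 (\<lambda>_ y. (1/2) *\<^sub>R (a + (y o\<^sub>L y)))"
  \<comment> \<open>Scalar majorant: the same recursion with \<open>a\<close> replaced by the bound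
    1 for its norm. Its increments dominate those of \<open>Y\<close>, and it stays in
    [0, 1].\<close>
  define r :: "nat \<Rightarrow> real" where "r = rec_nat 0 (\<lambda>_ s. (1 + s * s) / 2)"
  have Y: "Y 0 = 0" "Y (Suc k) = (1/2) *\<^sub>R (a + (Y k o\<^sub>L Y k))" for k
    by (simp_all add: Y_def)
  have r: "r 0 = 0" "r (Suc k) = (1 + r k * r k) / 2" for k
    by (simp_all add: r_def)
  have r01: "0 \<le> r k \<and> r k \<le> 1" for k
    by (induction k) (auto simp: r mult_le_one)
  have Yr: "norm (Y k) \<le> r k" for k
  proof (induction k)
    case (Suc k)
    have "norm (a + (Y k o\<^sub>L Y k)) \<le> norm a + norm (Y k) * norm (Y k)"
      by (rule order_trans[OF norm_triangle_ineq add_left_mono[OF norm_blinfun_compose]])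
    also have "\<dots> \<le> 1 + r k * r k"
      using Suc r01[of k] by (intro add_mono a mult_mono) auto
    finally show ?case
      by (simp add: Y r)
  qed (simp add: Y r)
  have dY: "norm (Y (Suc k) - Y k) \<le> r (Suc k) - r k" for k
  proof (induction k)
    case 0
    show ?case using a by (simp add: Y r)
  next
    case (Suc k)
    let ?A = "Y (Suc k)" and ?B = "Y k"
    \<comment> \<open>Noncommutative difference of squares: A^2 - B^2 = (A - B) A + B (A -
      B).\<close>
    have "Y (Suc (Suc k)) - ?A = (1/2) *\<^sub>R (((?A - ?B) o\<^sub>L ?A) + (?B o\<^sub>L (?A - ?B)))"
      by (rule blinfun_eqI) (simp add: Y(2)[of "Suc k"] Y(2)[of k] blinfun.bilinear_simps algebra_simps)
    then have "norm (Y (Suc (Suc k)) - ?A) = norm (((?A - ?B) o\<^sub>L ?A) + (?B o\<^sub>L (?A - ?B))) / 2"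
      by simp
    also have "\<dots> \<le> (norm (?A - ?B) * norm ?A + norm ?B * norm (?A - ?B)) / 2"
      by (intro divide_right_mono norm_triangle_mono norm_blinfun_compose) simp
    also have "\<dots> \<le> ((r (Suc k) - r k) * r (Suc k) + r k * (r (Suc k) - r k)) / 2"
      using Suc Yr[of k] Yr[of "Suc k"] r01[of k] r01[of "Suc k"] order_trans[OF norm_ge_zero Suc]
      by (intro divide_right_mono add_mono mult_mono) auto
    also have "\<dots> = r (Suc (Suc k)) - r (Suc k)"
    proof -
      have "r k * r k = 2 * r (Suc k) - 1"
        by (simp add: r field_simps)
      then show ?thesis
        by (simp add: r(2)[of "Suc k"] field_simps)
    qed
    finally show ?case .
  qed
  \<comment> \<open>Monotonicity is a by-product of \<open>dY\<close>: the increments of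
    \<open>r\<close> bound norms.\<close>
  have "incseq r"
    using order_trans[OF norm_ge_zero dY] by (auto intro: incseq_SucI)
  then obtain l where "r \<longlonglongrightarrow> l"
    using incseq_convergent[of r 1] r01 by blast
  then have "summable (\<lambda>k. r (Suc k) - r k)"
    using telescope_summable by blast
  then have "summable (\<lambda>k. Y (Suc k) - Y k)"
    using dY by (intro summable_comparison_test[of "\<lambda>k. Y (Suc k) - Y k"]) auto
  then have "(\<lambda>m. \<Sum>k<m. Y (Suc k) - Y k) \<longlonglongrightarrow> (\<Sum>k. Y (Suc k) - Y k)"
    by (rule summable_LIMSEQ)
  then obtain L where L: "Y \<longlonglongrightarrow> L"
    by (auto simp: sum_lessThan_telescope Y(1))
  have Lp: "(\<lambda>n. Y n \<xi>) \<longlonglongrightarrow> L \<xi>" for \<xi>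
    by (intro tendsto_intros L)
  have "(\<lambda>n. (1/2) *\<^sub>R (a + (Y n o\<^sub>L Y n))) \<longlonglongrightarrow> (1/2) *\<^sub>R (a + (L o\<^sub>L L))"
    by (intro tendsto_intros L bounded_bilinear.tendsto[OF bounded_bilinear_blinfun_compose])
  moreover have "(\<lambda>n. (1/2) *\<^sub>R (a + (Y n o\<^sub>L Y n))) \<longlonglongrightarrow> L"
    using LIMSEQ_Suc[OF L] by (simp add: Y)
  ultimately have LL: "L = (1/2) *\<^sub>R (a + (L o\<^sub>L L))"
    by (rule LIMSEQ_unique[rotated])
  have nL: "norm L \<le> 1"
    using tendsto_norm[OF L] by (rule LIMSEQ_le_const2) (intro exI allI impI order_trans[OF Yr], simp add: r01)
  have sY: "symm (Y k)" for k
    by (induction k) (auto simp: Y intro!: symm_scaleR symm_add symm_square a)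
  have sL: "symm L"
    by (rule symm_limit[OF sY Lp])
  define z where "z = id_blinfun - L"
  have "posop z"
    unfolding posop_def z_def
  proof (intro conjI allI symm_diff symm_id sL)
    fix \<xi>
    have "inner (L \<xi>) \<xi> \<le> (norm \<xi>)\<^sup>2"
      using inner_le_norm_blinfun[of L \<xi>] mult_right_mono[OF nL, of "(norm \<xi>)\<^sup>2"] by simp
    then show "0 \<le> inner ((id_blinfun - L) \<xi>) \<xi>"
      by (simp add: blinfun.bilinear_simps inner_simps power2_norm_eq_inner)
  qed
  moreover have "z o\<^sub>L z = c"
  proof (rule blinfun_eqI)
    fix \<xi>
    have "2 *\<^sub>R L \<xi> = a \<xi> + L (L \<xi>)"
      using arg_cong[OF LL, of "\<lambda>f. 2 *\<^sub>R blinfun_apply f \<xi>"] by (simp add: blinfun.bilinear_simps)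
    then show "(z o\<^sub>L z) \<xi> = c \<xi>"
      by (simp add: z_def a_def blinfun.bilinear_simps scaleR_2 algebra_simps)
  qed
  moreover have "bicommuting c z"
    unfolding bicommuting_def
  proof (intro allI impI)
    fix u assume "commuting c u"
    then have "commuting a u"
      by (simp add: a_def commuting_diff)
    then have "commuting (Y k) u" for k
      by (induction k)
        (auto simp: Y commuting_iff[of 0] blinfun.bilinear_simps intro!: commuting_scaleR commuting_add commuting_compose)
    then show "commuting z u"
      by (simp add: z_def commuting_diff commuting_limit[OF _ Lp])
  qed
  ultimately show ?thesis
    by blast
qed

lemma posop_sqrt:
  fixes c :: "'a::{real_inner,banach} \<Rightarrow>\<^sub>L 'a"
  assumes c: "posop c"
  obtains z where "posop z" "z o\<^sub>L z = c" "bicommuting c z"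
proof -
  define k where "k = 1 + norm c"
  have k: "k > 0"
    by (simp add: k_def add_pos_nonneg)
  have p: "posop ((1/k) *\<^sub>R c)"
    using c k by (auto simp: posop_def symm_scaleR blinfun.bilinear_simps)
  moreover have "norm ((1/k) *\<^sub>R c) \<le> 1"
    using k by (simp add: k_def)
  ultimately obtain z where z: "posop z" "z o\<^sub>L z = (1/k) *\<^sub>R c" "bicommuting ((1/k) *\<^sub>R c) z"
    using posop_contraction_sqrt by blast
  show thesis
  proof
    show "posop (sqrt k *\<^sub>R z)"
      using z k by (auto simp: posop_def symm_scaleR blinfun.bilinear_simps)
    have "z (z \<xi>) = (1/k) *\<^sub>R c \<xi>" for \<xi>
      using arg_cong[OF z(2), of "\<lambda>f. blinfun_apply f \<xi>"] by (simp add: blinfun.bilinear_simps)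
    then show "sqrt k *\<^sub>R z o\<^sub>L sqrt k *\<^sub>R z = c"
      using k by (intro blinfun_eqI) (simp add: blinfun.bilinear_simps)
    show "bicommuting c (sqrt k *\<^sub>R z)"
      using z(3) by (auto simp: bicommuting_def intro!: commuting_scaleR)
  qed
qed

text \<open>After scaling to a contraction, c^2 <= c bounds the square of the norm of
  \<open>c \<xi>\<close> by the form at \<open>\<xi>\<close>.\<close>

lemma posop_eq_0:
  assumes c: "posop c" and 0: "inner (c \<xi>) \<xi> = 0"
  shows "c \<xi> = 0"
proof -
  have s: "symm c"
    using c by (simp add: posop_def)
  define k where "k = 1 + norm c"
  have k: "k > 0"
    by (simp add: k_def add_pos_nonneg)
  have "posop ((1/k) *\<^sub>R c)" "norm ((1/k) *\<^sub>R c) \<le> 1"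
    using c k by (auto simp: posop_def symm_scaleR blinfun.bilinear_simps) (simp add: k_def)
  from posop_contraction_ineq[OF this, of \<xi>] show ?thesis
    using 0 k by (simp add: blinfun.bilinear_simps)
qed

text \<open>The root \<open>y\<close> commutes with its square \<open>c\<close>, hence with
  \<open>z\<close>, which is in the bicommutant of \<open>c\<close>. So (y + z)(y - z) = 0, and
  positivity makes both \<open>y\<close> and \<open>z\<close> vanish on the range of y - z, which
  forces y = z.\<close>

lemma posop_sqrt_unique:
  fixes c :: "'a::{real_inner,banach} \<Rightarrow>\<^sub>L 'a"
  assumes y: "posop y" "y o\<^sub>L y = c" and z: "posop z" "z o\<^sub>L z = c" and b: "bicommuting c z"
  shows "y = z"
proof (rule blinfun_eqI)
  fix \<xi>
  have "commuting c y"
    using y(2) by (auto simp: commuting_iff simp flip: y(2))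
  then have zy: "z (y \<zeta>) = y (z \<zeta>)" for \<zeta>
    using b by (meson bicommutingD commutingD)
  define \<eta> where "\<eta> = y \<xi> - z \<xi>"
  have "y (y \<xi>) = z (z \<xi>)"
    using y(2) z(2) by (metis blinfun_apply_blinfun_compose)
  then have "y \<eta> + z \<eta> = 0"
    by (simp add: \<eta>_def blinfun.bilinear_simps zy)
  then have "inner (y \<eta>) \<eta> + inner (z \<eta>) \<eta> = 0"
    by (metis inner_add_left inner_zero_left)
  moreover have "0 \<le> inner (y \<eta>) \<eta>" "0 \<le> inner (z \<eta>) \<eta>"
    using y z by (simp_all add: posop_def)
  ultimately have "y \<eta> = 0" "z \<eta> = 0"
    using y z by (auto intro!: posop_eq_0)
  moreover have "inner \<eta> \<eta> = inner \<xi> (y \<eta>) - inner \<xi> (z \<eta>)"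
    using y z by (subst (1) \<eta>_def) (simp add: posop_def symm_def inner_simps)
  ultimately show "y \<xi> = z \<xi>"
    by (simp add: \<eta>_def)
qed


section \<open>Kernel projections and spectral cuts\<close>

lemma blinfun_pointwise_limit:
  fixes D :: "nat \<Rightarrow> 'a::real_normed_vector \<Rightarrow>\<^sub>L 'b::real_normed_vector"
  assumes "\<And>n. norm (D n) \<le> K" "\<And>\<xi>. convergent (\<lambda>n. D n \<xi>)"
  obtains P where "\<And>\<xi>. (\<lambda>n. D n \<xi>) \<longlonglongrightarrow> blinfun_apply P \<xi>"
proof -
  define f where "f \<xi> = lim (\<lambda>n. D n \<xi>)" for \<xi>
  have f: "(\<lambda>n. D n \<xi>) \<longlonglongrightarrow> f \<xi>" for \<xi>
    using assms(2) by (simp add: f_def convergent_LIMSEQ_iff)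
  have "bounded_linear f"
  proof (rule bounded_linear_intro[where K = K])
    fix \<xi> \<eta> :: 'a and r :: real
    show "f (\<xi> + \<eta>) = f \<xi> + f \<eta>"
      using tendsto_add[OF f f, of \<xi> \<eta>] f[of "\<xi> + \<eta>"]
      by (simp add: LIMSEQ_unique blinfun.bilinear_simps)
    show "f (r *\<^sub>R \<xi>) = r *\<^sub>R f \<xi>"
      using tendsto_scaleR[OF tendsto_const f, of r \<xi>] f[of "r *\<^sub>R \<xi>"]
      by (simp add: LIMSEQ_unique blinfun.bilinear_simps)
    have "norm (D n \<xi>) \<le> norm \<xi> * K" for n
      using norm_blinfun[of "D n" \<xi>] mult_right_mono[OF assms(1), of "norm \<xi>" n]
      by (simp add: mult.commute)
    then show "norm (f \<xi>) \<le> norm \<xi> * K"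
      using tendsto_norm[OF f[of \<xi>]] LIMSEQ_le_const2 by blast
  qed
  then show thesis
    using f that[of "Blinfun f"] by (simp add: bounded_linear_Blinfun_apply)
qed

lemma projD: "proj p \<Longrightarrow> p (p \<xi>) = p \<xi>"
  unfolding proj_def by (metis blinfun_apply_blinfun_compose)

text \<open>Mean ergodic argument: for a positive contraction \<open>c\<close> the even powers of \<open>1 - c\<close>
  converge strongly to the projection onto the kernel of \<open>c\<close>. Unlike the construction of an
  orthogonal projection by minimal distance, this makes it evident what the limit commutes with.\<close>

lemma kernel_projection:
  fixes h :: "'a::{real_inner,banach} \<Rightarrow>\<^sub>L 'a"
  assumes h: "symm h"
  obtains P where "proj P" "bicommuting h P" "\<And>\<xi>. P \<xi> = \<xi> \<longleftrightarrow> h \<xi> = 0"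
proof -
  define s where "s = 1 / (1 + norm h)\<^sup>2"
  have "1 + norm h > 0"
    by (simp add: add_pos_nonneg)
  then have s: "s > 0" "s * (norm h * norm h) \<le> 1"
    using mult_le_one[of "norm h / (1 + norm h)" "norm h / (1 + norm h)"]
    by (simp_all add: s_def power2_eq_square)
  define c where "c = s *\<^sub>R (h o\<^sub>L h)"
  have c: "posop c" "norm c \<le> 1"
  proof -
    show "posop c"
      using posop_square[OF h] s by (auto simp: c_def posop_def symm_scaleR blinfun.bilinear_simps)
    have "norm c \<le> s * (norm h * norm h)"
      using s norm_blinfun_compose[of h h] by (simp add: c_def)
    then show "norm c \<le> 1"
      using s by simp
  qed
  have c0: "h \<xi> = 0" if "inner (c \<xi>) \<xi> = 0" for \<xi>
    using that inner_square[OF h, of \<xi>] s by (simp add: c_def blinfun.bilinear_simps)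
  define d where "d = id_blinfun - c"
  have d: "symm d" "norm d \<le> 1"
    using c by (simp_all add: d_def posop_def symm_diff posop_contraction_complement)
  define D where "D = rec_nat id_blinfun (\<lambda>_ D. d o\<^sub>L D)"
  have D: "D 0 = id_blinfun" "D (Suc n) = d o\<^sub>L D n" for n
    by (simp_all add: D_def)
  have Dcomm: "commuting (D n) u" if "commuting h u" for n u
  proof (induction n)
    case (Suc n)
    then show ?case
      using that by (auto simp: D d_def c_def intro!: commuting_compose commuting_diff commuting_scaleR)
  qed (simp add: D)
  have "commuting h d"
    by (rule commuting_sym) (auto simp: d_def c_def intro!: commuting_diff commuting_scaleR commuting_compose)
  note Dd = Dcomm[OF this]
  have Dsymm: "symm (D n)" for n
    by (induction n) (auto simp: D intro!: symm_compose d commuting_sym[OF Dd])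
  have Dle1: "norm (D n) \<le> 1" for n
  proof (induction n)
    case (Suc n)
    have "norm (D (Suc n)) \<le> norm d * norm (D n)"
      by (simp add: D norm_blinfun_compose)
    also have "\<dots> \<le> 1"
      using Suc d by (simp add: mult_le_one)
    finally show ?case .
  qed (simp add: D norm_blinfun_id_le)
  have Dadd: "D (m + n) \<xi> = D m (D n \<xi>)" for m n \<xi>
    by (induction m) (simp_all add: D)
  have conv: "convergent (\<lambda>n. D (2 * n) \<xi>)" for \<xi>
  proof -
    define b where "b n = (norm (D n \<xi>))\<^sup>2" for n
    \<comment> \<open>Reason for using even powers: their inner products are squared norms that
      depend on n + m only. The sequence of squared norms decreases, so the Cauchy property of
      vectors reduces to that of \<open>b\<close>.\<close>
    have ip: "inner (D (2 * n) \<xi>) (D (2 * m) \<xi>) = b (n + m)" for m n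
    proof -
      have "inner (D (2 * n) \<xi>) (D (2 * m) \<xi>) = inner \<xi> (D (2 * n + 2 * m) \<xi>)"
        by (simp add: symmD[OF Dsymm] Dadd)
      also have "2 * n + 2 * m = (n + m) + (n + m)"
        by simp
      also have "inner \<xi> (D ((n + m) + (n + m)) \<xi>) = b (n + m)"
        unfolding Dadd[of "n + m" "n + m"] by (simp add: b_def power2_norm_eq_inner symmD[OF Dsymm])
      finally show ?thesis .
    qed
    have "norm (d \<zeta>) \<le> norm \<zeta>" for \<zeta>
      using norm_blinfun[of d \<zeta>] mult_right_mono[OF d(2), of "norm \<zeta>"] by simp
    then have "decseq b"
      by (intro decseq_SucI) (simp add: b_def D)
    then have "convergent b"
      using decseq_convergent[of b 0] by (auto simp: b_def convergent_def)
    then have Cb: "Cauchy b"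
      by (rule convergent_Cauchy)
    have "Cauchy (\<lambda>n. D (2 * n) \<xi>)"
    proof (rule CauchyI)
      fix e :: real assume "0 < e"
      then have "0 < e\<^sup>2 / 2"
        by simp
      then obtain N where N: "\<And>m n. m \<ge> N \<Longrightarrow> n \<ge> N \<Longrightarrow> \<bar>b m - b n\<bar> < e\<^sup>2 / 2"
        using CauchyD[OF Cb] by (metis real_norm_def)
      have "norm (D (2 * m) \<xi> - D (2 * n) \<xi>) < e" if "m \<ge> N" "n \<ge> N" for m n
      proof -
        have "(norm (D (2 * m) \<xi> - D (2 * n) \<xi>))\<^sup>2 = (b (m + m) - b (m + n)) + (b (n + n) - b (m + n))"
          by (simp add: power2_norm_eq_inner inner_diff_left inner_diff_right ip add.commute)
        also have "\<dots> < e\<^sup>2"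
        proof -
          have "\<bar>b (m + m) - b (m + n)\<bar> < e\<^sup>2 / 2" "\<bar>b (n + n) - b (m + n)\<bar> < e\<^sup>2 / 2"
            using that by (intro N; simp)+
          then show ?thesis
            by linarith
        qed
        finally show ?thesis
          using \<open>0 < e\<close> by (simp add: power_less_imp_less_base)
      qed
      then show "\<exists>N. \<forall>m\<ge>N. \<forall>n\<ge>N. norm (D (2 * m) \<xi> - D (2 * n) \<xi>) < e"
        by blast
    qed
    then show ?thesis
      by (rule Cauchy_convergent)
  qed
  obtain P where P: "\<And>\<xi>. (\<lambda>n. D (2 * n) \<xi>) \<longlonglongrightarrow> blinfun_apply P \<xi>"
    using blinfun_pointwise_limit[of "\<lambda>n. D (2 * n)" 1] Dle1 conv by blast
  have ddP: "d (d (P \<xi>)) = P \<xi>" for \<xi>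
  proof -
    have "(\<lambda>n. d (d (D (2 * n) \<xi>))) \<longlonglongrightarrow> d (d (P \<xi>))"
      by (intro tendsto_intros P)
    moreover have "(\<lambda>n. d (d (D (2 * n) \<xi>))) \<longlonglongrightarrow> P \<xi>"
      using LIMSEQ_Suc[OF P[of \<xi>]] by (simp add: D)
    ultimately show ?thesis
      by (rule LIMSEQ_unique)
  qed
  show thesis
  proof
    have "D (2 * n) (P \<xi>) = P \<xi>" for n \<xi>
      by (induction n) (simp_all add: D ddP)
    then have "P (P \<xi>) = P \<xi>" for \<xi>
      using P[of "P \<xi>"] by (simp add: LIMSEQ_const_iff)
    then show "proj P"
      using symm_limit[OF Dsymm P] by (auto simp: proj_def intro: blinfun_eqI)
    show "bicommuting h P"
      unfolding bicommuting_def using commuting_limit[OF Dcomm P] by blast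
    show "P \<xi> = \<xi> \<longleftrightarrow> h \<xi> = 0" for \<xi>
    proof
      assume "h \<xi> = 0"
      then have "d \<xi> = \<xi>"
        by (simp add: d_def c_def blinfun.bilinear_simps)
      then have "D n \<xi> = \<xi>" for n
        by (induction n) (simp_all add: D)
      then show "P \<xi> = \<xi>"
        using P[of \<xi>] by (simp add: LIMSEQ_const_iff)
    next
      assume "P \<xi> = \<xi>"
      \<comment> \<open>A vector fixed by d^2 loses no norm under the contraction \<open>d\<close>;
        expanding the norm of \<xi> - c \<xi> and using c^2 <= c then leaves no room for a positive
        form of \<open>c\<close>.\<close>
      then have "norm \<xi> = norm (d (d \<xi>))"
        using ddP[of \<xi>] by simp
      also have "\<dots> \<le> norm (d \<xi>)"
        using norm_blinfun[of d "d \<xi>"] mult_right_mono[OF d(2), of "norm (d \<xi>)"] by simp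
      finally have "(norm \<xi>)\<^sup>2 \<le> (norm (d \<xi>))\<^sup>2"
        by simp
      also have "\<dots> = (norm \<xi>)\<^sup>2 - 2 * inner (c \<xi>) \<xi> + (norm (c \<xi>))\<^sup>2"
        by (simp add: d_def blinfun.bilinear_simps power2_norm_eq_inner inner_simps inner_commute)
      finally have "inner (c \<xi>) \<xi> \<le> 0"
        using posop_contraction_ineq[OF c, of \<xi>] by simp
      then have "inner (c \<xi>) \<xi> = 0"
        using c by (simp add: posop_def antisym)
      then show "h \<xi> = 0"
        by (rule c0)
    qed
  qed
qed

text \<open>Whatever commutes with \<open>b\<close> commutes with b^2, so the last property implies
  the third. The stronger one is recorded because uniqueness of positive roots asks for the
  bicommutant of the square.\<close>

lemma absolute_value_exists:
  fixes b :: "'a::{real_inner,banach} \<Rightarrow>\<^sub>L 'a"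
  assumes "symm b"
  obtains a where "posop a" "a o\<^sub>L a = b o\<^sub>L b" "bicommuting b a" "bicommuting (b o\<^sub>L b) a"
proof -
  obtain a where a: "posop a" "a o\<^sub>L a = b o\<^sub>L b" "bicommuting (b o\<^sub>L b) a"
    using posop_sqrt[OF posop_square[OF assms]] by blast
  moreover have "bicommuting b a"
    using a(3) by (auto simp: bicommuting_def intro: commuting_compose)
  ultimately show thesis
    using that by blast
qed

text \<open>The spectral projection of \<open>x\<close> for \<open>]-\<infinity>, t]\<close>, obtained as the projection onto the kernel
  of \<open>|x - t| + (x - t)\<close>, that is, of twice the positive part of \<open>x - t\<close>.\<close>

lemma spectral_cut:
  fixes x :: "'a::{real_inner,banach} \<Rightarrow>\<^sub>L 'a"
  assumes x: "symm x"
  obtains P where "proj P" "bicommuting x P"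
    "\<And>\<xi>. P \<xi> = \<xi> \<Longrightarrow> inner (x \<xi>) \<xi> \<le> t * (norm \<xi>)\<^sup>2"
    "\<And>\<xi>. P \<xi> = 0 \<Longrightarrow> \<xi> \<noteq> 0 \<Longrightarrow> t * (norm \<xi>)\<^sup>2 < inner (x \<xi>) \<xi>"
proof -
  define b where "b = x - t *\<^sub>R id_blinfun"
  have b: "symm b" "\<And>u. commuting x u \<Longrightarrow> commuting b u"
    using x by (auto simp: b_def intro!: symm_diff symm_scaleR commuting_diff commuting_scaleR)
  have ib: "inner (b \<xi>) \<xi> = inner (x \<xi>) \<xi> - t * (norm \<xi>)\<^sup>2" for \<xi>
    by (simp add: b_def blinfun.bilinear_simps inner_simps power2_norm_eq_inner)
  obtain a where a: "posop a" "a o\<^sub>L a = b o\<^sub>L b" "bicommuting b a"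
    using absolute_value_exists[OF b(1)] by blast
  have aa: "a (a \<xi>) = b (b \<xi>)" for \<xi>
    using a(2) by (metis blinfun_apply_blinfun_compose)
  have ab: "a (b \<xi>) = b (a \<xi>)" for \<xi>
    using commutingD[OF bicommuting_self[OF a(3)]] .
  have "symm (a + b)"
    using a(1) b(1) by (simp add: posop_def symm_add)
  then obtain P where P: "proj P" "bicommuting (a + b) P" "\<And>\<xi>. P \<xi> = \<xi> \<longleftrightarrow> (a + b) \<xi> = 0"
    using kernel_projection by blast
  have Pk: "P \<xi> = \<xi> \<longleftrightarrow> a \<xi> + b \<xi> = 0" for \<xi>
    using P(3) by (simp add: blinfun.bilinear_simps)
  have bi: "bicommuting x P"
    unfolding bicommuting_def
    using P(2) a(3) b(2) by (auto intro!: bicommutingD[OF P(2)] commuting_add bicommutingD[OF a(3)])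
  show thesis
  proof
    fix \<xi>
    show "inner (x \<xi>) \<xi> \<le> t * (norm \<xi>)\<^sup>2" if "P \<xi> = \<xi>"
    proof -
      have "b \<xi> = - a \<xi>"
        using that Pk by (simp add: eq_neg_iff_add_eq_0 add.commute)
      then have "inner (b \<xi>) \<xi> = - inner (a \<xi>) \<xi>"
        by simp
      moreover have "0 \<le> inner (a \<xi>) \<xi>"
        using a(1) by (simp add: posop_def)
      ultimately show ?thesis
        using ib[of \<xi>] by simp
    qed
    show "t * (norm \<xi>)\<^sup>2 < inner (x \<xi>) \<xi>" if "P \<xi> = 0" "\<xi> \<noteq> 0"
    proof -
      \<comment> \<open>Since (a + b)(a - b) = a^2 - b^2 = 0, this vector is in the range of
        \<open>P\<close>; as \<open>P\<close> commutes with \<open>a\<close> and \<open>b\<close>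
        and kills \<open>\<xi>\<close>, it is also in the kernel. Hence \<open>a\<close> and
        \<open>b\<close> agree at \<open>\<xi>\<close>.\<close>
      define \<zeta> where "\<zeta> = a \<xi> - b \<xi>"
      have "a \<zeta> + b \<zeta> = 0"
        by (simp add: \<zeta>_def blinfun.bilinear_simps aa ab)
      then have "P \<zeta> = \<zeta>"
        using Pk by blast
      moreover have "commuting P a" "commuting P b"
        by (rule bicommutingD[OF P(2)], simp add: commuting_iff blinfun.bilinear_simps ab)+
      then have "P \<zeta> = 0"
        using that by (simp add: \<zeta>_def blinfun.bilinear_simps commutingD[of P])
      ultimately have eq: "a \<xi> = b \<xi>"
        by (simp add: \<zeta>_def)
      have "inner (a \<xi>) \<xi> \<noteq> 0"
      proof
        assume "inner (a \<xi>) \<xi> = 0"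
        then have "a \<xi> = 0"
          by (rule posop_eq_0[OF a(1)])
        then have "P \<xi> = \<xi>"
          using Pk eq by simp
        then show False
          using that by simp
      qed
      moreover have "0 \<le> inner (a \<xi>) \<xi>"
        using a(1) by (simp add: posop_def)
      ultimately show ?thesis
        using ib[of \<xi>] eq by simp
    qed
  qed (use P bi in auto)
qed

section \<open>Spectral resolution\<close>

lemma proj_symm: "proj p \<Longrightarrow> symm p"
  by (simp add: proj_def)

lemma proj_inner:
  fixes p :: "'a::real_inner \<Rightarrow>\<^sub>L 'a"
  shows "proj p \<Longrightarrow> inner (p \<xi>) \<xi> = (norm (p \<xi>))\<^sup>2"
  using inner_square[of p \<xi>] by (simp add: projD proj_symm)

lemma proj_id [simp]: "proj id_blinfun"
  by (simp add: proj_def) (auto intro: blinfun_eqI)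

lemma proj_complement: "proj p \<Longrightarrow> proj (id_blinfun - p)"
  unfolding proj_def
  by (auto simp: symm_diff blinfun.bilinear_simps intro!: blinfun_eqI) (metis blinfun_apply_blinfun_compose)

lemma proj_compose:
  assumes "proj p" "proj q" "commuting p q"
  shows "proj (p o\<^sub>L q)"
proof -
  have "p (q (p (q \<xi>))) = p (q \<xi>)" for \<xi>
    using assms by (metis commutingD projD)
  then show ?thesis
    using assms by (auto simp: proj_def symm_compose intro!: blinfun_eqI)
qed

lemma proj_add:
  assumes "proj p" "proj q" "\<And>\<xi>. p (q \<xi>) = 0" "\<And>\<xi>. q (p \<xi>) = 0"
  shows "proj (p + q)"
  unfolding proj_def
  using assms by (auto simp: symm_add proj_symm projD blinfun.bilinear_simps intro!: blinfun_eqI)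

text \<open>By commutation, (1 - q) p \<open>\<xi>\<close> lies in the range of \<open>p\<close> and
  in the kernel of \<open>q\<close>. All comparisons of projections below rest on this criterion,
  with \<open>0\<close> supplied by form bounds.\<close>

lemma proj_absorb:
  assumes p: "proj p" and q: "proj q" and c: "commuting p q"
    and 0: "\<And>\<xi>. p \<xi> = \<xi> \<Longrightarrow> q \<xi> = 0 \<Longrightarrow> \<xi> = 0"
  shows "q (p \<xi>) = p \<xi>"
proof -
  define \<zeta> where "\<zeta> = p \<xi> - q (p \<xi>)"
  have "p \<zeta> = \<zeta>" "q \<zeta> = 0"
    using p q c by (simp_all add: \<zeta>_def blinfun.bilinear_simps projD commutingD[of p q])
  then have "\<zeta> = 0"
    by (rule 0)
  then show ?thesis
    by (simp add: \<zeta>_def)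
qed

text \<open>A difference of nested projections is a projection, whose form is a squared norm. This
  turns convergence of measures into strong convergence of projections.\<close>

lemma nested_proj_dist:
  fixes p q :: "'a::real_inner \<Rightarrow>\<^sub>L 'a"
  assumes p: "proj p" and q: "proj q" and pq: "p (q \<xi>) = p \<xi>"
  shows "(norm (q \<xi> - p \<xi>))\<^sup>2 = inner (q \<xi>) \<xi> - inner (p \<xi>) \<xi>"
proof -
  have "inner (p \<xi>) (q \<xi>) = inner (p (q \<xi>)) \<xi>"
    using p by (simp add: proj_symm symm_inner)
  then have "inner (p \<xi>) (q \<xi>) = inner (p \<xi>) \<xi>"
    by (simp add: pq)
  then show ?thesis
    using proj_inner[OF p, of \<xi>] proj_inner[OF q, of \<xi>]
    by (simp add: power2_norm_eq_inner inner_diff_left inner_diff_right inner_commute)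
qed

text \<open>Squared distances are bounded by differences of the forms. The disjunction in
  \<open>nested\<close> covers increasing and decreasing sequences alike.\<close>

lemma nested_proj_convergent:
  fixes S :: "nat \<Rightarrow> 'a::{real_inner,banach} \<Rightarrow>\<^sub>L 'a"
  assumes S: "\<And>n. proj (S n)"
    and nested: "\<And>m n. S m (S n \<xi>) = S m \<xi> \<or> S n (S m \<xi>) = S n \<xi>"
    and conv: "convergent (\<lambda>n. inner (S n \<xi>) \<xi>)"
  shows "convergent (\<lambda>n. S n \<xi>)"
proof (rule Cauchy_convergent, rule CauchyI)
  define b where "b n = inner (S n \<xi>) \<xi>" for n
  have Cb: "Cauchy b"
    using convergent_Cauchy[OF conv] unfolding b_def .
  have dist: "(norm (S m \<xi> - S n \<xi>))\<^sup>2 \<le> \<bar>b m - b n\<bar>" for m n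
    using nested[of m n]
  proof
    assume "S m (S n \<xi>) = S m \<xi>"
    from nested_proj_dist[OF S S this] show ?thesis
      by (simp add: b_def norm_minus_commute)
  next
    assume "S n (S m \<xi>) = S n \<xi>"
    from nested_proj_dist[OF S S this] show ?thesis
      by (simp add: b_def)
  qed
  fix e :: real assume "0 < e"
  then have "0 < e\<^sup>2"
    by simp
  then obtain N where N: "\<And>m n. m \<ge> N \<Longrightarrow> n \<ge> N \<Longrightarrow> \<bar>b m - b n\<bar> < e\<^sup>2"
    using CauchyD[OF Cb] by (metis real_norm_def)
  have "norm (S m \<xi> - S n \<xi>) < e" if "m \<ge> N" "n \<ge> N" for m n
    using le_less_trans[OF dist N[OF that]] \<open>0 < e\<close> by (simp add: power_less_imp_less_base)
  then show "\<exists>N. \<forall>m\<ge>N. \<forall>n\<ge>N. norm (S m \<xi> - S n \<xi>) < e"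
    by blast
qed

text \<open>If the form of the symmetric difference \<open>d\<close> vanishes, then its value at
  \<open>\<xi> + d \<xi>\<close> is twice the squared norm of \<open>d \<xi>\<close>.\<close>

lemma symm_eqI:
  fixes x y :: "'a::real_inner \<Rightarrow>\<^sub>L 'a"
  assumes x: "symm x" and y: "symm y" and eq: "\<And>\<xi>. inner (x \<xi>) \<xi> = inner (y \<xi>) \<xi>"
  shows "x = y"
proof (rule blinfun_eqI)
  fix \<xi>
  define d where "d = x - y"
  have d: "symm d" "\<And>\<xi>. inner (d \<xi>) \<xi> = 0"
    using x y eq by (simp_all add: d_def symm_diff blinfun.bilinear_simps inner_diff_left)
  have "inner (d (\<xi> + d \<xi>)) (\<xi> + d \<xi>) = 0"
    by (rule d)
  then have "2 * inner (d \<xi>) (d \<xi>) = 0"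
    using d(2)[of \<xi>] d(2)[of "d \<xi>"] symmD[OF d(1), of "d \<xi>" \<xi>] 
    by (simp add: blinfun.bilinear_simps inner_simps inner_commute)
  then have "d \<xi> = 0"
    by simp
  then show "x \<xi> = y \<xi>"
    by (simp add: d_def blinfun.bilinear_simps)
qed

lemma sets_borel_atMost: "sets borel = sigma_sets UNIV (range (\<lambda>a::real. {..a}))"
  by (subst borel_eq_atMost) simp

text \<open>The Dynkin-system step: a family of projections representing the measures of \<open>\<mu>\<close> on the
  half-lines extends to all Borel sets. Disjoint sets automatically get orthogonal projections,
  because \<open>\<mu> \<zeta> UNIV = \<parallel>\<zeta>\<parallel>\<^sup>2\<close> leaves no room for a vector \<open>\<zeta>\<close> in the range of one of them to
  have a component in the range of the other.\<close>

lemma projections_from_measures: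
  fixes x :: "'a::{real_inner,banach} \<Rightarrow>\<^sub>L 'a" and \<mu> :: "'a \<Rightarrow> real measure"
  assumes fin: "\<And>\<xi>. finite_borel_measure (\<mu> \<xi>)"
    and UNIV: "\<And>\<xi>. measure (\<mu> \<xi>) UNIV = (norm \<xi>)\<^sup>2"
    and half: "\<And>t. \<exists>p. proj p \<and> bicommuting x p \<and> (\<forall>\<xi>. inner (p \<xi>) \<xi> = measure (\<mu> \<xi>) {..t})"
    and B: "B \<in> sets borel"
  shows "\<exists>p. proj p \<and> bicommuting x p \<and> (\<forall>\<xi>. inner (p \<xi>) \<xi> = measure (\<mu> \<xi>) B)"
proof -
  have sets: "sets (\<mu> \<xi>) = sets borel" for \<xi>
    using fin finite_borel_measure.M_is_borel by blast
  have fm: "finite_measure (\<mu> \<xi>)" for \<xi>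
    using fin finite_borel_measure_def by blast
  have sp: "space (\<mu> \<xi>) = UNIV" for \<xi>
    using sets_eq_imp_space_eq[OF sets] by simp
  have int: "Int_stable (range (\<lambda>a::real. {..a}))"
    by (auto simp: Int_stable_def)
  from B have "B \<in> sigma_sets UNIV (range (\<lambda>a::real. {..a}))"
    by (simp add: sets_borel_atMost)
  with int subset_UNIV[of "range (\<lambda>a::real. {..a})", folded Pow_UNIV] show ?thesis
  proof (induction rule: sigma_sets_induct_disjoint)
    case (basic A)
    then show ?case
      using half by auto
  next
    case empty
    have "proj (0 :: 'a \<Rightarrow>\<^sub>L 'a)" "bicommuting x 0"
      by (simp_all add: proj_def bicommuting_def commuting_iff blinfun.bilinear_simps)
    then show ?case
      by (intro exI[of _ 0]) (simp add: blinfun.bilinear_simps)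
  next
    case (compl A)
    then obtain p where p: "proj p" "bicommuting x p" "\<And>\<xi>. inner (p \<xi>) \<xi> = measure (\<mu> \<xi>) A"
      by blast
    have A: "A \<in> sets borel"
      using compl by (simp add: sets_borel_atMost)
    have "measure (\<mu> \<xi>) (UNIV - A) = (norm \<xi>)\<^sup>2 - measure (\<mu> \<xi>) A" for \<xi>
      using finite_measure.finite_measure_compl[OF fm, of A \<xi>] A by (simp add: sets sp UNIV)
    then show ?case
      using p by (intro exI[of _ "id_blinfun - p"])
        (auto simp: proj_complement bicommuting_def commuting_diff blinfun.bilinear_simps inner_diff_left power2_norm_eq_inner)
  next
    case (union A)
    then have "\<forall>i. \<exists>p. proj p \<and> bicommuting x p \<and> (\<forall>\<xi>. inner (p \<xi>) \<xi> = measure (\<mu> \<xi>) (A i))"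
      by blast
    then obtain p where p: "\<And>i. proj (p i)" "\<And>i. bicommuting x (p i)"
      "\<And>i \<xi>. inner (p i \<xi>) \<xi> = measure (\<mu> \<xi>) (A i)"
      by metis
    have A: "A i \<in> sets borel" for i
      using union by (auto simp: sets_borel_atMost)
    have orth: "p i (p j \<xi>) = 0" if "i \<noteq> j" for i j \<xi>
    proof -
      define \<zeta> where "\<zeta> = p j \<xi>"
      interpret finite_measure "\<mu> \<zeta>"
        by (rule fm)
      have "A i \<inter> A j = {}"
        using union(1) that by (auto simp: disjoint_family_on_def)
      then have "measure (\<mu> \<zeta>) (A i) + measure (\<mu> \<zeta>) (A j) = measure (\<mu> \<zeta>) (A i \<union> A j)"
        using A by (intro finite_measure_Union[symmetric]) (simp_all add: sets)
      also have "\<dots> \<le> (norm \<zeta>)\<^sup>2"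
        using bounded_measure[of "A i \<union> A j"] by (simp add: sp UNIV)
      finally have "(norm (p i \<zeta>))\<^sup>2 + (norm (p j \<zeta>))\<^sup>2 \<le> (norm \<zeta>)\<^sup>2"
        by (simp add: p(3)[symmetric] proj_inner[OF p(1)])
      moreover have "p j \<zeta> = \<zeta>"
        by (simp add: \<zeta>_def projD[OF p(1)])
      ultimately show ?thesis
        by (simp add: \<zeta>_def)
    qed
    define S where "S n = (\<Sum>i<n. p i)" for n
    have S: "S 0 = 0" "S (Suc n) = S n + p n" for n
      by (simp_all add: S_def)
    have S_lt: "S n (p i \<xi>) = 0 \<and> p i (S n \<xi>) = 0" if "n \<le> i" for n i \<xi>
      using that by (induction n) (simp_all add: S blinfun.bilinear_simps orth)
    have S_proj: "proj (S n)" for n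
    proof (induction n)
      case 0
      show ?case by (simp add: S proj_def)
    next
      case (Suc n)
      then show ?case
        unfolding S by (intro proj_add p) (simp_all add: S_lt)
    qed
    have S_nested: "S m (S n \<xi>) = S m \<xi>" if "m \<le> n" for m n \<xi>
      using that
    proof (induction n rule: dec_induct)
      case base
      show ?case by (rule projD[OF S_proj])
    next
      case (step n)
      then show ?case by (simp add: S blinfun.bilinear_simps S_lt)
    qed
    have S_inner: "inner (S n \<xi>) \<xi> = (\<Sum>i<n. measure (\<mu> \<xi>) (A i))" for n \<xi>
      by (induction n) (simp_all add: S blinfun.bilinear_simps inner_add_left p(3))
    have lim: "(\<lambda>n. inner (S n \<xi>) \<xi>) \<longlonglongrightarrow> measure (\<mu> \<xi>) (\<Union>i. A i)" for \<xi>
      unfolding S_inner using finite_measure.finite_measure_UNION[OF fm, of A \<xi>] A union(1)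
      by (auto simp: sums_def sets)
    have conv: "convergent (\<lambda>n. S n \<xi>)" for \<xi>
    proof (rule nested_proj_convergent[OF S_proj])
      show "S m (S n \<xi>) = S m \<xi> \<or> S n (S m \<xi>) = S n \<xi>" for m n
        using S_nested[of m n] S_nested[of n m] by (cases "m \<le> n") auto
      show "convergent (\<lambda>n. inner (S n \<xi>) \<xi>)"
        using lim convergent_def by blast
    qed
    have "norm (S n) \<le> 1" for n
    proof (rule norm_blinfun_le_square_bound)
      fix \<xi>
      have "(norm \<xi>)\<^sup>2 - inner (S n \<xi>) \<xi> = (norm (\<xi> - S n \<xi>))\<^sup>2"
        using nested_proj_dist[OF S_proj[of n] proj_id, of \<xi>] by (simp add: power2_norm_eq_inner)
      then have "inner (S n \<xi>) \<xi> \<le> (norm \<xi>)\<^sup>2"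
        by (smt (verit) zero_le_power2)
      then show "(norm (S n \<xi>))\<^sup>2 \<le> (1 * norm \<xi>)\<^sup>2"
        by (simp add: proj_inner[OF S_proj])
    qed simp
    then obtain P where P: "\<And>\<xi>. (\<lambda>n. S n \<xi>) \<longlonglongrightarrow> blinfun_apply P \<xi>"
      using blinfun_pointwise_limit[of S 1] conv by blast
    \<comment> \<open>The sequence is constant from n = m on, since the partial sums are nested;
      idempotence of \<open>P\<close> follows by letting m grow.\<close>
    have SP: "S m (P \<xi>) = S m \<xi>" for m \<xi>
    proof -
      have "(\<lambda>n. S m (S n \<xi>)) \<longlonglongrightarrow> S m (P \<xi>)"
        by (intro tendsto_intros P)
      moreover have "(\<lambda>n. S m (S n \<xi>)) \<longlonglongrightarrow> S m \<xi>"
        using S_nested by (intro tendsto_eventually) (auto simp: eventually_sequentially)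
      ultimately show ?thesis
        by (rule LIMSEQ_unique)
    qed
    have "P (P \<xi>) = P \<xi>" for \<xi>
      using P[of "P \<xi>"] P[of \<xi>] by (simp add: SP LIMSEQ_unique)
    moreover have "symm P"
      by (rule symm_limit[OF proj_symm[OF S_proj] P])
    ultimately have "proj P"
      by (auto simp: proj_def intro: blinfun_eqI)
    moreover have "bicommuting x P"
      unfolding bicommuting_def
    proof (intro allI impI)
      fix u assume u: "commuting x u"
      have "commuting (S n) u" for n
        by (induction n)
          (auto simp: S commuting_iff[of 0] blinfun.bilinear_simps intro!: commuting_add bicommutingD[OF p(2) u])
      then show "commuting P u"
        by (rule commuting_limit[OF _ P])
    qed
    moreover have "inner (P \<xi>) \<xi> = measure (\<mu> \<xi>) (\<Union>i. A i)" for \<xi>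
      using tendsto_inner[OF P[of \<xi>] tendsto_const] lim by (rule LIMSEQ_unique)
    ultimately show ?case
      by blast
  qed
qed

text \<open>The spectral cuts \<open>Q t\<close> give functions t -> <\<open>Q t \<xi>\<close>,
  \<open>\<xi>\<close>>, which are Stieltjes distribution functions. Their monotonicity and right
  continuity come from the strict bound on the kernel of \<open>Q t\<close>.\<close>

lemma spectral_resolution:
  fixes x :: "'a::{real_inner,banach} \<Rightarrow>\<^sub>L 'a"
  assumes x: "symm x"
  obtains E :: "real set \<Rightarrow> 'a \<Rightarrow>\<^sub>L 'a" and \<mu> :: "'a \<Rightarrow> real measure"
  where "\<And>\<xi>. finite_borel_measure (\<mu> \<xi>)"
    "\<And>\<xi>. measure (\<mu> \<xi>) UNIV = (norm \<xi>)\<^sup>2"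
    "\<And>B. B \<in> sets borel \<Longrightarrow> proj (E B)"
    "\<And>B. B \<in> sets borel \<Longrightarrow> bicommuting x (E B)"
    "\<And>B \<xi>. B \<in> sets borel \<Longrightarrow> inner (E B \<xi>) \<xi> = measure (\<mu> \<xi>) B"
    "\<And>t \<xi>. E {..t} \<xi> = \<xi> \<Longrightarrow> inner (x \<xi>) \<xi> \<le> t * (norm \<xi>)\<^sup>2"
    "\<And>t \<xi>. E {..t} \<xi> = 0 \<Longrightarrow> t * (norm \<xi>)\<^sup>2 \<le> inner (x \<xi>) \<xi>"
proof -
  have "\<forall>t. \<exists>P. proj P \<and> bicommuting x P \<and> (\<forall>\<xi>. P \<xi> = \<xi> \<longrightarrow> inner (x \<xi>) \<xi> \<le> t * (norm \<xi>)\<^sup>2) \<and>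
      (\<forall>\<xi>. P \<xi> = 0 \<longrightarrow> \<xi> \<noteq> 0 \<longrightarrow> t * (norm \<xi>)\<^sup>2 < inner (x \<xi>) \<xi>)"
    using spectral_cut[OF x] by metis
  then obtain Q where Q: "\<And>t. proj (Q t)" "\<And>t. bicommuting x (Q t)"
    and Qle: "\<And>t \<xi>. Q t \<xi> = \<xi> \<Longrightarrow> inner (x \<xi>) \<xi> \<le> t * (norm \<xi>)\<^sup>2"
    and Qgt: "\<And>t \<xi>. Q t \<xi> = 0 \<Longrightarrow> \<xi> \<noteq> 0 \<Longrightarrow> t * (norm \<xi>)\<^sup>2 < inner (x \<xi>) \<xi>"
    by metis
  have Qcomm: "commuting (Q s) (Q t)" for s t
    using Q(2) by (meson bicommuting_self bicommutingD commuting_sym)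
  have Qmono: "Q t (Q s \<xi>) = Q s \<xi>" "Q s (Q t \<xi>) = Q s \<xi>" if "s \<le> t" for s t \<xi>
  proof -
    show 1: "Q t (Q s \<xi>) = Q s \<xi>"
    proof (rule proj_absorb[OF Q(1) Q(1) Qcomm])
      fix \<xi> assume "Q s \<xi> = \<xi>" "Q t \<xi> = 0"
      then show "\<xi> = 0"
        using Qle[of s \<xi>] Qgt[of t \<xi>] mult_right_mono[OF that, of "(norm \<xi>)\<^sup>2"] by force
    qed
    then show "Q s (Q t \<xi>) = Q s \<xi>"
      using Qcomm by (simp add: commutingD)
  qed
  define F where "F \<xi> t = inner (Q t \<xi>) \<xi>" for \<xi> t
  have F: "F \<xi> t = (norm (Q t \<xi>))\<^sup>2" for \<xi> t
    by (simp add: F_def proj_inner[OF Q(1)])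
  have Fmono: "F \<xi> s \<le> F \<xi> t" if "s \<le> t" for \<xi> s t
    using nested_proj_dist[OF Q(1) Q(1) Qmono(2)[OF that, of \<xi>]] unfolding F_def
    by (metis diff_ge_0_iff_ge zero_le_power2)
  \<comment> \<open>Here strictness on the kernel admits t = \<open>norm x\<close>; on the other
    side only the non-strict bound on the range is available, so \<open>bot\<close> needs t < -
    \<open>norm x\<close>.\<close>
  have top: "Q t \<xi> = \<xi>" if "norm x \<le> t" for t \<xi>
  proof -
    have "Q t (id_blinfun \<xi>) = id_blinfun \<xi>"
    proof (rule proj_absorb)
      fix \<xi> assume "Q t \<xi> = 0"
      then show "\<xi> = 0"
        using inner_le_norm_blinfun[of x \<xi>] mult_right_mono[OF that, of "(norm \<xi>)\<^sup>2"] Qgt[of t \<xi>]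
        by force
    qed (simp_all add: Q)
    then show ?thesis
      by simp
  qed
  have bot: "Q t \<xi> = 0" if "t < - norm x" for t \<xi>
  proof (rule ccontr)
    define \<zeta> where "\<zeta> = Q t \<xi>"
    assume "Q t \<xi> \<noteq> 0"
    then have "t * (norm \<zeta>)\<^sup>2 < - norm x * (norm \<zeta>)\<^sup>2"
      using that by (intro mult_strict_right_mono) (simp_all add: \<zeta>_def)
    then show False
      using Qle[of t \<zeta>] inner_le_norm_blinfun[of x \<zeta>] projD[OF Q(1), of t \<xi>] by (simp add: \<zeta>_def)
  qed
  have right_cont: "continuous (at_right a) (F \<xi>)" for a \<xi>
    unfolding continuous_within
  proof (rule tendsto_at_right_sequentially[where b = "a + 1"])
    fix f :: "nat \<Rightarrow> real" assume f: "decseq f" "f \<longlonglongrightarrow> a" "\<And>n. a < f n"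
    have af: "a \<le> f n" for n
      using f(3)[of n] by simp
    have "decseq (\<lambda>n. F \<xi> (f n))"
      using f(1) by (auto simp: decseq_def intro: Fmono)
    then obtain L where "(\<lambda>n. F \<xi> (f n)) \<longlonglongrightarrow> L"
      by (rule decseq_convergent[of _ 0]) (simp add: F)
    then have "convergent (\<lambda>n. inner (Q (f n) \<xi>) \<xi>)"
      unfolding F_def convergent_def by blast
    moreover have "Q (f m) (Q (f n) \<xi>) = Q (f m) \<xi> \<or> Q (f n) (Q (f m) \<xi>) = Q (f n) \<xi>" for m n
      using Qmono(2)[of "f m" "f n"] Qmono(2)[of "f n" "f m"] by (cases "f m \<le> f n") auto
    ultimately have "convergent (\<lambda>n. Q (f n) \<xi>)"
      by (intro nested_proj_convergent Q)
    then obtain \<eta> where \<eta>: "(\<lambda>n. Q (f n) \<xi>) \<longlonglongrightarrow> \<eta>"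
      by (auto simp: convergent_def)
    have Q\<eta>: "Q (f n) \<eta> = \<eta>" for n
    proof -
      have "(\<lambda>m. Q (f n) (Q (f m) \<xi>)) \<longlonglongrightarrow> Q (f n) \<eta>"
        by (intro tendsto_intros \<eta>)
      moreover have "\<forall>\<^sub>F m in sequentially. Q (f m) \<xi> = Q (f n) (Q (f m) \<xi>)"
        using f(1) by (auto simp: eventually_sequentially decseq_def intro!: exI[of _ n] Qmono(1)[symmetric])
      then have "(\<lambda>m. Q (f n) (Q (f m) \<xi>)) \<longlonglongrightarrow> \<eta>"
        by (rule Lim_transform_eventually[OF \<eta>])
      ultimately show ?thesis
        by (rule LIMSEQ_unique)
    qed
    \<comment> \<open>The limit is in the range of every \<open>Q (f n)\<close>, so the form of
      \<open>x\<close> at \<open>\<zeta>\<close> is at most \<open>a\<close> times its squared norm;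
      but \<open>\<zeta>\<close> is in the kernel of \<open>Q a\<close>, where a nonzero vector
      exceeds this.\<close>
    define \<zeta> where "\<zeta> = \<eta> - Q a \<eta>"
    have "Q (f n) \<zeta> = \<zeta>" for n
      by (simp add: \<zeta>_def blinfun.bilinear_simps Q\<eta> Qmono(1)[OF af])
    then have "inner (x \<zeta>) \<zeta> \<le> f n * (norm \<zeta>)\<^sup>2" for n
      by (rule Qle)
    moreover have "(\<lambda>n. f n * (norm \<zeta>)\<^sup>2) \<longlonglongrightarrow> a * (norm \<zeta>)\<^sup>2"
      by (intro tendsto_intros f)
    ultimately have "inner (x \<zeta>) \<zeta> \<le> a * (norm \<zeta>)\<^sup>2"
      by (meson LIMSEQ_le_const)
    moreover have "Q a \<zeta> = 0"
      by (simp add: \<zeta>_def blinfun.bilinear_simps projD[OF Q(1)])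
    ultimately have "\<zeta> = 0"
      using Qgt[of a \<zeta>] by force
    moreover have "(\<lambda>n. Q a (Q (f n) \<xi>)) \<longlonglongrightarrow> Q a \<eta>"
      by (intro tendsto_intros \<eta>)
    then have "Q a \<eta> = Q a \<xi>"
      by (simp add: Qmono(2)[OF af] LIMSEQ_const_iff)
    ultimately have "\<eta> = Q a \<xi>"
      by (simp add: \<zeta>_def)
    then show "(\<lambda>n. F \<xi> (f n)) \<longlonglongrightarrow> F \<xi> a"
      using \<eta> unfolding F by (auto intro!: tendsto_intros)
  qed simp
  have at_bot: "(F \<xi> \<longlongrightarrow> 0) at_bot" for \<xi>
  proof (rule tendsto_eventually)
    show "\<forall>\<^sub>F t in at_bot. F \<xi> t = 0"
      using eventually_gt_at_bot[of "- norm x"] by eventually_elim (simp add: F bot)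
  qed
  have at_top: "(F \<xi> \<longlongrightarrow> (norm \<xi>)\<^sup>2) at_top" for \<xi>
  proof (rule tendsto_eventually)
    show "\<forall>\<^sub>F t in at_top. F \<xi> t = (norm \<xi>)\<^sup>2"
      using eventually_ge_at_top[of "norm x"] by eventually_elim (simp add: F top)
  qed
  define \<mu> where "\<mu> \<xi> = interval_measure (F \<xi>)" for \<xi>
  have fin: "finite_borel_measure (\<mu> \<xi>)" for \<xi>
    unfolding \<mu>_def
    by (rule finite_borel_measure_interval_measure[OF Fmono right_cont at_bot at_top]) auto
  have UNIV: "measure (\<mu> \<xi>) UNIV = (norm \<xi>)\<^sup>2" for \<xi>
    unfolding \<mu>_def measure_def
    by (subst interval_measure_UNIV[OF Fmono right_cont at_bot at_top]) auto
  have Iic: "measure (\<mu> \<xi>) {..t} = inner (Q t \<xi>) \<xi>" for \<xi> t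
    unfolding \<mu>_def using measure_interval_measure_Iic[OF Fmono right_cont at_bot] by (simp add: F_def)
  have "\<exists>p. proj p \<and> bicommuting x p \<and> (\<forall>\<xi>. inner (p \<xi>) \<xi> = measure (\<mu> \<xi>) {..t})" for t
    using Q Iic by metis
  from projections_from_measures[OF fin UNIV this]
  obtain E where E: "\<And>B. B \<in> sets borel \<Longrightarrow> proj (E B)"
    "\<And>B. B \<in> sets borel \<Longrightarrow> bicommuting x (E B)"
    "\<And>B \<xi>. B \<in> sets borel \<Longrightarrow> inner (E B \<xi>) \<xi> = measure (\<mu> \<xi>) B"
    by metis
  \<comment> \<open>\<open>E\<close> was chosen by bare existence; it agrees with the cuts on
    half-lines because the two forms coincide.\<close>
  have EQ: "E {..t} = Q t" for t
    by (rule symm_eqI) (simp_all add: E Q Iic proj_symm)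
  show thesis
  proof (rule that[OF fin UNIV E])
    show "inner (x \<xi>) \<xi> \<le> t * (norm \<xi>)\<^sup>2" if "E {..t} \<xi> = \<xi>" for t \<xi>
      using that Qle by (simp add: EQ)
    show "t * (norm \<xi>)\<^sup>2 \<le> inner (x \<xi>) \<xi>" if "E {..t} \<xi> = 0" for t \<xi>
      using that Qgt[of t \<xi>] by (cases "\<xi> = 0") (simp_all add: EQ)
  qed
qed

section \<open>Spectral measures on a complex Hilbert space\<close>

text \<open>Makes the results for real inner product spaces of sort \<open>banach\<close>
  applicable.\<close>

instance chilbert_space \<subseteq> banach ..

lemma cinner_scaleC_right: "cinner \<xi> (c *\<^sub>C \<eta>) = cnj c * cinner \<xi> \<eta>"
  by (metis cinner_commute cinner_scaleC_left complex_cnj_mult)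

lemma Im_cinner: "Im (cinner \<xi> \<eta>) = inner \<xi> (\<i> *\<^sub>C \<eta>)"
  by (simp add: cinner_scaleC_right flip: Re_cinner)

lemma inner_ii: "inner (\<i> *\<^sub>C \<xi>) (\<i> *\<^sub>C \<eta>) = inner \<xi> \<eta>"
  by (simp add: cinner_scaleC_right cinner_scaleC_left flip: Re_cinner)

text \<open>Phrasing complex linearity as commutation lets it pass to the bicommutant.\<close>

lemma bounded_ops_iff: "x \<in> bounded_ops \<longleftrightarrow> (\<forall>c. commuting x (scalar_op c))"
  by (simp add: bounded_ops_def commuting_iff scalar_op.rep_eq)

lemma bounded_ops_scaleC: "x \<in> bounded_ops \<Longrightarrow> blinfun_apply x (c *\<^sub>C \<xi>) = c *\<^sub>C blinfun_apply x \<xi>"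
  by (simp add: bounded_ops_def)

lemma bounded_ops_closed [intro]:
  "id_blinfun \<in> bounded_ops"
  "x \<in> bounded_ops \<Longrightarrow> y \<in> bounded_ops \<Longrightarrow> x + y \<in> bounded_ops"
  "x \<in> bounded_ops \<Longrightarrow> y \<in> bounded_ops \<Longrightarrow> x - y \<in> bounded_ops"
  "x \<in> bounded_ops \<Longrightarrow> - x \<in> bounded_ops"
  "x \<in> bounded_ops \<Longrightarrow> r *\<^sub>R x \<in> bounded_ops"
  "x \<in> bounded_ops \<Longrightarrow> y \<in> bounded_ops \<Longrightarrow> x o\<^sub>L y \<in> bounded_ops"
  by (simp_all add: bounded_ops_iff commuting_add commuting_diff commuting_minus commuting_scaleR commuting_compose)

lemma bicommuting_bounded_ops: "bicommuting x p \<Longrightarrow> x \<in> bounded_ops \<Longrightarrow> p \<in> bounded_ops"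
  by (simp add: bounded_ops_iff bicommuting_def)

lemma selfadjoint_iff: "selfadjoint x \<longleftrightarrow> x \<in> bounded_ops \<and> symm x"
proof
  assume "selfadjoint x"
  then show "x \<in> bounded_ops \<and> symm x"
    by (simp add: selfadjoint_def symm_def flip: Re_cinner)
next
  assume "x \<in> bounded_ops \<and> symm x"
  then show "selfadjoint x"
    by (auto simp: selfadjoint_def complex_eq_iff Re_cinner Im_cinner symm_def
        simp flip: bounded_ops_scaleC)
qed

lemma selfadjoint_closed [intro]:
  "selfadjoint id_blinfun"
  "selfadjoint x \<Longrightarrow> selfadjoint y \<Longrightarrow> selfadjoint (x + y)"
  "selfadjoint x \<Longrightarrow> selfadjoint y \<Longrightarrow> selfadjoint (x - y)"
  "selfadjoint x \<Longrightarrow> selfadjoint (- x)"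
  "selfadjoint x \<Longrightarrow> selfadjoint (r *\<^sub>R x)"
  by (auto simp: selfadjoint_iff symm_add symm_diff symm_minus symm_scaleR)

lemma projection_iff: "projection p \<longleftrightarrow> p \<in> bounded_ops \<and> proj p"
  by (auto simp: projection_def proj_def selfadjoint_iff)

text \<open>A real-valued complex form is symmetric: <x \<open>\<xi>\<close>, i
  \<open>\<xi>\<close>> = 0 in the real inner product, polarised, and complex linearity moves the
  two factors i across.\<close>

lemma positive_op_iff: "positive_op x \<longleftrightarrow> x \<in> bounded_ops \<and> posop x"
proof
  assume x: "positive_op x"
  then have b: "x \<in> bounded_ops" and p: "0 \<le> inner (x \<xi>) \<xi>" and i: "inner (x \<xi>) (\<i> *\<^sub>C \<xi>) = 0" for \<xi>
    by (auto simp: positive_op_def complex_nonneg_Reals_iff Re_cinner Im_cinner)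
  have anti: "inner (x \<xi>) (\<i> *\<^sub>C \<eta>) = - inner (x \<eta>) (\<i> *\<^sub>C \<xi>)" for \<xi> \<eta>
    using i[of "\<xi> + \<eta>"] i[of \<xi>] i[of \<eta>]
    by (simp add: blinfun.bilinear_simps scaleC_add_right inner_simps)
  have ii: "\<i> *\<^sub>C (\<i> *\<^sub>C \<eta>) = - \<eta>" for \<eta> :: 'a
    using scaleC_of_real[of "-1" \<eta>] by (simp add: scaleC_scaleC)
  have "symm x"
    unfolding symm_def
  proof (intro allI)
    fix \<xi> \<eta>
    have "inner (x \<xi>) (\<i> *\<^sub>C (\<i> *\<^sub>C \<eta>)) = - inner (\<i> *\<^sub>C x \<eta>) (\<i> *\<^sub>C \<xi>)"
      unfolding anti[of \<xi>] by (simp add: bounded_ops_scaleC[OF b])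
    then show "inner (x \<xi>) \<eta> = inner \<xi> (x \<eta>)"
      by (simp add: ii inner_ii inner_commute)
  qed
  then show "x \<in> bounded_ops \<and> posop x"
    using b p by (simp add: posop_def)
next
  assume x: "x \<in> bounded_ops \<and> posop x"
  then have "selfadjoint x"
    by (simp add: selfadjoint_iff posop_def)
  then have "cinner (x \<xi>) \<xi> = cinner \<xi> (x \<xi>)" for \<xi>
    by (simp add: selfadjoint_def)
  then have c: "cinner (x \<xi>) \<xi> = cnj (cinner (x \<xi>) \<xi>)" for \<xi>
    using cinner_commute[of \<xi> "x \<xi>"] by simp
  have "Im (cinner (x \<xi>) \<xi>) = 0" for \<xi>
    using arg_cong[OF c[of \<xi>], of Im] by simp
  then show "positive_op x"
    using x by (simp add: positive_op_def complex_nonneg_Reals_iff posop_def Re_cinner)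
qed

text \<open>A self-adjoint operator is its own witness for the description, so existence does not go
  through Riesz representation.\<close>

lemma adj_selfadjoint:
  assumes x: "selfadjoint x"
  shows "adj x = x"
  unfolding adj_def
proof (rule the_equality)
  show "\<forall>\<xi> \<eta>. cinner (x \<xi>) \<eta> = cinner \<xi> (x \<eta>)"
    using x by (simp add: selfadjoint_def)
  fix y assume y: "\<forall>\<xi> \<eta>. cinner (x \<xi>) \<eta> = cinner \<xi> (blinfun_apply y \<eta>)"
  show "y = x"
  proof (rule blinfun_eqI)
    fix \<eta>
    have "inner \<xi> (y \<eta>) = inner \<xi> (x \<eta>)" for \<xi>
      using x y by (metis selfadjoint_def Re_cinner)
    then show "y \<eta> = x \<eta>"
      using vector_eq_ldot by blast
  qed
qed

text \<open>The constructed root is in the bicommutant of x^2, so it coincides with every other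
  positive root and the description denotes it.\<close>

lemma op_abs_selfadjoint:
  assumes x: "selfadjoint x"
  shows positive_op_abs: "positive_op (op_abs x)"
    and op_abs_square: "op_abs x o\<^sub>L op_abs x = x o\<^sub>L x"
    and bicommuting_abs: "bicommuting x (op_abs x)"
    and bicommuting_square_abs: "bicommuting (x o\<^sub>L x) (op_abs x)"
proof -
  have b: "x \<in> bounded_ops" and s: "symm x"
    using x by (simp_all add: selfadjoint_iff)
  obtain a where a: "posop a" "a o\<^sub>L a = x o\<^sub>L x" "bicommuting x a" "bicommuting (x o\<^sub>L x) a"
    using absolute_value_exists[OF s] by blast
  have "op_abs x = a"
    unfolding op_abs_def adj_selfadjoint[OF x]
  proof (rule the_equality)
    show "positive_op a \<and> a o\<^sub>L a = x o\<^sub>L x"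
      using a b bicommuting_bounded_ops by (simp add: positive_op_iff)
    show "y = a" if "positive_op y \<and> y o\<^sub>L y = x o\<^sub>L x" for y
      using that a posop_sqrt_unique by (metis positive_op_iff)
  qed
  then show "positive_op (op_abs x)" "op_abs x o\<^sub>L op_abs x = x o\<^sub>L x" "bicommuting x (op_abs x)"
    "bicommuting (x o\<^sub>L x) (op_abs x)"
    using a b bicommuting_bounded_ops by (simp_all add: positive_op_iff)
qed

lemma selfadjoint_abs: "selfadjoint x \<Longrightarrow> selfadjoint (op_abs x)"
  using positive_op_abs by (auto simp: positive_op_iff posop_def selfadjoint_iff)

section \<open>Projection-valued measures and their scalar measures\<close>

context
  fixes E :: "real set \<Rightarrow> ('h::chilbert_space \<Rightarrow>\<^sub>L 'h)"
  assumes E: "projection_valued_measure E"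
begin

lemma pvm_proj: "B \<in> sets borel \<Longrightarrow> proj (E B)"
  using E by (simp add: projection_valued_measure_def projection_iff)

lemma pvm_UNIV: "E UNIV = id_blinfun"
  using E by (simp add: projection_valued_measure_def)

lemma pvm_Int: "A \<in> sets borel \<Longrightarrow> B \<in> sets borel \<Longrightarrow> E A (E B \<xi>) = E (A \<inter> B) \<xi>"
  using E unfolding projection_valued_measure_def by (metis blinfun_apply_blinfun_compose)

lemma pvm_sums: "range A \<subseteq> sets borel \<Longrightarrow> disjoint_family A \<Longrightarrow> (\<lambda>i. E (A i) \<xi>) sums E (\<Union>i. A i) \<xi>"
  using E by (simp add: projection_valued_measure_def)

text \<open>The empty sets form a disjoint sequence, and a constant series converges only if its
  term is 0.\<close>

lemma pvm_empty: "E {} \<xi> = 0"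
proof -
  have "(\<lambda>i::nat. E {} \<xi>) sums E {} \<xi>"
    using pvm_sums[of "\<lambda>_. {}"] by (simp add: disjoint_family_on_def)
  then show ?thesis
    using sums_summable summable_const_iff by blast
qed

lemma sets_scalar_measure: "sets (scalar_measure E \<xi>) = sets borel"
  unfolding scalar_measure_def
  by (subst sets_measure_of) (use sets.sigma_sets_eq[of "borel :: real measure"] in simp_all)

lemma space_scalar_measure: "space (scalar_measure E \<xi>) = UNIV"
  unfolding scalar_measure_def by (simp add: space_measure_of_conv)

lemma pvm_inner_nonneg: "B \<in> sets borel \<Longrightarrow> 0 \<le> inner (E B \<xi>) \<xi>"
  using proj_inner[OF pvm_proj] by simp

lemma emeasure_scalar_measure:
  assumes B: "B \<in> sets borel"
  shows "emeasure (scalar_measure E \<xi>) B = ennreal (inner (E B \<xi>) \<xi>)"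
proof -
  have "emeasure (scalar_measure E \<xi>) B = ennreal (Re (cinner (E B \<xi>) \<xi>))"
  proof (rule emeasure_measure_of[OF scalar_measure_def])
    show "positive (sets (scalar_measure E \<xi>)) (\<lambda>B. ennreal (Re (cinner (E B \<xi>) \<xi>)))"
      by (simp add: positive_def pvm_empty Re_cinner)
    show "countably_additive (sets (scalar_measure E \<xi>)) (\<lambda>B. ennreal (Re (cinner (E B \<xi>) \<xi>)))"
      unfolding sets_scalar_measure
    proof (rule countably_additiveI)
      fix A :: "nat \<Rightarrow> real set"
      assume A: "range A \<subseteq> sets borel" "disjoint_family A"
      have "(\<lambda>i. inner (E (A i) \<xi>) \<xi>) sums inner (E (\<Union>i. A i) \<xi>) \<xi>"
        using bounded_linear.sums[OF bounded_linear_inner_left pvm_sums[OF A]] .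
      then show "(\<Sum>i. ennreal (Re (cinner (E (A i) \<xi>) \<xi>))) = ennreal (Re (cinner (E (\<Union>i. A i) \<xi>) \<xi>))"
        unfolding Re_cinner using A by (intro suminf_ennreal_eq pvm_inner_nonneg) auto
    qed
  qed (use B sets_scalar_measure in auto)
  then show ?thesis
    by (simp add: Re_cinner)
qed

lemma measure_scalar_measure:
  "B \<in> sets borel \<Longrightarrow> measure (scalar_measure E \<xi>) B = inner (E B \<xi>) \<xi>"
  by (simp add: measure_def emeasure_scalar_measure pvm_inner_nonneg)

lemma finite_scalar_measure: "finite_measure (scalar_measure E \<xi>)"
  by (rule finite_measureI) (simp add: space_scalar_measure emeasure_scalar_measure)

lemma measure_scalar_measure_UNIV: "measure (scalar_measure E \<xi>) UNIV = (norm \<xi>)\<^sup>2"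
  by (simp add: measure_scalar_measure pvm_UNIV power2_norm_eq_inner)

lemma pvm_compl:
  assumes B: "B \<in> sets borel"
  shows "E (- B) = id_blinfun - E B"
proof (rule symm_eqI)
  fix \<xi>
  show "inner (E (- B) \<xi>) \<xi> = inner ((id_blinfun - E B) \<xi>) \<xi>"
    using finite_measure.finite_measure_compl[OF finite_scalar_measure, of B \<xi>] B
    by (simp add: sets_scalar_measure space_scalar_measure measure_scalar_measure Compl_eq_Diff_UNIV[symmetric]
        pvm_UNIV blinfun.bilinear_simps inner_diff_left)
qed (use B in \<open>auto intro!: proj_symm pvm_proj proj_complement\<close>)

lemma scalar_measure_projected:
  assumes B: "B \<in> sets borel"
  shows "scalar_measure E (E B \<xi>) = density (scalar_measure E \<xi>) (indicator B)"
proof (rule measure_eqI)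
  fix A assume "A \<in> sets (scalar_measure E (E B \<xi>))"
  then have A: "A \<in> sets borel"
    by (simp add: sets_scalar_measure)
  have "inner (E A (E B \<xi>)) (E B \<xi>) = inner (E B (E A (E B \<xi>))) \<xi>"
    using proj_symm[OF pvm_proj[OF B]] by (simp add: symmD inner_commute)
  also have "E B (E A (E B \<xi>)) = E (B \<inter> A) \<xi>"
    using A B by (simp add: pvm_Int Int_commute Int_left_commute)
  finally show "emeasure (scalar_measure E (E B \<xi>)) A = emeasure (density (scalar_measure E \<xi>) (indicator B)) A"
    using A B by (simp add: emeasure_restricted sets_scalar_measure emeasure_scalar_measure)
qed (simp add: sets_scalar_measure)

text \<open>The spectral integral has no cross terms between a Borel set and its complement. For a
  spectral measure of \<open>x\<close> this will force \<open>x\<close> to commute with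
  \<open>E B\<close>.\<close>

lemma integral_scalar_measure_split:
  fixes f :: "real \<Rightarrow> real"
  assumes B: "B \<in> sets borel" and f: "integrable (scalar_measure E \<xi>) f"
  shows "integral\<^sup>L (scalar_measure E \<xi>) f =
    integral\<^sup>L (scalar_measure E (E B \<xi>)) f + integral\<^sup>L (scalar_measure E (E (- B) \<xi>)) f"
proof -
  let ?\<mu> = "scalar_measure E \<xi>"
  have fm: "f \<in> borel_measurable ?\<mu>"
    using f by (rule borel_measurable_integrable)
  have proj: "integral\<^sup>L (scalar_measure E (E A \<xi>)) f = (\<integral>s. indicator A s * f s \<partial>?\<mu>)"
    if A: "A \<in> sets borel" for A
  proof -
    have "density ?\<mu> (indicator A) = density ?\<mu> (\<lambda>s. ennreal (indicator A s))"
      by (simp add: ennreal_indicator)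
    moreover have "integral\<^sup>L (density ?\<mu> (\<lambda>s. ennreal (indicator A s))) f = (\<integral>s. indicator A s *\<^sub>R f s \<partial>?\<mu>)"
      using A by (intro integral_density fm borel_measurable_indicator) (auto simp: sets_scalar_measure)
    ultimately show ?thesis
      by (simp add: scalar_measure_projected[OF A])
  qed
  have "integrable ?\<mu> (\<lambda>s. indicator A s * f s)" if "A \<in> sets borel" for A
    using integrable_mult_indicator[OF _ f, of A] that by (simp add: sets_scalar_measure)
  then have "(\<integral>s. indicator B s * f s \<partial>?\<mu>) + (\<integral>s. indicator (- B) s * f s \<partial>?\<mu>)
      = (\<integral>s. indicator B s * f s + indicator (- B) s * f s \<partial>?\<mu>)"
    using B by (intro Bochner_Integration.integral_add[symmetric]) auto
  also have "\<dots> = integral\<^sup>L ?\<mu> f"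
    by (intro Bochner_Integration.integral_cong) (auto simp: indicator_def)
  finally show ?thesis
    using B by (simp add: proj)
qed

lemma AE_scalar_measure:
  assumes B: "B \<in> sets borel" and \<xi>: "E B \<xi> = \<xi>"
  shows "AE s in scalar_measure E \<xi>. s \<in> B"
proof -
  have "- B \<in> null_sets (scalar_measure E \<xi>)"
    using B by (auto simp: null_sets_def sets_scalar_measure emeasure_scalar_measure pvm_compl blinfun.bilinear_simps \<xi>)
  then show ?thesis
    using AE_not_in by fastforce
qed

lemma scalar_integral_le:
  assumes i: "integrable (scalar_measure E \<xi>) (\<lambda>s. s)" and ae: "AE s in scalar_measure E \<xi>. s \<le> t"
  shows "(\<integral>s. s \<partial>scalar_measure E \<xi>) \<le> t * (norm \<xi>)\<^sup>2"
proof -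
  interpret finite_measure "scalar_measure E \<xi>"
    by (rule finite_scalar_measure)
  have "(\<integral>s. s \<partial>scalar_measure E \<xi>) \<le> (\<integral>s. t \<partial>scalar_measure E \<xi>)"
    using i ae by (intro integral_mono_AE) auto
  then show ?thesis
    by (simp add: space_scalar_measure measure_scalar_measure_UNIV mult.commute)
qed

lemma scalar_integral_ge:
  assumes i: "integrable (scalar_measure E \<xi>) (\<lambda>s. s)" and ae: "AE s in scalar_measure E \<xi>. t \<le> s"
  shows "t * (norm \<xi>)\<^sup>2 \<le> (\<integral>s. s \<partial>scalar_measure E \<xi>)"
proof -
  interpret finite_measure "scalar_measure E \<xi>"
    by (rule finite_scalar_measure)
  have "(\<integral>s. t \<partial>scalar_measure E \<xi>) \<le> (\<integral>s. s \<partial>scalar_measure E \<xi>)"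
    using i ae by (intro integral_mono_AE) auto
  then show ?thesis
    by (simp add: space_scalar_measure measure_scalar_measure_UNIV mult.commute)
qed

text \<open>A function positive almost everywhere with integral 0 would make the measure zero, but
  the total mass is the squared norm of \<open>\<xi>\<close>. This upgrades the two preceding bounds
  to strict ones.\<close>

lemma scalar_integral_neq:
  assumes i: "integrable (scalar_measure E \<xi>) (\<lambda>s. s)" and \<xi>: "\<xi> \<noteq> 0"
    and ae: "(AE s in scalar_measure E \<xi>. s < t) \<or> (AE s in scalar_measure E \<xi>. t < s)"
  shows "(\<integral>s. s \<partial>scalar_measure E \<xi>) \<noteq> t * (norm \<xi>)\<^sup>2"
proof
  let ?\<mu> = "scalar_measure E \<xi>"
  interpret finite_measure ?\<mu>
    by (rule finite_scalar_measure)
  assume eq: "(\<integral>s. s \<partial>?\<mu>) = t * (norm \<xi>)\<^sup>2"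
  have int: "(\<integral>s. t - s \<partial>?\<mu>) = 0" "(\<integral>s. s - t \<partial>?\<mu>) = 0"
    using i eq by (simp_all add: space_scalar_measure measure_scalar_measure_UNIV mult.commute)
  have "AE s in ?\<mu>. False"
    using ae
  proof
    assume a: "AE s in ?\<mu>. s < t"
    then have "AE s in ?\<mu>. t - s = 0"
      using i int by (subst integral_nonneg_eq_0_iff_AE[symmetric]) auto
    then show ?thesis
      using a by eventually_elim simp
  next
    assume a: "AE s in ?\<mu>. t < s"
    then have "AE s in ?\<mu>. s - t = 0"
      using i int by (subst integral_nonneg_eq_0_iff_AE[symmetric]) auto
    then show ?thesis
      using a by eventually_elim simp
  qed
  then have "emeasure ?\<mu> UNIV = 0"
    using AE_iff_measurable[of UNIV ?\<mu> "\<lambda>_. False"] by (simp add: sets_scalar_measure space_scalar_measure)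
  then show False
    using inner_gt_zero_iff[of \<xi>] \<xi>
    by (simp add: emeasure_scalar_measure pvm_UNIV ennreal_eq_0_iff del: inner_gt_zero_iff)
qed

end

section \<open>Arbitrary spectral measures of a self-adjoint operator\<close>

lemma spectral_measureD:
  assumes "spectral_measure x E"
  shows "projection_valued_measure E" "integrable (scalar_measure E \<xi>) (\<lambda>s. s)"
    "inner (x \<xi>) \<xi> = (\<integral>s. s \<partial>scalar_measure E \<xi>)"
proof -
  show "projection_valued_measure E" "integrable (scalar_measure E \<xi>) (\<lambda>s. s)"
    using assms by (simp_all add: spectral_measure_def)
  have "cinner (x \<xi>) \<xi> = complex_of_real (\<integral>s. s \<partial>scalar_measure E \<xi>)"
    using assms by (simp add: spectral_measure_def)
  then show "inner (x \<xi>) \<xi> = (\<integral>s. s \<partial>scalar_measure E \<xi>)"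
    by (simp flip: Re_cinner)
qed

text \<open>Comparing the split integral with the expansion of <x \<open>\<xi>\<close>,
  \<open>\<xi>\<close>> along \<open>E B\<close> and its complement leaves a vanishing cross term.
  Its two arguments are then made independent, which kills the off-diagonal blocks of
  \<open>x\<close>.\<close>

lemma spectral_measure_commuting:
  assumes x: "selfadjoint x" and E: "spectral_measure x E" and B: "B \<in> sets borel"
  shows "commuting x (E B)"
proof -
  note pvm = spectral_measureD(1)[OF E]
  have s: "symm x"
    using x by (simp add: selfadjoint_iff)
  let ?p = "E B" and ?q = "E (- B)"
  have B': "- B \<in> sets borel"
    using B by simp
  have p: "proj ?p" "proj ?q"
    using pvm_proj[OF pvm] B B' by blast+
  have q: "?q \<xi> = \<xi> - ?p \<xi>" for \<xi>
    by (simp add: pvm_compl[OF pvm B] blinfun.bilinear_simps)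
  have pq: "?p (?q \<xi>) = 0" "?q (?p \<xi>) = 0" for \<xi>
    by (simp_all add: q blinfun.bilinear_simps projD[OF p(1)])
  have diag: "inner (x (?p \<xi>)) (?q \<xi>) = 0" for \<xi>
  proof -
    have "inner (x \<xi>) \<xi> = inner (x (?p \<xi>)) (?p \<xi>) + inner (x (?q \<xi>)) (?q \<xi>)"
      unfolding spectral_measureD(3)[OF E]
      by (rule integral_scalar_measure_split[OF pvm B spectral_measureD(2)[OF E]])
    moreover have "\<xi> = ?p \<xi> + ?q \<xi>"
      by (simp add: q)
    then have "inner (x \<xi>) \<xi> = inner (x (?p \<xi> + ?q \<xi>)) (?p \<xi> + ?q \<xi>)"
      by simp
    moreover have "inner (x (?p \<xi> + ?q \<xi>)) (?p \<xi> + ?q \<xi>) =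
        inner (x (?p \<xi>)) (?p \<xi>) + inner (x (?q \<xi>)) (?q \<xi>) + 2 * inner (x (?p \<xi>)) (?q \<xi>)"
      using symm_inner[OF s, of "?q \<xi>" "?p \<xi>"]
      by (simp only: blinfun.bilinear_simps inner_add_left inner_add_right)
    ultimately show ?thesis
      by linarith
  qed
  \<comment> \<open>The components of \<open>?p \<xi> + ?q \<eta>\<close> are
    \<open>?p \<xi>\<close> and \<open>?q \<eta>\<close>, so \<open>diag\<close> at this vector
    separates the two variables.\<close>
  have off: "inner (x (?p \<xi>)) (?q \<eta>) = 0" for \<xi> \<eta>
    using diag[of "?p \<xi> + ?q \<eta>"] by (simp add: blinfun.bilinear_simps pq projD p)
  have qxp: "?q (x (?p \<xi>)) = 0" for \<xi>
  proof -
    have "inner (?q (x (?p \<xi>))) (?q (x (?p \<xi>))) = inner (x (?p \<xi>)) (?q (?q (x (?p \<xi>))))"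
      by (rule symmD[OF proj_symm[OF p(2)]])
    then show ?thesis
      by (simp only: off inner_eq_zero_iff)
  qed
  have pxq: "?p (x (?q \<xi>)) = 0" for \<xi>
  proof -
    have "inner (?p (x (?q \<xi>))) (?p (x (?q \<xi>))) = inner (x (?q \<xi>)) (?p (?p (x (?q \<xi>))))"
      by (rule symmD[OF proj_symm[OF p(1)]])
    also have "\<dots> = inner (x (?p (?p (x (?q \<xi>))))) (?q \<xi>)"
      by (rule symm_inner[OF s])
    finally show ?thesis
      by (simp only: off inner_eq_zero_iff)
  qed
  show ?thesis
    unfolding commuting_iff
  proof
    fix \<xi>
    have "x (?p \<xi>) = ?p (x (?p \<xi>))"
      using qxp[of \<xi>] by (simp add: q)
    moreover have "?p (x \<xi>) = ?p (x (?p \<xi>))"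
      using pxq[of \<xi>] by (simp add: q blinfun.bilinear_simps)
    ultimately show "x (?p \<xi>) = ?p (x \<xi>)"
      by simp
  qed
qed

text \<open>The measure of \<open>\<xi>\<close> lives on a half-line and the integrand is compared
  with its endpoint; the bound is strict exactly when the endpoint is excluded.\<close>

lemma spectral_measure_bounds:
  assumes x: "spectral_measure x E"
  shows "E {..t} \<xi> = \<xi> \<Longrightarrow> inner (x \<xi>) \<xi> \<le> t * (norm \<xi>)\<^sup>2"
    and "E {..t} \<xi> = 0 \<Longrightarrow> \<xi> \<noteq> 0 \<Longrightarrow> t * (norm \<xi>)\<^sup>2 < inner (x \<xi>) \<xi>"
    and "E {..<t} \<xi> = \<xi> \<Longrightarrow> \<xi> \<noteq> 0 \<Longrightarrow> inner (x \<xi>) \<xi> < t * (norm \<xi>)\<^sup>2"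
    and "E {..<t} \<xi> = 0 \<Longrightarrow> t * (norm \<xi>)\<^sup>2 \<le> inner (x \<xi>) \<xi>"
proof -
  note E = spectral_measureD(1)[OF x] and int = spectral_measureD(2)[OF x] and eq = spectral_measureD(3)[OF x]
  have compl: "E (- B) \<xi> = \<xi>" if "B \<in> sets borel" "E B \<xi> = 0" for B
    using that by (simp add: pvm_compl[OF E] blinfun.bilinear_simps)
  show "inner (x \<xi>) \<xi> \<le> t * (norm \<xi>)\<^sup>2" if "E {..t} \<xi> = \<xi>"
    unfolding eq using AE_scalar_measure[OF E _ that] by (intro scalar_integral_le[OF E int]) auto
  show "t * (norm \<xi>)\<^sup>2 < inner (x \<xi>) \<xi>" if "E {..t} \<xi> = 0" "\<xi> \<noteq> 0"
  proof -
    have ae: "AE s in scalar_measure E \<xi>. t < s"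
      using AE_scalar_measure[OF E _ compl[OF _ that(1)]] by (auto simp: not_le)
    then have "AE s in scalar_measure E \<xi>. t \<le> s"
      by eventually_elim simp
    then have "t * (norm \<xi>)\<^sup>2 \<le> inner (x \<xi>) \<xi>"
      unfolding eq by (intro scalar_integral_ge[OF E int])
    moreover have "inner (x \<xi>) \<xi> \<noteq> t * (norm \<xi>)\<^sup>2"
      unfolding eq using ae that(2) by (intro scalar_integral_neq[OF E int]) auto
    ultimately show ?thesis
      by simp
  qed
  show "inner (x \<xi>) \<xi> < t * (norm \<xi>)\<^sup>2" if "E {..<t} \<xi> = \<xi>" "\<xi> \<noteq> 0"
  proof -
    have ae: "AE s in scalar_measure E \<xi>. s < t"
      using AE_scalar_measure[OF E _ that(1)] by auto
    then have "AE s in scalar_measure E \<xi>. s \<le> t"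
      by eventually_elim simp
    then have "inner (x \<xi>) \<xi> \<le> t * (norm \<xi>)\<^sup>2"
      unfolding eq by (intro scalar_integral_le[OF E int])
    moreover have "inner (x \<xi>) \<xi> \<noteq> t * (norm \<xi>)\<^sup>2"
      unfolding eq using ae that(2) by (intro scalar_integral_neq[OF E int]) auto
    ultimately show ?thesis
      by simp
  qed
  show "t * (norm \<xi>)\<^sup>2 \<le> inner (x \<xi>) \<xi>" if "E {..<t} \<xi> = 0"
    unfolding eq using AE_scalar_measure[OF E _ compl[OF _ that]]
    by (intro scalar_integral_ge[OF E int]) (auto simp: not_less)
qed

text \<open>Multiplicativity comes from additivity: for disjoint sets the sum of the two projections
  is again a projection, so the anticommutator vanishes, and commuting factors then have product
  0.\<close>

lemma pvm_from_measures:
  fixes E :: "real set \<Rightarrow> ('h::chilbert_space \<Rightarrow>\<^sub>L 'h)"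
  assumes x: "x \<in> bounded_ops"
    and fin: "\<And>\<xi>. finite_borel_measure (\<mu> \<xi>)"
    and UNIV: "\<And>\<xi>. measure (\<mu> \<xi>) UNIV = (norm \<xi>)\<^sup>2"
    and proj: "\<And>B. B \<in> sets borel \<Longrightarrow> proj (E B)"
    and bi: "\<And>B. B \<in> sets borel \<Longrightarrow> bicommuting x (E B)"
    and \<mu>: "\<And>B \<xi>. B \<in> sets borel \<Longrightarrow> inner (E B \<xi>) \<xi> = measure (\<mu> \<xi>) B"
  shows "projection_valued_measure E"
proof -
  have sets: "sets (\<mu> \<xi>) = sets borel" for \<xi>
    using fin finite_borel_measure.M_is_borel by blast
  have fm: "finite_measure (\<mu> \<xi>)" for \<xi>
    using fin finite_borel_measure_def by blast
  have comm: "commuting (E A) (E B)" if "A \<in> sets borel" "B \<in> sets borel" for A B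
    using bi[OF that(1)] bi[OF that(2)] by (meson bicommuting_self bicommutingD commuting_sym)
  have add: "E (A \<union> B) = E A + E B" if "A \<in> sets borel" "B \<in> sets borel" "A \<inter> B = {}" for A B
  proof (rule symm_eqI)
    show "inner (E (A \<union> B) \<xi>) \<xi> = inner ((E A + E B) \<xi>) \<xi>" for \<xi>
      using that finite_measure.finite_measure_Union[OF fm, of A \<xi> B]
      by (simp add: \<mu> sets blinfun.bilinear_simps inner_add_left)
  qed (use that in \<open>auto intro: symm_add proj_symm proj\<close>)
  have orth: "E A (E B \<xi>) = 0" if AB: "A \<in> sets borel" "B \<in> sets borel" "A \<inter> B = {}" for A B \<xi>
  proof -
    have "(E A + E B) ((E A + E B) \<xi>) = (E A + E B) \<xi>"
      using projD[OF proj, of "A \<union> B"] AB by (simp add: add)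
    then have "E A (E B \<xi>) + E B (E A \<xi>) = 0"
      using AB by (simp add: blinfun.bilinear_simps projD[OF proj] add.commute)
    then have "2 *\<^sub>R E A (E B \<xi>) = 0"
      using commutingD[OF comm[OF AB(1,2)]] by (simp add: scaleR_2)
    then show ?thesis
      by simp
  qed
  have Int: "E (A \<inter> B) \<xi> = E A (E B \<xi>)" if AB: "A \<in> sets borel" "B \<in> sets borel" for A B \<xi>
  proof -
    have "E ((A \<inter> B) \<union> (A - B)) = E (A \<inter> B) + E (A - B)" "E ((A \<inter> B) \<union> (B - A)) = E (A \<inter> B) + E (B - A)"
      using AB by (intro add; auto)+
    moreover have "(A \<inter> B) \<union> (A - B) = A" "(A \<inter> B) \<union> (B - A) = B"
      by auto
    ultimately have "E A = E (A \<inter> B) + E (A - B)" "E B = E (A \<inter> B) + E (B - A)"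
      by metis+
    moreover have "E (A \<inter> B) (E (B - A) \<xi>) = 0" "E (A - B) (E (A \<inter> B) \<xi>) = 0" "E (A - B) (E (B - A) \<xi>) = 0"
      using AB by (intro orth; auto)+
    moreover have "E (A \<inter> B) (E (A \<inter> B) \<xi>) = E (A \<inter> B) \<xi>"
      using AB by (intro projD proj) auto
    ultimately show ?thesis
      by (metis (no_types, lifting) add_0 add_0_right blinfun.add_left blinfun.add_right)
  qed
  have id: "E UNIV = id_blinfun"
    by (rule symm_eqI) (simp_all add: \<mu> UNIV proj proj_symm power2_norm_eq_inner)
  have sums: "(\<lambda>i. E (A i) \<xi>) sums E (\<Union>i. A i) \<xi>"
    if A: "range A \<subseteq> sets borel" "disjoint_family A" for A :: "nat \<Rightarrow> real set" and \<xi>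
  proof -
    let ?U = "\<Union>i. A i"
    define V where "V n = (\<Union>i<n. A i)" for n
    have Vb: "V n \<in> sets borel" and Ub: "?U \<in> sets borel" for n
      using A by (auto simp: V_def)
    have part: "(\<Sum>i<n. E (A i) \<xi>) = E (V n) \<xi>" for n
    proof (induction n)
      case 0
      have "E {} \<xi> = 0"
        using orth[of "{}" "{}" \<xi>] projD[OF proj[of "{}"], of \<xi>] by simp
      then show ?case by (simp add: V_def)
    next
      case (Suc n)
      have "A i \<inter> A n = {}" if "i < n" for i
        using A(2) that by (simp add: disjoint_family_on_def)
      then have "V n \<inter> A n = {}"
        unfolding V_def by blast
      moreover have "A n \<in> sets borel"
        using A(1) by blast
      ultimately have "E (V n \<union> A n) = E (V n) + E (A n)"
        using Vb by (intro add)
      moreover have "V (Suc n) = V n \<union> A n"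
        by (auto simp: V_def less_Suc_eq)
      ultimately show ?case
        using Suc by (simp add: blinfun.bilinear_simps)
    qed
    have "(\<lambda>n. \<Sum>i<n. measure (\<mu> \<xi>) (A i)) \<longlonglongrightarrow> measure (\<mu> \<xi>) ?U"
      using finite_measure.finite_measure_UNION[OF fm, of A \<xi>] A by (simp add: sums_def sets)
    moreover have "(\<Sum>i<n. measure (\<mu> \<xi>) (A i)) = inner (E (V n) \<xi>) \<xi>" for n
    proof -
      have "(\<Sum>i<n. measure (\<mu> \<xi>) (A i)) = inner (\<Sum>i<n. E (A i) \<xi>) \<xi>"
        unfolding inner_sum_left using A by (intro sum.cong) (auto simp: \<mu>)
      then show ?thesis
        by (simp add: part)
    qed
    ultimately have "(\<lambda>n. inner (E ?U \<xi>) \<xi> - inner (E (V n) \<xi>) \<xi>) \<longlonglongrightarrow> inner (E ?U \<xi>) \<xi> - inner (E ?U \<xi>) \<xi>"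
      using Ub by (intro tendsto_diff[OF tendsto_const]) (simp add: \<mu>)
    moreover have "(norm (E (V n) \<xi> - E ?U \<xi>))\<^sup>2 = inner (E ?U \<xi>) \<xi> - inner (E (V n) \<xi>) \<xi>" for n
    proof -
      have "V n \<inter> ?U = V n"
        by (auto simp: V_def)
      then have "E (V n) (E ?U \<xi>) = E (V n) \<xi>"
        using Int[OF Vb Ub] by metis
      from nested_proj_dist[OF proj[OF Vb] proj[OF Ub] this] show ?thesis
        by (simp add: norm_minus_commute)
    qed
    ultimately have "(\<lambda>n. (norm (E (V n) \<xi> - E ?U \<xi>))\<^sup>2) \<longlonglongrightarrow> 0"
      by simp
    from tendsto_real_sqrt[OF this] have "(\<lambda>n. norm (E (V n) \<xi> - E ?U \<xi>)) \<longlonglongrightarrow> 0"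
      by simp
    then show ?thesis
      unfolding sums_def part by (simp add: tendsto_norm_zero_iff LIM_zero_iff)
  qed
  show ?thesis
    unfolding projection_valued_measure_def
    using proj bicommuting_bounded_ops[OF bi x] id Int sums
    by (auto simp: projection_iff intro!: blinfun_eqI)
qed

text \<open>The defect \<open>\<langle>x \<xi>, \<xi>\<rangle> - \<integral> s d\<mu>\<^sub>\<xi>(s)\<close> is additive under splitting \<open>\<xi>\<close> by a spectral projection
  and at most \<open>(b - a) \<parallel>\<xi>\<parallel>\<^sup>2\<close> on the range of \<open>E ]a, b]\<close>; repeated bisection makes it vanish.\<close>

lemma spectral_measureI:
  assumes x: "selfadjoint x" and E: "projection_valued_measure E"
    and bi: "\<And>B. B \<in> sets borel \<Longrightarrow> bicommuting x (E B)"
    and le: "\<And>t \<xi>. E {..t} \<xi> = \<xi> \<Longrightarrow> inner (x \<xi>) \<xi> \<le> t * (norm \<xi>)\<^sup>2"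
    and ge: "\<And>t \<xi>. E {..t} \<xi> = 0 \<Longrightarrow> t * (norm \<xi>)\<^sup>2 \<le> inner (x \<xi>) \<xi>"
  shows "spectral_measure x E"
proof -
  have s: "symm x"
    using x by (simp add: selfadjoint_iff)
  \<comment> \<open>The extra 1 compensates for \<open>le\<close> and \<open>ge\<close> being
    non-strict: the support can then be confined to ]-K, K].\<close>
  define K where "K = norm x + 1"
  have split: "\<xi> = E {..t} \<xi> + E {t<..} \<xi>" for t \<xi>
    using pvm_compl[OF E, of "{..t}"] by (simp add: blinfun.bilinear_simps)
  have disj: "{..t} \<inter> {t<..} = {}" for t :: real
    by auto
  have Ioc: "E {a<..b} \<xi> = E {a<..} (E {..b} \<xi>)" for a b \<xi>
  proof -
    have "{a<..b} = {a<..} \<inter> {..b}"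
      by auto
    then show ?thesis
      by (simp add: pvm_Int[OF E])
  qed
  have top: "E {..K} \<xi> = \<xi>" for \<xi>
  proof -
    have "E {K<..} \<xi> = 0"
    proof (rule ccontr)
      define \<zeta> where "\<zeta> = E {K<..} \<xi>"
      assume "E {K<..} \<xi> \<noteq> 0"
      then have "norm x * (norm \<zeta>)\<^sup>2 < K * (norm \<zeta>)\<^sup>2"
        by (intro mult_strict_right_mono) (simp_all add: K_def \<zeta>_def)
      moreover have "E {..K} \<zeta> = 0"
        by (simp add: \<zeta>_def pvm_Int[OF E] disj pvm_empty[OF E])
      ultimately show False
        using ge[of K \<zeta>] inner_le_norm_blinfun[of x \<zeta>] by simp
    qed
    then show ?thesis
      using split[of \<xi> K] by simp
  qed
  have bot: "E {..- K} \<xi> = 0" for \<xi>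
  proof (rule ccontr)
    define \<zeta> where "\<zeta> = E {..- K} \<xi>"
    assume "E {..- K} \<xi> \<noteq> 0"
    then have "- K * (norm \<zeta>)\<^sup>2 < - norm x * (norm \<zeta>)\<^sup>2"
      by (intro mult_strict_right_mono) (simp_all add: K_def \<zeta>_def)
    moreover have "E {..- K} \<zeta> = \<zeta>"
      by (simp add: \<zeta>_def pvm_Int[OF E])
    ultimately show False
      using le[of "- K" \<zeta>] inner_le_norm_blinfun[of x \<zeta>] by simp
  qed
  have full: "E {- K<..K} \<xi> = \<xi>" for \<xi>
    using split[of \<xi> "- K"] by (simp add: Ioc top bot)
  have int: "integrable (scalar_measure E \<xi>) (\<lambda>s. s)" for \<xi>
  proof (rule finite_measure.integrable_const_bound[OF finite_scalar_measure[OF E]])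
    have "AE s in scalar_measure E \<xi>. s \<in> {- K<..K}"
      using AE_scalar_measure[OF E _ full] by simp
    then show "AE s in scalar_measure E \<xi>. norm s \<le> K"
      by eventually_elim auto
    show "(\<lambda>s. s) \<in> borel_measurable (scalar_measure E \<xi>)"
      by (simp add: measurable_cong_sets[OF sets_scalar_measure[OF E] refl])
  qed
  define D where "D \<xi> = inner (x \<xi>) \<xi> - (\<integral>s. s \<partial>scalar_measure E \<xi>)" for \<xi>
  have D_split: "D \<xi> = D (E {..t} \<xi>) + D (E {t<..} \<xi>)"
    and norm_split: "(norm \<xi>)\<^sup>2 = (norm (E {..t} \<xi>))\<^sup>2 + (norm (E {t<..} \<xi>))\<^sup>2" for t \<xi>
  proof -
    let ?p = "E {..t}" and ?q = "E {t<..}"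
    have orth: "inner (?p \<zeta>) (?q \<eta>) = 0" for \<zeta> \<eta>
    proof -
      have "inner (?p \<zeta>) (?q \<eta>) = inner \<zeta> (?p (?q \<eta>))"
        by (rule symmD[OF proj_symm[OF pvm_proj[OF E]]]) simp
      then show ?thesis
        by (simp add: pvm_Int[OF E] disj pvm_empty[OF E])
    qed
    have "x (?p \<xi>) = ?p (x \<xi>)" "x (?q \<xi>) = ?q (x \<xi>)"
      by (simp_all add: commutingD[OF bicommuting_self[OF bi]])
    then have "inner (x (?p \<xi>)) (?q \<xi>) = 0" "inner (x (?q \<xi>)) (?p \<xi>) = 0"
      using orth[of "x \<xi>" \<xi>] orth[of \<xi> "x \<xi>"] by (simp_all add: inner_commute)
    moreover have "inner (x \<xi>) \<xi> = inner (x (?p \<xi> + ?q \<xi>)) (?p \<xi> + ?q \<xi>)"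
      using split[of \<xi> t] by simp
    ultimately have "inner (x \<xi>) \<xi> = inner (x (?p \<xi>)) (?p \<xi>) + inner (x (?q \<xi>)) (?q \<xi>)"
      by (simp only: blinfun.add_right inner_add_left inner_add_right)
    then show "D \<xi> = D (?p \<xi>) + D (?q \<xi>)"
      using integral_scalar_measure_split[OF E _ int, of "{..t}" \<xi>] by (simp add: D_def)
    have "(norm \<xi>)\<^sup>2 = (norm (?p \<xi> + ?q \<xi>))\<^sup>2"
      using split[of \<xi> t] by simp
    also have "\<dots> = (norm (?p \<xi>))\<^sup>2 + (norm (?q \<xi>))\<^sup>2"
      using orth by (intro norm_add_Pythagorean) (simp add: orthogonal_def)
    finally show "(norm \<xi>)\<^sup>2 = (norm (?p \<xi>))\<^sup>2 + (norm (?q \<xi>))\<^sup>2" .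
  qed
  have bisect: "\<bar>D \<xi>\<bar> \<le> (b - a) / 2 ^ n * (norm \<xi>)\<^sup>2" if "a \<le> b" "E {a<..b} \<xi> = \<xi>" for n a b \<xi>
    using that
  proof (induction n arbitrary: a b \<xi>)
    case 0
    have Eb: "E {..b} \<xi> = \<xi>" and Ea: "E {..a} \<xi> = 0"
    proof -
      have "{..b} \<inter> {a<..b} = {a<..b}" "{..a} \<inter> {a<..b} = {}"
        by auto
      then show "E {..b} \<xi> = \<xi>" "E {..a} \<xi> = 0"
        using pvm_Int[OF E, of "{..b}" "{a<..b}" \<xi>] pvm_Int[OF E, of "{..a}" "{a<..b}" \<xi>] 0
        by (simp_all add: pvm_empty[OF E])
    qed
    have ae: "AE s in scalar_measure E \<xi>. s \<in> {a<..b}"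
      using AE_scalar_measure[OF E _ 0(2)] by simp
    then have "AE s in scalar_measure E \<xi>. a \<le> s" "AE s in scalar_measure E \<xi>. s \<le> b"
      by (eventually_elim, simp)+
    then have "a * (norm \<xi>)\<^sup>2 \<le> (\<integral>s. s \<partial>scalar_measure E \<xi>)" "(\<integral>s. s \<partial>scalar_measure E \<xi>) \<le> b * (norm \<xi>)\<^sup>2"
      by (auto intro: scalar_integral_ge[OF E int] scalar_integral_le[OF E int])
    then have "\<bar>D \<xi>\<bar> \<le> b * (norm \<xi>)\<^sup>2 - a * (norm \<xi>)\<^sup>2"
      using le[OF Eb] ge[OF Ea] by (simp add: D_def)
    then show ?case
      by (simp add: left_diff_distrib)
  next
    case (Suc n)
    define c where "c = (a + b) / 2"
    have c: "a \<le> c" "c \<le> b"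
      using Suc.prems by (simp_all add: c_def)
    have "{a<..c} \<inter> {..c} = {a<..c}" "{..c} \<inter> {a<..b} = {a<..c}" "{c<..b} \<inter> {c<..} = {c<..b}" "{c<..} \<inter> {a<..b} = {c<..b}"
      using c by auto
    then have "E {a<..c} (E {..c} \<xi>) = E {..c} \<xi>" "E {c<..b} (E {c<..} \<xi>) = E {c<..} \<xi>"
      using Suc.prems(2) pvm_Int[OF E, of "{..c}" "{a<..b}" \<xi>] pvm_Int[OF E, of "{c<..}" "{a<..b}" \<xi>]
      by (simp_all add: pvm_Int[OF E])
    from Suc.IH[OF c(1) this(1)] Suc.IH[OF c(2) this(2)]
    have "\<bar>D (E {..c} \<xi>)\<bar> + \<bar>D (E {c<..} \<xi>)\<bar> \<le>
        (c - a) / 2 ^ n * (norm (E {..c} \<xi>))\<^sup>2 + (b - c) / 2 ^ n * (norm (E {c<..} \<xi>))\<^sup>2"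
      by simp
    also have "\<dots> = (b - a) / 2 ^ Suc n * (norm \<xi>)\<^sup>2"
      unfolding norm_split[of \<xi> c] by (simp add: c_def field_simps)
    finally show ?case
      using D_split[of \<xi> c] by linarith
  qed
  have "D \<xi> = 0" for \<xi>
  proof -
    have "(\<lambda>n. (K - - K) * (norm \<xi>)\<^sup>2 * (1 / 2) ^ n) \<longlonglongrightarrow> (K - - K) * (norm \<xi>)\<^sup>2 * 0"
      by (intro tendsto_intros LIMSEQ_power_zero) simp
    moreover have "0 \<le> K"
      by (simp add: K_def add_nonneg_nonneg)
    then have "\<bar>D \<xi>\<bar> \<le> (K - - K) * (norm \<xi>)\<^sup>2 * (1 / 2) ^ n" for n
      using bisect[of "- K" K \<xi> n] full by (simp add: power_one_over field_simps)
    ultimately have "\<bar>D \<xi>\<bar> \<le> (K - - K) * (norm \<xi>)\<^sup>2 * 0"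
      by (meson LIMSEQ_le_const)
    then show ?thesis
      by simp
  qed
  then have eq: "inner (x \<xi>) \<xi> = (\<integral>s. s \<partial>scalar_measure E \<xi>)" for \<xi>
    by (simp add: D_def)
  have im: "Im (cinner (x \<xi>) \<xi>) = 0" for \<xi>
  proof -
    have "cinner (x \<xi>) \<xi> = cnj (cinner (x \<xi>) \<xi>)"
      using x cinner_commute[of \<xi> "x \<xi>"] by (simp add: selfadjoint_def)
    from arg_cong[OF this, of Im] show ?thesis
      by simp
  qed
  show ?thesis
    unfolding spectral_measure_def
    using E int eq im by (auto simp: complex_eq_iff Re_cinner)
qed

section \<open>Existence and half-line spectral projections\<close>

lemma spectral_measure_exists:
  assumes x: "selfadjoint x"
  obtains E where "spectral_measure x E" "\<And>B. B \<in> sets borel \<Longrightarrow> bicommuting x (E B)"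
proof -
  have b: "x \<in> bounded_ops" and s: "symm x"
    using x by (simp_all add: selfadjoint_iff)
  obtain E \<mu> where fin: "\<And>\<xi>. finite_borel_measure (\<mu> \<xi>)"
    and \<mu>: "\<And>\<xi>. measure (\<mu> \<xi>) UNIV = (norm \<xi>)\<^sup>2"
      "\<And>B \<xi>. B \<in> sets borel \<Longrightarrow> inner (blinfun_apply (E B) \<xi>) \<xi> = measure (\<mu> \<xi>) B"
    and E: "\<And>B. B \<in> sets borel \<Longrightarrow> proj (E B)" "\<And>B. B \<in> sets borel \<Longrightarrow> bicommuting x (E B)"
    and le: "\<And>t \<xi>. E {..t} \<xi> = \<xi> \<Longrightarrow> inner (x \<xi>) \<xi> \<le> t * (norm \<xi>)\<^sup>2"
    and ge: "\<And>t \<xi>. E {..t} \<xi> = 0 \<Longrightarrow> t * (norm \<xi>)\<^sup>2 \<le> inner (x \<xi>) \<xi>"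
    using spectral_resolution[OF s] by metis
  have "projection_valued_measure E"
    by (rule pvm_from_measures[OF b fin \<mu>(1) E \<mu>(2)])
  then have "spectral_measure x E"
    using x E le ge by (intro spectral_measureI)
  then show thesis
    using that E by blast
qed

text \<open>\<open>disj\<close> is quantified over both measures so that it can be applied in either
  order, giving mutual absorption of \<open>E B\<close> and a rival value. These commute, since
  \<open>E B\<close> is in the bicommutant of \<open>x\<close> and the rival commutes with
  \<open>x\<close>.\<close>

lemma spectral_projection_eqI:
  assumes x: "selfadjoint x" and E: "spectral_measure x E" and bi: "bicommuting x (E B)" and B: "B \<in> sets borel"
    and disj: "\<And>E E' \<xi>. spectral_measure x E \<Longrightarrow> spectral_measure x E' \<Longrightarrow> E B \<xi> = \<xi> \<Longrightarrow> E' B \<xi> = 0 \<Longrightarrow> \<xi> = 0"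
  shows "spectral_projection B x = E B"
  unfolding spectral_projection_def
proof (rule the_equality)
  show "\<exists>E'. spectral_measure x E' \<and> E B = E' B"
    using E by blast
  fix p assume "\<exists>E'. spectral_measure x E' \<and> p = E' B"
  then obtain E' where E': "spectral_measure x E'" "p = E' B"
    by blast
  have p: "proj (E B)" "proj p"
    using pvm_proj[OF spectral_measureD(1)] E E' B by auto
  have c: "commuting (E B) p"
    using bicommutingD[OF bi spectral_measure_commuting[OF x E'(1) B]] E'(2) by simp
  show "p = E B"
  proof (rule blinfun_eqI)
    fix \<xi>
    have "p (E B \<xi>) = E B \<xi>"
      using disj[OF E E'(1)] E'(2) by (intro proj_absorb p c) auto
    moreover have "E B (p \<xi>) = p \<xi>"
      using disj[OF E'(1) E] E'(2) by (intro proj_absorb p commuting_sym[OF c]) auto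
    ultimately show "p \<xi> = E B \<xi>"
      using commutingD[OF c] by simp
  qed
qed

text \<open>On half-lines, the form bound on the range for one measure contradicts the one on the
  kernel for the other, since one of the two is strict.\<close>

lemma spectral_projection_halfline:
  assumes x: "selfadjoint x" and E: "spectral_measure x E" and bi: "\<And>B. B \<in> sets borel \<Longrightarrow> bicommuting x (E B)"
  shows "spectral_projection {..t} x = E {..t}" "e_below t x = E {..<t}"
  unfolding e_below_def
  by (rule spectral_projection_eqI[OF x E bi];
      (meson spectral_measure_bounds not_less | simp))+

lemma spectral_projection_atMost:
  assumes x: "selfadjoint x"
  shows "projection (spectral_projection {..t} x)"
    and "bicommuting x (spectral_projection {..t} x)"
    and "spectral_projection {..t} x \<xi> = \<xi> \<Longrightarrow> inner (x \<xi>) \<xi> \<le> t * (norm \<xi>)\<^sup>2"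
proof -
  obtain E where E: "spectral_measure x E" and bi: "\<And>B. B \<in> sets borel \<Longrightarrow> bicommuting x (E B)"
    using spectral_measure_exists[OF x] by blast
  have eq: "spectral_projection {..t} x = E {..t}"
    by (rule spectral_projection_halfline[OF x E bi])
  show "projection (spectral_projection {..t} x)" "bicommuting x (spectral_projection {..t} x)"
    "spectral_projection {..t} x \<xi> = \<xi> \<Longrightarrow> inner (x \<xi>) \<xi> \<le> t * (norm \<xi>)\<^sup>2"
    using E bi spectral_measure_bounds(1)[OF E] unfolding eq
    by (auto simp: spectral_measure_def projection_valued_measure_def)
qed

lemma e_perp_properties:
  assumes x: "selfadjoint x"
  shows projection_e_perp: "projection (e_perp t x)"
    and bicommuting_e_perp: "bicommuting x (e_perp t x)"
    and e_perp_ge: "e_perp t x \<xi> = \<xi> \<Longrightarrow> t * (norm \<xi>)\<^sup>2 \<le> inner (x \<xi>) \<xi>"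
    and e_perp_less: "e_perp t x \<xi> = 0 \<Longrightarrow> \<xi> \<noteq> 0 \<Longrightarrow> inner (x \<xi>) \<xi> < t * (norm \<xi>)\<^sup>2"
    and e_below_left_continuous: "(\<lambda>n. e_below (t - 1 / real (Suc n)) x \<xi>) \<longlonglongrightarrow> e_below t x \<xi>"
proof -
  obtain E where E: "spectral_measure x E" and bi: "\<And>B. B \<in> sets borel \<Longrightarrow> bicommuting x (E B)"
    using spectral_measure_exists[OF x] by blast
  note pvm = spectral_measureD(1)[OF E]
  have eq: "e_below t x = E {..<t}" for t
    by (rule spectral_projection_halfline[OF x E bi])
  show "bicommuting x (e_perp t x)"
    using bi[of "{..<t}"] by (auto simp: e_perp_def eq bicommuting_def commuting_diff)
  then show "projection (e_perp t x)"
    using x pvm_proj[OF pvm, of "{..<t}"] proj_complement bicommuting_bounded_ops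
    by (auto simp: projection_iff selfadjoint_iff e_perp_def eq)
  show "t * (norm \<xi>)\<^sup>2 \<le> inner (x \<xi>) \<xi>" if "e_perp t x \<xi> = \<xi>"
    using that spectral_measure_bounds(4)[OF E] by (simp add: e_perp_def eq blinfun.bilinear_simps)
  show "inner (x \<xi>) \<xi> < t * (norm \<xi>)\<^sup>2" if "e_perp t x \<xi> = 0" "\<xi> \<noteq> 0"
    using that spectral_measure_bounds(3)[OF E] by (simp add: e_perp_def eq blinfun.bilinear_simps)
  \<comment> \<open>These half-lines increase to the open half-line below t, so continuity of the
    scalar measure from below gives strong convergence of the projections.\<close>
  let ?A = "\<lambda>n. {..<t - 1 / real (Suc n)}"
  have inc: "incseq ?A"
    by (auto simp: incseq_def frac_le intro: order_less_le_trans)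
  have un: "(\<Union>n. ?A n) = {..<t}"
  proof (intro equalityI subsetI)
    fix s assume "s \<in> {..<t}"
    then obtain n where "1 / real (Suc n) < t - s"
      using nat_approx_posE[of "t - s"] by auto
    then show "s \<in> (\<Union>n. ?A n)"
      by (auto intro!: exI[of _ n])
  qed (auto intro: less_trans)
  have "(\<lambda>n. measure (scalar_measure E \<xi>) (?A n)) \<longlonglongrightarrow> measure (scalar_measure E \<xi>) {..<t}"
  proof -
    have "range ?A \<subseteq> sets (scalar_measure E \<xi>)"
      by (auto simp: sets_scalar_measure[OF pvm])
    from finite_measure.finite_Lim_measure_incseq[OF finite_scalar_measure[OF pvm] this inc] show ?thesis
      unfolding un .
  qed
  then have "(\<lambda>n. inner (E {..<t} \<xi>) \<xi> - inner (E (?A n) \<xi>) \<xi>) \<longlonglongrightarrow> inner (E {..<t} \<xi>) \<xi> - inner (E {..<t} \<xi>) \<xi>"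
    by (intro tendsto_diff[OF tendsto_const]) (simp add: measure_scalar_measure[OF pvm])
  moreover have "inner (E {..<t} \<xi>) \<xi> - inner (E (?A n) \<xi>) \<xi> = (norm (E (?A n) \<xi> - E {..<t} \<xi>))\<^sup>2" for n
  proof -
    have "?A n \<inter> {..<t} = ?A n"
      by (auto intro: less_trans)
    then have "E (?A n) (E {..<t} \<xi>) = E (?A n) \<xi>"
      using pvm_Int[OF pvm, of "?A n" "{..<t}" \<xi>] by simp
    from nested_proj_dist[OF pvm_proj[OF pvm] pvm_proj[OF pvm] this] show ?thesis
      by (simp add: norm_minus_commute)
  qed
  ultimately have "(\<lambda>n. (norm (E (?A n) \<xi> - E {..<t} \<xi>))\<^sup>2) \<longlonglongrightarrow> 0"
    by simp
  from tendsto_real_sqrt[OF this] show "(\<lambda>n. e_below (t - 1 / real (Suc n)) x \<xi>) \<longlonglongrightarrow> e_below t x \<xi>"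
    by (simp add: eq tendsto_norm_zero_iff LIM_zero_iff)
qed

section \<open>Tensor products of operators\<close>

lemma cinner_scaleR_left: "cinner (r *\<^sub>R \<xi>) \<eta> = of_real r * cinner \<xi> \<eta>"
  using cinner_scaleC_left[of "of_real r" \<xi> \<eta>] by (simp add: scaleC_of_real)

lemma Im_cinner_self: "Im (cinner \<xi> \<xi>) = 0"
  using arg_cong[OF cinner_commute[of \<xi> \<xi>], of Im] by simp

text \<open>Lets every result about the first tensor factor be reused for the second.\<close>

lemma hilbert_tensor_flip:
  assumes "hilbert_tensor T"
  shows "hilbert_tensor (\<lambda>\<eta> \<xi>. T \<xi> \<eta>)"
proof -
  have "{T \<xi> \<eta> |\<eta> \<xi>. True} = {T \<xi> \<eta> |\<xi> \<eta>. True}"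
    by blast
  then show ?thesis
    using assms by (simp add: hilbert_tensor_def mult.commute)
qed

context
  fixes T :: "'a::chilbert_space \<Rightarrow> 'b::chilbert_space \<Rightarrow> 'k::chilbert_space"
  assumes T: "hilbert_tensor T"
begin

lemma tensor_add_left: "T (\<xi> + \<xi>') \<eta> = T \<xi> \<eta> + T \<xi>' \<eta>"
  and tensor_add_right: "T \<xi> (\<eta> + \<eta>') = T \<xi> \<eta> + T \<xi> \<eta>'"
  and tensor_scaleC_left: "T (c *\<^sub>C \<xi>) \<eta> = c *\<^sub>C T \<xi> \<eta>"
  and tensor_scaleC_right: "T \<xi> (c *\<^sub>C \<eta>) = c *\<^sub>C T \<xi> \<eta>"
  and cinner_tensor: "cinner (T \<xi> \<eta>) (T \<xi>' \<eta>') = cinner \<xi> \<xi>' * cinner \<eta> \<eta>'"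
  and tensor_dense: "closure (span {T \<xi> \<eta> |\<xi> \<eta>. True}) = UNIV"
  using T by (simp_all add: hilbert_tensor_def)

lemma tensor_scaleR_left: "T (r *\<^sub>R \<xi>) \<eta> = r *\<^sub>R T \<xi> \<eta>"
  and tensor_scaleR_right: "T \<xi> (r *\<^sub>R \<eta>) = r *\<^sub>R T \<xi> \<eta>"
  by (simp_all add: tensor_scaleC_left tensor_scaleC_right flip: scaleC_of_real)

lemma norm_tensor: "norm (T \<xi> \<eta>) = norm \<xi> * norm \<eta>"
proof -
  have "inner (T \<xi> \<eta>) (T \<xi> \<eta>) = inner \<xi> \<xi> * inner \<eta> \<eta>"
    using cinner_tensor[of \<xi> \<eta> \<xi> \<eta>] by (simp add: Im_cinner_self flip: Re_cinner)
  then show ?thesis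
    by (simp add: norm_eq_sqrt_inner real_sqrt_mult)
qed

lemma bounded_bilinear_tensor: "bounded_bilinear T"
  by unfold_locales
    (auto simp: tensor_add_left tensor_add_right tensor_scaleR_left tensor_scaleR_right norm_tensor intro!: exI[of _ 1])

lemma tensor_ext:
  fixes f g :: "'k \<Rightarrow> 'c::real_normed_vector"
  assumes f: "bounded_linear f" and g: "bounded_linear g" and eq: "\<And>\<xi> \<eta>. f (T \<xi> \<eta>) = g (T \<xi> \<eta>)"
  shows "f u = g u"
proof -
  have "u \<in> closure (span {T \<xi> \<eta> |\<xi> \<eta>. True})"
    unfolding tensor_dense by (rule UNIV_I)
  moreover have "closure (span {T \<xi> \<eta> |\<xi> \<eta>. True}) \<subseteq> {u. f u = g u}"
  proof (rule closure_minimal)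
    show "span {T \<xi> \<eta> |\<xi> \<eta>. True} \<subseteq> {u. f u = g u}"
      using eq by (intro span_minimal)
        (auto simp: subspace_def linear_simps[OF f] linear_simps[OF g])
    show "closed {u. f u = g u}"
      using f g by (intro closed_Collect_eq linear_continuous_on)
  qed
  ultimately show ?thesis
    by blast
qed

lemma tensor_blinfun_ext:
  assumes "\<And>\<xi> \<eta>. blinfun_apply x (T \<xi> \<eta>) = blinfun_apply y (T \<xi> \<eta>)"
  shows "x = y"
  by (rule blinfun_eqI) (rule tensor_ext[OF blinfun.bounded_linear_right blinfun.bounded_linear_right assms])

lemma op_tensor_eqI:
  assumes "\<And>\<xi> \<eta>. blinfun_apply z (T \<xi> \<eta>) = T (blinfun_apply x \<xi>) (blinfun_apply y \<eta>)"
  shows "op_tensor T x y = z"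
  unfolding op_tensor_def using assms by (intro the_equality) (auto intro: tensor_blinfun_ext)

lemma tensor_bounded_ops:
  assumes x: "x \<in> bounded_ops" and z: "\<And>\<xi> \<eta>. blinfun_apply z (T \<xi> \<eta>) = T (blinfun_apply x \<xi>) \<eta>"
  shows "z \<in> bounded_ops"
  unfolding bounded_ops_iff
proof
  fix c
  have "z o\<^sub>L scalar_op c = scalar_op c o\<^sub>L z"
    by (rule tensor_blinfun_ext)
      (simp add: scalar_op.rep_eq z bounded_ops_scaleC[OF x] flip: tensor_scaleC_left)
  then show "commuting z (scalar_op c)"
    by (simp add: commuting_def)
qed

text \<open>Symmetry is checked on elementary tensors and extended by density in one argument at a
  time.\<close>

lemma tensor_symm:
  assumes x: "selfadjoint x" and z: "\<And>\<xi> \<eta>. blinfun_apply z (T \<xi> \<eta>) = T (blinfun_apply x \<xi>) \<eta>"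
  shows "symm z"
proof -
  have 1: "inner (z (T \<xi> \<eta>)) (T \<xi>' \<eta>') = inner (T \<xi> \<eta>) (z (T \<xi>' \<eta>'))" for \<xi> \<eta> \<xi>' \<eta>'
    using x by (simp add: z cinner_tensor selfadjoint_def flip: Re_cinner)
  have 2: "inner (z u) (T \<xi>' \<eta>') = inner u (z (T \<xi>' \<eta>'))" for u \<xi>' \<eta>'
    by (rule tensor_ext[where f = "\<lambda>u. inner (z u) (T \<xi>' \<eta>')"]) (auto simp: 1 intro!: bounded_linear_intros)
  have "inner (z u) v = inner u (z v)" for u v
    by (rule tensor_ext[where f = "\<lambda>v. inner (z u) v"]) (auto simp: 2 intro!: bounded_linear_intros)
  then show ?thesis
    by (simp add: symm_def)
qed

text \<open>Boundedness of \<open>x \<otimes> 1\<close> on the algebraic tensor product: with \<open>w = (\<parallel>x\<parallel>\<^sup>2 - x\<^sup>2)\<^bsup>1/2\<^esup>\<close>, the map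
  \<open>\<xi> \<otimes> \<eta> \<mapsto> (x \<xi> \<otimes> \<eta>, w \<xi> \<otimes> \<eta>)\<close> multiplies inner products by \<open>\<parallel>x\<parallel>\<^sup>2\<close>. The extension is obtained
  as the closure of the graph.\<close>

lemma tensor_left_exists:
  fixes x :: "'a \<Rightarrow>\<^sub>L 'a"
  assumes x: "selfadjoint x"
  obtains z where "\<And>\<xi> \<eta>. blinfun_apply z (T \<xi> \<eta>) = T (x \<xi>) \<eta>"
proof -
  define K where "K = norm x"
  have b: "x \<in> bounded_ops" and s: "symm x"
    using x by (simp_all add: selfadjoint_iff)
  define c where "c = K\<^sup>2 *\<^sub>R id_blinfun - (x o\<^sub>L x)"
  have "posop c"
    unfolding posop_def
  proof (intro conjI allI)
    show "symm c"
      unfolding c_def by (intro symm_diff symm_scaleR symm_id symm_square s)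
    show "0 \<le> inner (c \<xi>) \<xi>" for \<xi>
      using power_mono[OF norm_blinfun[of x \<xi>], of 2] inner_square[OF s, of \<xi>]
      by (simp add: c_def K_def blinfun.bilinear_simps inner_diff_left power_mult_distrib power2_norm_eq_inner)
  qed
  then obtain w where w: "posop w" "w o\<^sub>L w = c" "bicommuting c w"
    using posop_sqrt by blast
  have "c \<in> bounded_ops"
    unfolding c_def using b by (intro bounded_ops_closed)
  then have wsa: "selfadjoint w"
    using w bicommuting_bounded_ops by (auto simp: selfadjoint_iff posop_def)
  have ww: "x (x \<xi>) + w (w \<xi>) = K\<^sup>2 *\<^sub>R \<xi>" for \<xi>
    using arg_cong[OF w(2), of "\<lambda>f. blinfun_apply f \<xi>"] by (simp add: c_def blinfun.bilinear_simps)
  define gen where "gen = {(T \<xi> \<eta>, T (x \<xi>) \<eta>, T (w \<xi>) \<eta>) |\<xi> \<eta>. True}"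
  define G where "G = span gen"
  \<comment> \<open>Polarised defect of the identity claimed for the map: it vanishes on generators,
    hence bilinearly on their span. On the diagonal it bounds the second coordinate by
    \<open>K\<close> times the first; the third coordinate only serves this identity.\<close>
  define B :: "'k \<times> 'k \<times> 'k \<Rightarrow> 'k \<times> 'k \<times> 'k \<Rightarrow> real" where
    "B p q = inner (fst (snd p)) (fst (snd q)) + inner (snd (snd p)) (snd (snd q)) - K\<^sup>2 * inner (fst p) (fst q)" for p q
  have B0: "B p q = 0" if pq: "p \<in> gen" "q \<in> gen" for p q
  proof -
    obtain \<xi> \<eta> \<xi>' \<eta>' where p: "p = (T \<xi> \<eta>, T (x \<xi>) \<eta>, T (w \<xi>) \<eta>)"
      and q: "q = (T \<xi>' \<eta>', T (x \<xi>') \<eta>', T (w \<xi>') \<eta>')"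
      using pq by (auto simp: gen_def)
    have "cinner (x \<xi>) (x \<xi>') + cinner (w \<xi>) (w \<xi>') = cinner (x (x \<xi>) + w (w \<xi>)) \<xi>'"
      using x wsa by (simp add: selfadjoint_def cinner_add_left)
    also have "\<dots> = of_real (K\<^sup>2) * cinner \<xi> \<xi>'"
      by (simp only: ww cinner_scaleR_left)
    finally have "(cinner (x \<xi>) (x \<xi>') + cinner (w \<xi>) (w \<xi>')) * cinner \<eta> \<eta>' = of_real (K\<^sup>2) * (cinner \<xi> \<xi>' * cinner \<eta> \<eta>')"
      by simp
    then have "cinner (T (x \<xi>) \<eta>) (T (x \<xi>') \<eta>') + cinner (T (w \<xi>) \<eta>) (T (w \<xi>') \<eta>') =
        of_real (K\<^sup>2) * cinner (T \<xi> \<eta>) (T \<xi>' \<eta>')"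
      by (simp add: cinner_tensor distrib_right)
    from arg_cong[OF this, of Re] show ?thesis
      by (simp only: p q B_def fst_conv snd_conv plus_complex.sel Re_cinner Re_complex_of_real
          Im_complex_of_real times_complex.sel)
  qed
  have B1: "B p q = 0" if pq: "p \<in> G" "q \<in> gen" for p q
    using pq(1) unfolding G_def
  proof (induction rule: span_induct)
    show "subspace {p. B p q = 0}"
      by (auto simp: subspace_def B_def inner_add_left algebra_simps simp flip: distrib_left)
  qed (use B0 pq in auto)
  have B2: "B p q = 0" if pq: "p \<in> G" "q \<in> G" for p q
    using pq(2) unfolding G_def
  proof (induction rule: span_induct)
    show "subspace {q. B p q = 0}"
      by (auto simp: subspace_def B_def inner_add_right algebra_simps simp flip: distrib_left)
  qed (use B1 pq in auto)
  have G_le: "norm (fst (snd p)) \<le> K * norm (fst p)" if "p \<in> G" for p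
  proof -
    have "(norm (fst (snd p)))\<^sup>2 + (norm (snd (snd p)))\<^sup>2 = (K * norm (fst p))\<^sup>2"
      using B2[OF that that] by (simp add: B_def power2_norm_eq_inner power_mult_distrib)
    then have "(norm (fst (snd p)))\<^sup>2 \<le> (K * norm (fst p))\<^sup>2"
      by (smt (verit) zero_le_power2)
    then show ?thesis
      by (rule power2_le_imp_le) (simp add: K_def)
  qed
  have G_sub: "p + q \<in> G" "p - q \<in> G" if "p \<in> G" "q \<in> G" for p q
    using that by (simp_all add: G_def span_add span_diff)
  have G_scale: "r *\<^sub>R p \<in> G" if "p \<in> G" for r p
    using that by (simp add: G_def span_scale)
  \<comment> \<open>Closure of the graph of x (x) 1. The norm bound makes it single-valued, and
    completeness together with density of the elementary tensors makes it total.\<close>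
  define R where "R u v \<longleftrightarrow> (\<exists>p::nat \<Rightarrow> _. (\<forall>n. p n \<in> G) \<and> (\<lambda>n. fst (p n)) \<longlonglongrightarrow> u \<and> (\<lambda>n. fst (snd (p n))) \<longlonglongrightarrow> v)" for u v
  have R_add: "R (u + u') (v + v')" if uv: "R u v" and uv': "R u' v'" for u u' v v'
  proof -
    obtain p where "\<forall>n. p n \<in> G" "(\<lambda>n. fst (p n)) \<longlonglongrightarrow> u" "(\<lambda>n. fst (snd (p n))) \<longlonglongrightarrow> v"
      using uv unfolding R_def by blast
    moreover obtain q where "\<forall>n. q n \<in> G" "(\<lambda>n. fst (q n)) \<longlonglongrightarrow> u'" "(\<lambda>n. fst (snd (q n))) \<longlonglongrightarrow> v'"
      using uv' unfolding R_def by blast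
    ultimately show ?thesis
      unfolding R_def by (intro exI[of _ "\<lambda>n. p n + q n"]) (auto intro: G_sub tendsto_add)
  qed
  have R_scale: "R (r *\<^sub>R u) (r *\<^sub>R v)" if uv: "R u v" for r u v
  proof -
    obtain p where "\<forall>n. p n \<in> G" "(\<lambda>n. fst (p n)) \<longlonglongrightarrow> u" "(\<lambda>n. fst (snd (p n))) \<longlonglongrightarrow> v"
      using uv unfolding R_def by blast
    then show ?thesis
      unfolding R_def by (intro exI[of _ "\<lambda>n. r *\<^sub>R p n"]) (auto intro: G_scale tendsto_scaleR)
  qed
  have R_le: "norm v \<le> K * norm u" if uv: "R u v" for u v
  proof -
    obtain p where p: "\<forall>n. p n \<in> G" "(\<lambda>n. fst (p n)) \<longlonglongrightarrow> u" "(\<lambda>n. fst (snd (p n))) \<longlonglongrightarrow> v"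
      using uv unfolding R_def by blast
    show ?thesis
    proof (rule LIMSEQ_le)
      show "(\<lambda>n. norm (fst (snd (p n)))) \<longlonglongrightarrow> norm v" "(\<lambda>n. K * norm (fst (p n))) \<longlonglongrightarrow> K * norm u"
        by (intro tendsto_intros p)+
      show "\<exists>N. \<forall>n\<ge>N. norm (fst (snd (p n))) \<le> K * norm (fst (p n))"
        using G_le p(1) by blast
    qed
  qed
  have R_unique: "v = v'" if "R u v" "R u v'" for u v v'
    using R_le[OF R_add[OF that(1) R_scale[OF that(2), of "-1"]]] by simp
  have R_total: "\<exists>v. R u v" for u
  proof -
    have "{T \<xi> \<eta> |\<xi> \<eta>. True} = fst ` gen"
      by (auto simp: gen_def image_def)
    then have "span {T \<xi> \<eta> |\<xi> \<eta>. True} = fst ` G"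
      by (simp add: G_def linear_span_image[OF linear_fst])
    then have "u \<in> closure (fst ` G)"
      using tensor_dense by (metis UNIV_I)
    then obtain f where "\<And>n. f n \<in> fst ` G" and f: "f \<longlonglongrightarrow> u"
      unfolding closure_sequential by blast
    then have "\<forall>n. \<exists>q. q \<in> G \<and> f n = fst q"
      by blast
    then obtain p where p: "\<And>n. p n \<in> G" "\<And>n. f n = fst (p n)"
      unfolding choice_iff by blast
    have "Cauchy (\<lambda>n. fst (snd (p n)))"
    proof (rule CauchyI)
      fix e :: real assume e: "0 < e"
      have "K + 1 > 0"
        by (simp add: K_def add_nonneg_pos)
      then obtain N where N: "\<And>m n. m \<ge> N \<Longrightarrow> n \<ge> N \<Longrightarrow> norm (f m - f n) < e / (K + 1)"
        using CauchyD[OF LIMSEQ_imp_Cauchy[OF f], of "e / (K + 1)"] e by auto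
      have "norm (fst (snd (p m)) - fst (snd (p n))) < e" if "m \<ge> N" "n \<ge> N" for m n
      proof -
        have "norm (fst (snd (p m)) - fst (snd (p n))) \<le> K * norm (f m - f n)"
          using G_le[OF G_sub(2)[OF p(1)[of m] p(1)[of n]]] by (simp add: p(2))
        also have "\<dots> \<le> (K + 1) * norm (f m - f n)"
          by (intro mult_right_mono) auto
        also have "\<dots> < e"
          using N[OF that] \<open>K + 1 > 0\<close> by (simp add: field_simps)
        finally show ?thesis .
      qed
      then show "\<exists>N. \<forall>m\<ge>N. \<forall>n\<ge>N. norm (fst (snd (p m)) - fst (snd (p n))) < e"
        by blast
    qed
    then obtain v where "(\<lambda>n. fst (snd (p n))) \<longlonglongrightarrow> v"
      using Cauchy_convergent convergent_def by blast
    moreover have "(\<lambda>n. fst (p n)) \<longlonglongrightarrow> u"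
      using f unfolding ext[of f, OF p(2)] .
    ultimately show ?thesis
      unfolding R_def using p(1) by blast
  qed
  define h where "h u = (THE v. R u v)" for u
  have h: "R u (h u)" for u
    unfolding h_def using R_total R_unique by (metis (mono_tags, lifting) theI)
  have hI: "h u = v" if "R u v" for u v
    using R_unique[OF h that] .
  have bl: "bounded_linear h"
    by (rule bounded_linear_intro[where K = K])
      (auto intro: hI R_add R_scale h simp: R_le[OF h] mult.commute[of _ K])
  have "h (T \<xi> \<eta>) = T (x \<xi>) \<eta>" for \<xi> \<eta>
  proof (rule hI)
    have "(T \<xi> \<eta>, T (x \<xi>) \<eta>, T (w \<xi>) \<eta>) \<in> G"
      unfolding G_def gen_def by (rule span_base) blast
    then show "R (T \<xi> \<eta>) (T (x \<xi>) \<eta>)"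
      unfolding R_def by (intro exI[of _ "\<lambda>_. (T \<xi> \<eta>, T (x \<xi>) \<eta>, T (w \<xi>) \<eta>)"]) simp
  qed
  then show thesis
    using that[of "Blinfun h"] by (simp add: bounded_linear_Blinfun_apply[OF bl])
qed

lemma op_tensor_left_apply:
  assumes "selfadjoint x"
  shows "op_tensor T x id_blinfun (T \<xi> \<eta>) = T (x \<xi>) \<eta>"
proof -
  obtain z where z: "\<And>\<xi> \<eta>. blinfun_apply z (T \<xi> \<eta>) = T (x \<xi>) \<eta>"
    using tensor_left_exists[OF assms] by blast
  have "op_tensor T x id_blinfun = z"
    by (rule op_tensor_eqI) (simp add: z)
  then show ?thesis
    by (simp add: z)
qed

lemma selfadjoint_op_tensor_left:
  assumes "selfadjoint x"
  shows "selfadjoint (op_tensor T x id_blinfun)"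
  using tensor_bounded_ops[of x] tensor_symm[OF assms] op_tensor_left_apply[OF assms] assms
  by (auto simp: selfadjoint_iff)

text \<open>A general vector is not an elementary tensor, so positivity is transferred through a
  root: c (x) 1 is the square of the symmetric operator w (x) 1.\<close>

lemma op_tensor_left_nonneg:
  assumes c: "positive_op c"
  shows "0 \<le> inner (op_tensor T c id_blinfun u) u"
proof -
  obtain w where w: "posop w" "w o\<^sub>L w = c" "bicommuting c w"
    using c posop_sqrt by (auto simp: positive_op_iff)
  then have ws: "selfadjoint w"
    using c bicommuting_bounded_ops by (auto simp: selfadjoint_iff posop_def positive_op_iff)
  let ?w = "op_tensor T w id_blinfun"
  have "op_tensor T c id_blinfun = ?w o\<^sub>L ?w"
    using w(2) by (intro op_tensor_eqI) (auto simp: op_tensor_left_apply[OF ws])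
  then show ?thesis
    using inner_square[of ?w u] selfadjoint_op_tensor_left[OF ws] by (simp add: selfadjoint_iff)
qed

text \<open>The bound on the range of \<open>p\<close> is positivity of the compression p (x - t) p,
  and positivity survives tensoring with 1.\<close>

lemma op_tensor_left_ge:
  assumes x: "selfadjoint x" and p: "projection p"
    and ge: "\<And>\<xi>. p \<xi> = \<xi> \<Longrightarrow> t * (norm \<xi>)\<^sup>2 \<le> inner (x \<xi>) \<xi>"
    and u: "op_tensor T p id_blinfun u = u"
  shows "t * (norm u)\<^sup>2 \<le> inner (op_tensor T x id_blinfun u) u"
proof -
  have ps: "selfadjoint p" and pp: "proj p" and sp: "symm p"
    using p by (auto simp: projection_iff selfadjoint_iff proj_symm)
  define c where "c = p o\<^sub>L ((x - t *\<^sub>R id_blinfun) o\<^sub>L p)"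
  have form: "inner (c \<xi>) \<eta> = inner ((x - t *\<^sub>R id_blinfun) (p \<xi>)) (p \<eta>)" for \<xi> \<eta>
    by (simp add: c_def symmD[OF sp])
  have "positive_op c"
    unfolding positive_op_iff posop_def symm_def
  proof (intro conjI allI)
    show "c \<in> bounded_ops"
      using x p unfolding c_def selfadjoint_iff projection_iff by (intro bounded_ops_closed) blast+
    have "symm (x - t *\<^sub>R id_blinfun)"
      using x by (auto simp: selfadjoint_iff intro!: symm_diff symm_scaleR)
    from symm_inner[OF this] show "inner (c \<xi>) \<eta> = inner \<xi> (c \<eta>)" for \<xi> \<eta>
      by (metis form inner_commute)
    show "0 \<le> inner (c \<xi>) \<xi>" for \<xi>
      using ge[OF projD[OF pp], of \<xi>]
      by (simp add: form blinfun.bilinear_simps inner_diff_left power2_norm_eq_inner)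
  qed
  from op_tensor_left_nonneg[OF this, of u]
  have "0 \<le> inner (op_tensor T c id_blinfun u) u" .
  also have "op_tensor T c id_blinfun = op_tensor T p id_blinfun o\<^sub>L
      ((op_tensor T x id_blinfun - t *\<^sub>R id_blinfun) o\<^sub>L op_tensor T p id_blinfun)"
  proof (rule op_tensor_eqI)
    interpret T: bounded_bilinear T
      by (rule bounded_bilinear_tensor)
    fix \<xi> \<eta>
    have "T (x (p \<xi>)) \<eta> - t *\<^sub>R T (p \<xi>) \<eta> = T (x (p \<xi>) - t *\<^sub>R p \<xi>) \<eta>"
      by (simp add: T.diff_left T.scaleR_left)
    then show "(op_tensor T p id_blinfun o\<^sub>L
        ((op_tensor T x id_blinfun - t *\<^sub>R id_blinfun) o\<^sub>L op_tensor T p id_blinfun)) (T \<xi> \<eta>) = T (c \<xi>) (id_blinfun \<eta>)"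
      using op_tensor_left_apply[OF ps] op_tensor_left_apply[OF x]
      by (simp add: blinfun.diff_left blinfun.scaleR_left c_def)
  qed
  also have "inner (\<dots> u) u = inner ((op_tensor T x id_blinfun - t *\<^sub>R id_blinfun) u) (op_tensor T p id_blinfun u)"
    using selfadjoint_op_tensor_left[OF ps] by (simp add: selfadjoint_iff symm_def u)
  finally show ?thesis
    by (simp add: u blinfun.bilinear_simps inner_diff_left power2_norm_eq_inner)
qed

lemma op_tensor_left_le:
  assumes x: "selfadjoint x" and p: "projection p"
    and le: "\<And>\<xi>. p \<xi> = \<xi> \<Longrightarrow> inner (x \<xi>) \<xi> \<le> t * (norm \<xi>)\<^sup>2"
    and u: "op_tensor T p id_blinfun u = u"
  shows "inner (op_tensor T x id_blinfun u) u \<le> t * (norm u)\<^sup>2"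
proof -
  interpret T: bounded_bilinear T
    by (rule bounded_bilinear_tensor)
  have "op_tensor T (- x) id_blinfun = - op_tensor T x id_blinfun"
    by (rule op_tensor_eqI) (simp add: blinfun.minus_left op_tensor_left_apply[OF x] T.minus_left)
  moreover have "- t * (norm u)\<^sup>2 \<le> inner (op_tensor T (- x) id_blinfun u) u"
    using x p u le by (intro op_tensor_left_ge[of "- x" p]) (auto simp: blinfun.minus_left)
  ultimately show ?thesis
    by (simp add: blinfun.minus_left)
qed

end

lemma op_tensor_flip: "op_tensor (\<lambda>\<eta> \<xi>. T \<xi> \<eta>) y x = op_tensor T x y"
  unfolding op_tensor_def by (rule arg_cong[of _ _ The]) auto

context
  fixes T :: "'a::chilbert_space \<Rightarrow> 'b::chilbert_space \<Rightarrow> 'k::chilbert_space"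
  assumes T: "hilbert_tensor T"
begin

lemmas op_tensor_right_apply =
  op_tensor_left_apply[OF hilbert_tensor_flip[OF T], unfolded op_tensor_flip[of T]]
lemmas selfadjoint_op_tensor_right =
  selfadjoint_op_tensor_left[OF hilbert_tensor_flip[OF T], unfolded op_tensor_flip[of T]]
lemmas op_tensor_right_ge =
  op_tensor_left_ge[OF hilbert_tensor_flip[OF T], unfolded op_tensor_flip[of T]]
lemmas op_tensor_right_le =
  op_tensor_left_le[OF hilbert_tensor_flip[OF T], unfolded op_tensor_flip[of T]]

end

section \<open>Modulus and comparison of projections\<close>

lemma proj_commuting_form:
  assumes p: "proj p" and c: "commuting y p"
  shows "inner (y (p \<xi>)) \<xi> = inner (y (p \<xi>)) (p \<xi>)"
proof -
  have "y (p \<xi>) = p (y (p \<xi>))"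
    using commutingD[OF c, of "p \<xi>"] projD[OF p, of \<xi>] by simp
  then have "inner (y (p \<xi>)) \<xi> = inner (p (y (p \<xi>))) \<xi>"
    by simp
  then show ?thesis
    by (simp add: symmD[OF proj_symm[OF p]])
qed

text \<open>Uniqueness of positive roots identifies the modulus with y Q - y (1 - Q), where
  \<open>Q\<close> is the spectral projection for [0, oo).\<close>

lemma op_abs_form:
  fixes y :: "'h::chilbert_space \<Rightarrow>\<^sub>L 'h"
  assumes y: "selfadjoint y"
  defines "Q \<equiv> e_perp 0 y"
  shows "inner (op_abs y \<xi>) \<xi> = inner (y (Q \<xi>)) (Q \<xi>) - inner (y (\<xi> - Q \<xi>)) (\<xi> - Q \<xi>)"
    and "inner (y \<xi>) \<xi> = inner (y (Q \<xi>)) (Q \<xi>) + inner (y (\<xi> - Q \<xi>)) (\<xi> - Q \<xi>)"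
    and "0 \<le> inner (y (Q \<xi>)) (Q \<xi>)" and "inner (y (\<xi> - Q \<xi>)) (\<xi> - Q \<xi>) \<le> 0"
proof -
  have Q: "proj Q"
    using projection_e_perp[OF y] by (simp add: Q_def projection_iff)
  have c: "commuting y Q"
    using bicommuting_e_perp[OF y] by (simp add: Q_def bicommuting_self commuting_sym)
  have s: "symm y"
    using y by (simp add: selfadjoint_iff)
  define q where "q = id_blinfun - Q"
  have q: "proj q" "commuting y q" "q \<xi> = \<xi> - Q \<xi>" for \<xi>
    unfolding q_def using proj_complement[OF Q] c
    by (auto simp: commuting_iff blinfun.bilinear_simps)
  have pos: "0 \<le> inner (y (Q \<xi>)) (Q \<xi>)" for \<xi>
    using e_perp_ge[OF y, of 0 "Q \<xi>"] projD[OF Q] by (simp add: Q_def)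
  have neg: "inner (y (q \<xi>)) (q \<xi>) \<le> 0" for \<xi>
    using e_perp_less[OF y, of 0 "q \<xi>"] projD[OF Q, of \<xi>]
    by (cases "q \<xi> = 0") (simp_all add: q(3) blinfun.bilinear_simps flip: Q_def)
  define a where "a = (y o\<^sub>L Q) - (y o\<^sub>L q)"
  have a_form: "inner (a \<xi>) \<xi> = inner (y (Q \<xi>)) (Q \<xi>) - inner (y (q \<xi>)) (q \<xi>)" for \<xi>
    by (simp add: a_def blinfun.diff_left inner_diff_left proj_commuting_form[OF Q c] proj_commuting_form[OF q(1,2)])
  have "posop a"
    unfolding posop_def
  proof (intro conjI allI)
    show "symm a"
      unfolding a_def by (intro symm_diff symm_compose s proj_symm Q q c)
    show "0 \<le> inner (a \<xi>) \<xi>" for \<xi>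
      using pos[of \<xi>] neg[of \<xi>] by (simp add: a_form)
  qed
  moreover have "a o\<^sub>L a = y o\<^sub>L y"
    by (rule blinfun_eqI)
      (simp add: a_def q(3) blinfun.bilinear_simps commutingD[OF c] projD[OF Q])
  ultimately have "a = op_abs y"
    using posop_sqrt_unique[of a "y o\<^sub>L y" "op_abs y"] op_abs_square[OF y] positive_op_abs[OF y]
      bicommuting_square_abs[OF y] by (simp add: positive_op_iff)
  then show "inner (op_abs y \<xi>) \<xi> = inner (y (Q \<xi>)) (Q \<xi>) - inner (y (\<xi> - Q \<xi>)) (\<xi> - Q \<xi>)"
    using a_form by (simp add: q)
  have "inner (y \<xi>) \<xi> = inner (y (Q \<xi>)) \<xi> + inner (y (q \<xi>)) \<xi>"
    by (simp add: q(3) blinfun.bilinear_simps inner_diff_left)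
  then show "inner (y \<xi>) \<xi> = inner (y (Q \<xi>)) (Q \<xi>) + inner (y (\<xi> - Q \<xi>)) (\<xi> - Q \<xi>)"
    by (simp add: proj_commuting_form Q q(1,2) c flip: q(3))
  show "0 \<le> inner (y (Q \<xi>)) (Q \<xi>)" "inner (y (\<xi> - Q \<xi>)) (\<xi> - Q \<xi>) \<le> 0"
    using pos neg[of \<xi>] by (simp_all add: q)
qed

lemma op_abs_ge:
  assumes "selfadjoint y"
  shows "\<bar>inner (y \<xi>) \<xi>\<bar> \<le> inner (op_abs y \<xi>) \<xi>"
  using op_abs_form[OF assms, of \<xi>] by linarith

text \<open>Only the range of a commuting projection is stable under cutting a vector by the spectral
  projections of \<open>y\<close>; for a single vector the implication fails.\<close>

lemma op_abs_less:
  assumes y: "selfadjoint y" and c: "commuting y r"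
    and less: "\<And>\<zeta>. r \<zeta> = \<zeta> \<Longrightarrow> \<zeta> \<noteq> 0 \<Longrightarrow> \<bar>inner (y \<zeta>) \<zeta>\<bar> < l * (norm \<zeta>)\<^sup>2"
    and \<xi>: "r \<xi> = \<xi>" "\<xi> \<noteq> 0"
  shows "inner (op_abs y \<xi>) \<xi> < l * (norm \<xi>)\<^sup>2"
proof -
  define Q where "Q = e_perp 0 y"
  have Q: "proj Q"
    using projection_e_perp[OF y] by (simp add: Q_def projection_iff)
  have "commuting Q r"
    unfolding Q_def by (rule bicommutingD[OF bicommuting_e_perp[OF y] c])
  then have r: "r (Q \<xi>) = Q \<xi>" "r (\<xi> - Q \<xi>) = \<xi> - Q \<xi>"
    using commutingD[OF \<open>commuting Q r\<close>, of \<xi>] \<xi> by (simp_all add: blinfun.bilinear_simps)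
  have le: "\<bar>inner (y \<zeta>) \<zeta>\<bar> \<le> l * (norm \<zeta>)\<^sup>2" if "r \<zeta> = \<zeta>" for \<zeta>
    using less[OF that] by (cases "\<zeta> = 0") auto
  have "Q \<xi> \<noteq> 0 \<or> \<xi> - Q \<xi> \<noteq> 0"
    using \<xi> by auto
  then have "\<bar>inner (y (Q \<xi>)) (Q \<xi>)\<bar> + \<bar>inner (y (\<xi> - Q \<xi>)) (\<xi> - Q \<xi>)\<bar> < l * (norm (Q \<xi>))\<^sup>2 + l * (norm (\<xi> - Q \<xi>))\<^sup>2"
    using le[OF r(1)] le[OF r(2)] less[OF r(1)] less[OF r(2)] by linarith
  moreover have "(norm (\<xi> - Q \<xi>))\<^sup>2 = (norm \<xi>)\<^sup>2 - (norm (Q \<xi>))\<^sup>2"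
    using nested_proj_dist[OF Q proj_id, of \<xi>] by (simp add: proj_inner[OF Q] power2_norm_eq_inner)
  ultimately show ?thesis
    using op_abs_form[OF y, of \<xi>] unfolding Q_def[symmetric] by (simp add: right_diff_distrib)
qed

text \<open>Turns an inclusion of sets into an inequality of projections: a common vector of the
  range of \<open>r\<close> and the kernel of \<open>e_perp l y\<close> would have form at least l
  and strictly below l.\<close>

lemma e_perp_absorbs:
  assumes y: "selfadjoint y" and r: "projection r" and c: "commuting y r"
    and ge: "\<And>\<xi>. r \<xi> = \<xi> \<Longrightarrow> l * (norm \<xi>)\<^sup>2 \<le> inner (y \<xi>) \<xi>"
  shows "e_perp l y (r \<xi>) = r \<xi>"
proof (rule proj_absorb)
  show "proj r" "proj (e_perp l y)"
    using r projection_e_perp[OF y] by (simp_all add: projection_iff)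
  show "commuting r (e_perp l y)"
    by (rule commuting_sym[OF bicommutingD[OF bicommuting_e_perp[OF y] c]])
  show "\<zeta> = 0" if "r \<zeta> = \<zeta>" "e_perp l y \<zeta> = 0" for \<zeta>
    using ge[OF that(1)] e_perp_less[OF y that(2)] by fastforce
qed

text \<open>Handles the case in which the upper and the lower tail are not disjoint.\<close>

lemma e_perp_nonpos:
  assumes y: "selfadjoint y" and l: "l \<le> 0"
  shows "e_perp l (op_abs y) = id_blinfun"
proof (rule blinfun_eqI)
  fix \<xi>
  have "e_perp l (op_abs y) (id_blinfun \<xi>) = id_blinfun \<xi>"
  proof (rule e_perp_absorbs[OF selfadjoint_abs[OF y]])
    show "projection id_blinfun"
      by (auto simp: projection_iff)
    show "l * (norm \<xi>)\<^sup>2 \<le> inner (op_abs y \<xi>) \<xi>" for \<xi>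
      using op_abs_ge[OF y, of \<xi>] mult_right_mono[OF l, of "(norm \<xi>)\<^sup>2"] by simp
  qed simp
  then show "e_perp l (op_abs y) \<xi> = id_blinfun \<xi>"
    by simp
qed

text \<open>Counterpart of \<open>e_perp_absorbs\<close> for disjoint sets: by commutation, a
  nonzero image would lie in both ranges, where the form bounds conflict.\<close>

lemma e_perp_annihilates:
  assumes y: "selfadjoint y" and r: "projection r" and c: "commuting y r"
    and less: "\<And>\<xi>. r \<xi> = \<xi> \<Longrightarrow> \<xi> \<noteq> 0 \<Longrightarrow> inner (y \<xi>) \<xi> < l * (norm \<xi>)\<^sup>2"
  shows "e_perp l y (r \<xi>) = 0"
proof (rule ccontr)
  assume n: "e_perp l y (r \<xi>) \<noteq> 0"
  have "r (e_perp l y (r \<xi>)) = e_perp l y (r \<xi>)"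
    using r commutingD[OF bicommutingD[OF bicommuting_e_perp[OF y] c]]
    by (metis projD projection_iff)
  moreover have "e_perp l y (e_perp l y (r \<xi>)) = e_perp l y (r \<xi>)"
    using projection_e_perp[OF y] by (simp add: projection_iff projD)
  ultimately show False
    using less[OF _ n] e_perp_ge[OF y] by fastforce
qed

lemma e_below_eq: "e_below t y = id_blinfun - e_perp t y"
  by (simp add: e_perp_def)

lemma bicommuting_shift: "bicommuting x (x - t *\<^sub>R id_blinfun)" "bicommuting x (t *\<^sub>R id_blinfun - x)"
  by (auto simp: bicommuting_def intro!: commuting_diff commuting_scaleR)

lemma inner_shift:
  fixes x :: "'h::real_inner \<Rightarrow>\<^sub>L 'h"
  shows "inner ((x - t *\<^sub>R id_blinfun) \<xi>) \<xi> = inner (x \<xi>) \<xi> - t * (norm \<xi>)\<^sup>2"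
    and "inner ((t *\<^sub>R id_blinfun - x) \<xi>) \<xi> = t * (norm \<xi>)\<^sup>2 - inner (x \<xi>) \<xi>"
  by (simp_all add: blinfun.bilinear_simps inner_diff_left power2_norm_eq_inner)

section \<open>Bicommutants and states\<close>

lemma commutant_closed:
  assumes "p \<in> commutant S" "q \<in> commutant S"
  shows "p + q \<in> commutant S" "p - q \<in> commutant S" "id_blinfun \<in> commutant S"
  using assms by (auto simp: commutant_def blinfun.bilinear_simps intro!: blinfun_eqI)
    (metis blinfun_apply_blinfun_compose)+

text \<open>Elements of the commutant of \<open>S\<close> commute with \<open>y\<close>, hence with
  \<open>p\<close>. This places spectral projections and moduli in the algebra.\<close>

lemma bicommutant_bicommuting:
  assumes y: "y \<in> commutant (commutant S)" and p: "bicommuting y p"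
  shows "p \<in> commutant (commutant S)"
proof -
  have "p \<in> bounded_ops"
    using y p bicommuting_bounded_ops by (auto simp: commutant_def)
  moreover have "u o\<^sub>L p = p o\<^sub>L u" if "u \<in> commutant S" for u
  proof -
    have "commuting y u"
      using y that by (auto simp: commutant_def commuting_def)
    then show ?thesis
      using p by (auto simp: bicommuting_def commuting_def)
  qed
  ultimately show ?thesis
    unfolding commutant_def[of "commutant S"] by auto
qed

lemma subset_bicommutant: "p \<in> S \<Longrightarrow> p \<in> bounded_ops \<Longrightarrow> p \<in> commutant (commutant S)"
  by (auto simp: commutant_def)

text \<open>A projection equals p* p. The vanishing imaginary part lets real parts multiply in the
  product formula for the trace.\<close>

lemma state_projection:
  assumes st: "state_on N \<rho>" and p: "projection p" "p \<in> N"
  shows "0 \<le> Re (\<rho> p)" "Im (\<rho> p) = 0"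
proof -
  have "adj p o\<^sub>L p = p"
    using p by (simp add: projection_def adj_selfadjoint)
  then have "\<rho> p \<in> \<real>\<^sub>\<ge>\<^sub>0"
    using st p(2) unfolding state_on_def by metis
  then show "0 \<le> Re (\<rho> p)" "Im (\<rho> p) = 0"
    by (simp_all add: complex_nonneg_Reals_iff)
qed

lemma state_add: "state_on N \<rho> \<Longrightarrow> p \<in> N \<Longrightarrow> q \<in> N \<Longrightarrow> \<rho> (p + q) = \<rho> p + \<rho> q"
  by (simp add: state_on_def)

lemma state_diff:
  assumes "state_on N \<rho>" "p - q \<in> N" "q \<in> N"
  shows "\<rho> (p - q) = \<rho> p - \<rho> q"
  using state_add[OF assms] by simp

text \<open>Taking adjoints in q p = p gives p q = p, so q - p is itself a projection.\<close>

lemma state_mono: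
  assumes st: "state_on N \<rho>" and p: "projection p" "p \<in> N" and q: "projection q" "q \<in> N" "q - p \<in> N"
    and le: "\<And>\<xi>. q (p \<xi>) = p \<xi>"
  shows "Re (\<rho> p) \<le> Re (\<rho> q)"
proof -
  have pq: "p (q \<xi>) = p \<xi>" for \<xi>
  proof -
    have "inner (p (q \<xi>)) \<eta> = inner (p \<xi>) \<eta>" for \<eta>
      using p(1) q(1) le[of \<eta>] by (simp add: projection_iff proj_def symm_def)
    then show ?thesis
      using vector_eq_rdot by blast
  qed
  have "projection (q - p)"
    unfolding projection_iff proj_def using p(1) q(1)
    by (auto simp: projection_iff symm_diff proj_symm blinfun.bilinear_simps pq le projD intro!: blinfun_eqI)
  then have "0 \<le> Re (\<rho> (q - p))"
    using state_projection(1)[OF st _ q(3)] by blast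
  then show ?thesis
    using state_diff[OF st q(3) p(2)] by simp
qed

section \<open>Tensor products of projections\<close>

context
  fixes T :: "'a::chilbert_space \<Rightarrow> 'b::chilbert_space \<Rightarrow> 'k::chilbert_space"
  assumes T: "hilbert_tensor T"
begin

lemma op_tensor_eq_compose:
  assumes "selfadjoint p" "selfadjoint q"
  shows "op_tensor T p q = op_tensor T p id_blinfun o\<^sub>L op_tensor T id_blinfun q"
  by (rule op_tensor_eqI[OF T])
    (simp add: op_tensor_left_apply[OF T assms(1)] op_tensor_right_apply[OF T assms(2)])

lemma op_tensor_apply:
  assumes "selfadjoint p" "selfadjoint q"
  shows "op_tensor T p q (T \<xi> \<eta>) = T (p \<xi>) (q \<eta>)"
  using op_tensor_eq_compose[OF assms]
  by (simp add: op_tensor_left_apply[OF T assms(1)] op_tensor_right_apply[OF T assms(2)])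

lemma commuting_left_right:
  assumes "selfadjoint p" "selfadjoint q"
  shows "commuting (op_tensor T p id_blinfun) (op_tensor T id_blinfun q)"
  unfolding commuting_def
  by (rule tensor_blinfun_ext[OF T])
    (simp add: op_tensor_left_apply[OF T assms(1)] op_tensor_right_apply[OF T assms(2)])

lemma commuting_left:
  assumes "selfadjoint p" "selfadjoint x" "commuting p x"
  shows "commuting (op_tensor T p id_blinfun) (op_tensor T x id_blinfun)"
  unfolding commuting_def
  by (rule tensor_blinfun_ext[OF T])
    (simp add: op_tensor_left_apply[OF T assms(1)] op_tensor_left_apply[OF T assms(2)] commutingD[OF assms(3)])

lemma projection_left:
  assumes p: "projection p"
  shows "projection (op_tensor T p id_blinfun)"
proof -
  have s: "selfadjoint p"
    using p by (simp add: projection_def)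
  have "op_tensor T p id_blinfun o\<^sub>L op_tensor T p id_blinfun = op_tensor T p id_blinfun"
    using p by (intro tensor_blinfun_ext[OF T]) (simp add: op_tensor_left_apply[OF T s] projection_iff projD)
  then show ?thesis
    using selfadjoint_op_tensor_left[OF T s] by (simp add: projection_def)
qed

end

context
  fixes T :: "'h::chilbert_space \<Rightarrow> 'h \<Rightarrow> 'k::chilbert_space"
  assumes T: "hilbert_tensor T"
begin

lemmas commuting_right =
  commuting_left[OF hilbert_tensor_flip[OF T], unfolded op_tensor_flip[of T]]
lemmas projection_right =
  projection_left[OF hilbert_tensor_flip[OF T], unfolded op_tensor_flip[of T]]

lemma op_tensor_projection:
  assumes p: "projection p" and q: "projection q"
  shows "projection (op_tensor T p q)"
    and "op_tensor T p q u = u \<Longrightarrow> op_tensor T p id_blinfun u = u"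
    and "op_tensor T p q u = u \<Longrightarrow> op_tensor T id_blinfun q u = u"
proof -
  let ?L = "op_tensor T p id_blinfun" and ?R = "op_tensor T id_blinfun q"
  have s: "selfadjoint p" "selfadjoint q"
    using p q by (simp_all add: projection_def)
  note eq = op_tensor_eq_compose[OF T s]
  have c: "commuting ?L ?R"
    by (rule commuting_left_right[OF T s])
  have L: "projection ?L" and R: "projection ?R"
    using projection_left[OF T p] projection_right[OF q] .
  then have Lp: "proj ?L" and Rp: "proj ?R"
    by (simp_all add: projection_iff)
  show "projection (op_tensor T p q)"
    unfolding eq using L R proj_compose[OF Lp Rp c] by (auto simp: projection_iff)
  show "?L u = u" if "op_tensor T p q u = u"
    using that projD[OF Lp, of "?R u"] by (simp add: eq)
  show "?R u = u" if "op_tensor T p q u = u"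
    using that projD[OF Rp, of "?L u"] by (simp add: eq commutingD[OF c])
qed

lemma selfadjoint_symmetrization: "selfadjoint x \<Longrightarrow> selfadjoint (symmetrization T x)"
  unfolding symmetrization_def
  using selfadjoint_op_tensor_left[OF T] selfadjoint_op_tensor_right[OF T] by blast

lemma commuting_symmetrization:
  assumes x: "selfadjoint x" and p: "selfadjoint p" "commuting p x" and q: "selfadjoint q" "commuting q x"
  shows "commuting (symmetrization T x) (op_tensor T p q)"
  unfolding symmetrization_def op_tensor_eq_compose[OF T p(1) q(1)]
  by (intro commuting_diff; rule commuting_sym; intro commuting_compose)
    (auto intro: commuting_left[OF T p(1) x p(2)] commuting_right[OF q(1) x q(2)]
      commuting_left_right[OF T] commuting_sym p q x)

text \<open>The range of p (x) q lies in the ranges of p (x) 1 and 1 (x) q, where x (x) 1 and 1 (x)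
  x are bounded separately.\<close>

lemma symmetrization_ge:
  assumes x: "selfadjoint x" and p: "projection p" and q: "projection q"
    and ge: "\<And>\<xi>. p \<xi> = \<xi> \<Longrightarrow> a * (norm \<xi>)\<^sup>2 \<le> inner (x \<xi>) \<xi>"
    and le: "\<And>\<xi>. q \<xi> = \<xi> \<Longrightarrow> inner (x \<xi>) \<xi> \<le> b * (norm \<xi>)\<^sup>2"
    and u: "op_tensor T p q u = u"
  shows "(a - b) * (norm u)\<^sup>2 \<le> inner (symmetrization T x u) u"
  using op_tensor_left_ge[OF T x p ge op_tensor_projection(2)[OF p q u]]
    op_tensor_right_le[OF T x q le op_tensor_projection(3)[OF p q u]]
  by (simp add: symmetrization_def blinfun.bilinear_simps inner_diff_left left_diff_distrib)

lemma symmetrization_le: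
  assumes x: "selfadjoint x" and p: "projection p" and q: "projection q"
    and le: "\<And>\<xi>. p \<xi> = \<xi> \<Longrightarrow> inner (x \<xi>) \<xi> \<le> a * (norm \<xi>)\<^sup>2"
    and ge: "\<And>\<xi>. q \<xi> = \<xi> \<Longrightarrow> b * (norm \<xi>)\<^sup>2 \<le> inner (x \<xi>) \<xi>"
    and u: "op_tensor T p q u = u"
  shows "inner (symmetrization T x u) u \<le> (a - b) * (norm u)\<^sup>2"
  using op_tensor_left_le[OF T x p le op_tensor_projection(2)[OF p q u]]
    op_tensor_right_ge[OF T x q ge op_tensor_projection(3)[OF p q u]]
  by (simp add: symmetrization_def blinfun.bilinear_simps inner_diff_left left_diff_distrib)

end

section \<open>Symmetrization inequalities\<close>

locale symmetrization_setup =
  fixes M :: "('h::chilbert_space \<Rightarrow>\<^sub>L 'h) set"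
    and \<tau> :: "('h \<Rightarrow>\<^sub>L 'h) \<Rightarrow> complex"
    and T :: "'h \<Rightarrow> 'h \<Rightarrow> 'k::chilbert_space"
    and \<tau>2 :: "('k \<Rightarrow>\<^sub>L 'k) \<Rightarrow> complex"
    and x :: "'h \<Rightarrow>\<^sub>L 'h"
  assumes M: "commutant (commutant M) = M"
    and \<tau>: "state_on M \<tau>"
    and T: "hilbert_tensor T"
    and \<tau>2: "state_on (vn_tensor T M M) \<tau>2"
    and product: "p \<in> M \<Longrightarrow> q \<in> M \<Longrightarrow> \<tau>2 (op_tensor T p q) = \<tau> p * \<tau> q"
    and xM: "x \<in> M"
    and x: "selfadjoint x"
begin

abbreviation "xh \<equiv> symmetrization T x"

lemma bicommuting_mem: "bicommuting x p \<Longrightarrow> p \<in> M"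
  using bicommutant_bicommuting[of x M p] xM by (simp add: M)

lemma M_closed: "p \<in> M \<Longrightarrow> q \<in> M \<Longrightarrow> p + q \<in> M" "p \<in> M \<Longrightarrow> q \<in> M \<Longrightarrow> p - q \<in> M" "id_blinfun \<in> M"
  using commutant_closed[of _ "commutant M"] xM by (auto simp: M)

lemma xh: "selfadjoint xh"
  by (rule selfadjoint_symmetrization[OF T x])

lemma tensor_closed:
  "p \<in> vn_tensor T M M \<Longrightarrow> q \<in> vn_tensor T M M \<Longrightarrow> p + q \<in> vn_tensor T M M"
  "p \<in> vn_tensor T M M \<Longrightarrow> q \<in> vn_tensor T M M \<Longrightarrow> p - q \<in> vn_tensor T M M"
  by (simp_all add: vn_tensor_def commutant_closed)

lemma op_tensor_mem: "p \<in> M \<Longrightarrow> q \<in> M \<Longrightarrow> op_tensor T p q \<in> bounded_ops \<Longrightarrow> op_tensor T p q \<in> vn_tensor T M M"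
  unfolding vn_tensor_def by (rule subset_bicommutant) auto

lemma xh_mem: "xh \<in> vn_tensor T M M"
proof -
  have "op_tensor T x id_blinfun \<in> bounded_ops" "op_tensor T id_blinfun x \<in> bounded_ops"
    using selfadjoint_op_tensor_left[OF T x] selfadjoint_op_tensor_right[OF T x] by (simp_all add: selfadjoint_iff)
  then show ?thesis
    unfolding symmetrization_def using xM M_closed(3) by (intro tensor_closed(2) op_tensor_mem)
qed

lemma tensor_bicommuting_mem: "bicommuting xh p \<Longrightarrow> p \<in> vn_tensor T M M"
  using xh_mem unfolding vn_tensor_def by (rule bicommutant_bicommuting)

lemma tensor_projection_mem:
  assumes p: "projection p" "bicommuting x p" and q: "projection q" "bicommuting x q"
  shows "op_tensor T p q \<in> vn_tensor T M M"
    and "Re (\<tau>2 (op_tensor T p q)) = Re (\<tau> p) * Re (\<tau> q)"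
    and "commuting xh (op_tensor T p q)"
proof -
  have M: "p \<in> M" "q \<in> M"
    using p q bicommuting_mem by blast+
  show "op_tensor T p q \<in> vn_tensor T M M"
    using op_tensor_projection(1)[OF T p(1) q(1)] M by (intro op_tensor_mem) (simp_all add: projection_iff)
  show "Re (\<tau>2 (op_tensor T p q)) = Re (\<tau> p) * Re (\<tau> q)"
    using state_projection(2)[OF \<tau> p(1) M(1)] by (simp add: product[OF M])
  show "commuting xh (op_tensor T p q)"
    using p q by (intro commuting_symmetrization[OF T x] bicommuting_self) (simp_all add: projection_def)
qed

lemma symmetrization_tail:
  assumes m: "is_median \<tau> x m"
  shows "Re (\<tau> (e_perp l (x - m *\<^sub>R id_blinfun))) \<le> 2 * Re (\<tau>2 (e_perp l xh))"
proof -
  define y where "y = x - m *\<^sub>R id_blinfun"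
  have y: "selfadjoint y"
    unfolding y_def using x by (intro selfadjoint_closed)
  define p where "p = e_perp l y"
  define q where "q = spectral_projection {..m} x"
  have p: "projection p" "bicommuting x p"
    unfolding p_def using projection_e_perp[OF y] bicommuting_e_perp[OF y] bicommuting_shift(1)[of x m]
    by (auto simp: y_def intro: bicommuting_trans)
  have q: "projection q" "bicommuting x q"
    unfolding q_def by (rule spectral_projection_atMost[OF x])+
  note pq = tensor_projection_mem[OF p q]
  have ge: "l * (norm u)\<^sup>2 \<le> inner (xh u) u" if "op_tensor T p q u = u" for u
  proof -
    \<comment> \<open>The bounds are a = l + m on the first factor, from the tail of x - m, and b =
      m on the second.\<close>
    have "(l + m - m) * (norm u)\<^sup>2 \<le> inner (xh u) u"
    proof (rule symmetrization_ge[OF T x p(1) q(1) _ _ that])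
      show "(l + m) * (norm \<xi>)\<^sup>2 \<le> inner (x \<xi>) \<xi>" if "p \<xi> = \<xi>" for \<xi>
        using e_perp_ge[OF y, of l \<xi>] that unfolding p_def y_def inner_shift by (simp add: distrib_right)
      show "inner (x \<xi>) \<xi> \<le> m * (norm \<xi>)\<^sup>2" if "q \<xi> = \<xi>" for \<xi>
        using spectral_projection_atMost(3)[OF x] that by (simp add: q_def)
    qed
    then show ?thesis
      by simp
  qed
  have "Re (\<tau>2 (op_tensor T p q)) \<le> Re (\<tau>2 (e_perp l xh))"
    using pq op_tensor_projection(1)[OF T p(1) q(1)] projection_e_perp[OF xh] ge
      tensor_bicommuting_mem[OF bicommuting_e_perp[OF xh]]
    by (intro state_mono[OF \<tau>2] e_perp_absorbs[OF xh] tensor_closed)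
  \<comment> \<open>Here the median enters: \<open>q\<close> has trace at least 1/2.\<close>
  moreover have "Re (\<tau> p) * (1 / 2) \<le> Re (\<tau> p) * Re (\<tau> q)"
    using m state_projection(1)[OF \<tau> p(1) bicommuting_mem[OF p(2)]]
    by (intro mult_left_mono) (simp_all add: is_median_def q_def)
  ultimately have "Re (\<tau> p) \<le> 2 * Re (\<tau>2 (e_perp l xh))"
    by (simp add: pq(2))
  then show ?thesis
    by (simp add: p_def y_def)
qed

lemma symmetrization_abs_tail:
  assumes m: "is_median \<tau> x m"
  shows "Re (\<tau> (e_perp l (op_abs (x - m *\<^sub>R id_blinfun)))) \<le> 2 * Re (\<tau>2 (e_perp l (op_abs xh)))"
\<comment> \<open>For l <= 0 both tail projections are 1 and the claim reads 1 <= 2. For l > 0 the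
  upper and lower tails \<open>p1\<close> and \<open>p2\<close> of x - m are orthogonal and can be
  treated separately, each with its own half of the median condition.\<close>
proof (cases "l \<le> 0")
  case True
  have "selfadjoint (x - m *\<^sub>R id_blinfun)"
    using x by (intro selfadjoint_closed)
  then show ?thesis
    using True \<tau> \<tau>2 by (simp add: e_perp_nonpos xh state_on_def)
next
  case False
  define y where "y = x - m *\<^sub>R id_blinfun"
  define y' where "y' = m *\<^sub>R id_blinfun - x"
  have y: "selfadjoint y" "selfadjoint y'"
    unfolding y_def y'_def by (intro selfadjoint_closed(1,3,5) x)+
  have ya: "selfadjoint (op_abs y)"
    by (rule selfadjoint_abs[OF y(1)])
  have bi: "bicommuting x y" "bicommuting x y'"
    by (simp_all add: y_def y'_def bicommuting_shift)
  have form: "inner (y \<xi>) \<xi> = inner (x \<xi>) \<xi> - m * (norm \<xi>)\<^sup>2" "inner (y' \<xi>) \<xi> = m * (norm \<xi>)\<^sup>2 - inner (x \<xi>) \<xi>" for \<xi>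
    by (simp_all add: y_def y'_def inner_shift)
  define p1 where "p1 = e_perp l y"
  define p2 where "p2 = e_perp l y'"
  define q1 where "q1 = spectral_projection {..m} x"
  define q2 where "q2 = e_perp m x"
  have p1: "projection p1" "bicommuting x p1"
    unfolding p1_def using projection_e_perp[OF y(1)] bicommuting_trans[OF bi(1) bicommuting_e_perp[OF y(1)]] .
  have p2: "projection p2" "bicommuting x p2"
    unfolding p2_def using projection_e_perp[OF y(2)] bicommuting_trans[OF bi(2) bicommuting_e_perp[OF y(2)]] .
  have q1: "projection q1" "bicommuting x q1"
    unfolding q1_def by (rule spectral_projection_atMost[OF x])+
  have q2: "projection q2" "bicommuting x q2"
    unfolding q2_def using projection_e_perp[OF x] bicommuting_e_perp[OF x] .
  note mem1 = tensor_projection_mem[OF p1 q1] and mem2 = tensor_projection_mem[OF p2 q2]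
  note proj1 = op_tensor_projection(1)[OF T p1(1) q1(1)] and proj2 = op_tensor_projection(1)[OF T p2(1) q2(1)]
  note sa = p1(1)[unfolded projection_def, THEN conjunct1] p2(1)[unfolded projection_def, THEN conjunct1]
    q1(1)[unfolded projection_def, THEN conjunct1] q2(1)[unfolded projection_def, THEN conjunct1]
  have c12: "commuting p1 p2"
    by (rule bicommutingD[OF p1(2) commuting_sym[OF bicommuting_self[OF p2(2)]]])
  have orth: "p1 (p2 \<xi>) = 0" for \<xi>
  proof -
    define \<zeta> where "\<zeta> = p1 (p2 \<xi>)"
    have "p1 \<zeta> = \<zeta>" "p2 \<zeta> = \<zeta>"
      using p1(1) p2(1) by (simp_all add: \<zeta>_def projection_iff projD flip: commutingD[OF c12])
    then have "l * (norm \<zeta>)\<^sup>2 + l * (norm \<zeta>)\<^sup>2 \<le> 0"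
      using e_perp_ge[OF y(1), of l \<zeta>] e_perp_ge[OF y(2), of l \<zeta>] by (simp add: p1_def p2_def form)
    then have "l * (norm \<zeta>)\<^sup>2 \<le> 0"
      by simp
    then show ?thesis
      using False by (simp add: \<zeta>_def mult_le_0_iff)
  qed
  have orth': "p2 (p1 \<xi>) = 0" for \<xi>
    using orth[of \<xi>] by (simp add: commutingD[OF c12])
  have p12: "projection (p1 + p2)"
    using p1(1) p2(1) orth orth' by (auto simp: projection_iff intro: proj_add)
  \<comment> \<open>The part where both one-sided tails vanish; there the modulus of
    \<open>y\<close> is strictly below l, so the tail of the modulus is dominated by
    \<open>p1 + p2\<close>.\<close>
  define r where "r = id_blinfun - (p1 + p2)"
  have r: "projection r" "bicommuting x r"
    using p12 proj_complement[of "p1 + p2"] p1(2) p2(2)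
    by (auto simp: r_def projection_iff bicommuting_def intro!: commuting_diff commuting_add)
  have cyr: "commuting y r"
    by (rule bicommutingD[OF bi(1) commuting_sym[OF bicommuting_self[OF r(2)]]])
  have "e_perp l (op_abs y) (r \<xi>) = 0" for \<xi>
  proof (rule e_perp_annihilates[OF ya r(1)])
    show "commuting (op_abs y) r"
      by (rule bicommutingD[OF bicommuting_abs[OF y(1)] cyr])
    show "inner (op_abs y \<xi>) \<xi> < l * (norm \<xi>)\<^sup>2" if "r \<xi> = \<xi>" "\<xi> \<noteq> 0" for \<xi>
    proof (rule op_abs_less[OF y(1) cyr _ that])
      fix \<zeta> assume \<zeta>: "r \<zeta> = \<zeta>" "\<zeta> \<noteq> 0"
      have "p1 \<zeta> + p2 \<zeta> = \<zeta> - r \<zeta>"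
        by (simp add: r_def blinfun.diff_left blinfun.add_left)
      also have "\<dots> = 0"
        using \<zeta> by simp
      finally have sum: "p1 \<zeta> + p2 \<zeta> = 0" .
      \<comment> \<open>Orthogonality of the ranges separates the two summands of a vanishing
        sum.\<close>
      have "p1 (p1 \<zeta> + p2 \<zeta>) = p1 \<zeta>"
        using p1(1) orth by (simp add: blinfun.add_right projection_iff projD)
      then have "p1 \<zeta> = 0"
        by (simp add: sum)
      moreover from this have "p2 \<zeta> = 0"
        using sum by simp
      ultimately show "\<bar>inner (y \<zeta>) \<zeta>\<bar> < l * (norm \<zeta>)\<^sup>2"
        using e_perp_less[OF y(1) _ \<zeta>(2), of l] e_perp_less[OF y(2) _ \<zeta>(2), of l]
        unfolding form p1_def p2_def by linarith
    qed
  qed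
  note e0 = this
  define p where "p = e_perp l (op_abs y)"
  have p: "projection p" "bicommuting x p"
    unfolding p_def using projection_e_perp[OF ya]
      bicommuting_trans[OF bi(1) bicommuting_trans[OF bicommuting_abs[OF y(1)] bicommuting_e_perp[OF ya]]] .
  have "(p1 + p2) (p \<xi>) = p \<xi>" for \<xi>
  proof -
    have "r (p \<xi>) = p (r \<xi>)"
      by (rule commutingD[OF bicommutingD[OF r(2) commuting_sym[OF bicommuting_self[OF p(2)]]]])
    then have "r (p \<xi>) = 0"
      by (simp add: p_def e0)
    then show ?thesis
      by (simp add: r_def blinfun.bilinear_simps)
  qed
  then have "Re (\<tau> p) \<le> Re (\<tau> (p1 + p2))"
    using p p1 p2 p12 bicommuting_mem by (intro state_mono[OF \<tau>] M_closed) blast+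
  then have split: "Re (\<tau> p) \<le> Re (\<tau> p1) + Re (\<tau> p2)"
    using p1 p2 bicommuting_mem by (simp add: state_add[OF \<tau>])

  let ?P = "e_perp l (op_abs xh)" and ?r1 = "op_tensor T p1 q1" and ?r2 = "op_tensor T p2 q2"
  have xha: "selfadjoint (op_abs xh)"
    by (rule selfadjoint_abs[OF xh])
  have bxa: "bicommuting xh (op_abs xh)"
    by (rule bicommuting_abs[OF xh])
  have P: "projection ?P" "?P \<in> vn_tensor T M M"
    using projection_e_perp[OF xha] tensor_bicommuting_mem[OF bicommuting_trans[OF bxa bicommuting_e_perp[OF xha]]] .
  have r1: "?P (?r1 u) = ?r1 u" for u
  proof (rule e_perp_absorbs[OF xha proj1 bicommutingD[OF bxa mem1(3)]])
    fix u assume u: "?r1 u = u"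
    have "(l + m - m) * (norm u)\<^sup>2 \<le> inner (xh u) u"
    proof (rule symmetrization_ge[OF T x p1(1) q1(1) _ _ u])
      show "(l + m) * (norm \<xi>)\<^sup>2 \<le> inner (x \<xi>) \<xi>" if "p1 \<xi> = \<xi>" for \<xi>
        using e_perp_ge[OF y(1), of l \<xi>] that unfolding p1_def form by (simp add: distrib_right)
      show "inner (x \<xi>) \<xi> \<le> m * (norm \<xi>)\<^sup>2" if "q1 \<xi> = \<xi>" for \<xi>
        using spectral_projection_atMost(3)[OF x] that by (simp add: q1_def)
    qed
    then show "l * (norm u)\<^sup>2 \<le> inner (op_abs xh u) u"
      using op_abs_ge[OF xh, of u] by simp
  qed
  have r2: "?P (?r2 u) = ?r2 u" for u
  proof (rule e_perp_absorbs[OF xha proj2 bicommutingD[OF bxa mem2(3)]])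
    fix u assume u: "?r2 u = u"
    \<comment> \<open>Lower tail: s <= m - l and t >= m give s - t <= -l.\<close>
    have "inner (xh u) u \<le> (m - l - m) * (norm u)\<^sup>2"
    proof (rule symmetrization_le[OF T x p2(1) q2(1) _ _ u])
      show "inner (x \<xi>) \<xi> \<le> (m - l) * (norm \<xi>)\<^sup>2" if "p2 \<xi> = \<xi>" for \<xi>
        using e_perp_ge[OF y(2), of l \<xi>] that unfolding p2_def form by (simp add: left_diff_distrib)
      show "m * (norm \<xi>)\<^sup>2 \<le> inner (x \<xi>) \<xi>" if "q2 \<xi> = \<xi>" for \<xi>
        using e_perp_ge[OF x] that by (simp add: q2_def)
    qed
    then show "l * (norm u)\<^sup>2 \<le> inner (op_abs xh u) u"
      using op_abs_ge[OF xh, of u] by simp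
  qed
  have 0: "T 0 \<xi> = 0" for \<xi>
    using bounded_bilinear.zero_left[OF bounded_bilinear_tensor[OF T]] .
  \<comment> \<open>Orthogonality comes from the first factors alone; \<open>q1\<close> and
    \<open>q2\<close> overlap if \<open>x\<close> has an atom at m.\<close>
  have "?r1 o\<^sub>L ?r2 = 0" "?r2 o\<^sub>L ?r1 = 0"
    by (rule tensor_blinfun_ext[OF T]; simp add: op_tensor_apply[OF T] sa orth orth' 0)+
  then have r12: "?r1 (?r2 u) = 0" "?r2 (?r1 u) = 0" for u
    by (metis blinfun_apply_blinfun_compose zero_blinfun.rep_eq)+
  have "projection (?r1 + ?r2)"
    using proj1 proj2 r12 by (auto simp: projection_iff intro: proj_add)
  then have "Re (\<tau>2 (?r1 + ?r2)) \<le> Re (\<tau>2 ?P)"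
    using mem1(1) mem2(1) P r1 r2
    by (intro state_mono[OF \<tau>2] tensor_closed) (simp_all add: blinfun.bilinear_simps)
  then have "Re (\<tau> p1) * Re (\<tau> q1) + Re (\<tau> p2) * Re (\<tau> q2) \<le> Re (\<tau>2 ?P)"
    using mem1(1,2) mem2(1,2) by (simp add: state_add[OF \<tau>2])
  moreover have "Re (\<tau> p1) * (1 / 2) \<le> Re (\<tau> p1) * Re (\<tau> q1)" "Re (\<tau> p2) * (1 / 2) \<le> Re (\<tau> p2) * Re (\<tau> q2)"
    using m state_projection(1)[OF \<tau> p1(1) bicommuting_mem[OF p1(2)]] state_projection(1)[OF \<tau> p2(1) bicommuting_mem[OF p2(2)]]
    by (intro mult_left_mono; simp add: is_median_def q1_def q2_def)+
  ultimately show ?thesis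
    using split unfolding p_def y_def by linarith
qed

text \<open>The strict bound \<open>|x - \<alpha>| < l / 2\<close> on the range of \<open>r\<close> does not pass to the Hilbert space tensor
  product directly. It is replaced by the uniform bounds on the projections for \<open>l / 2 - 1 / (n + 1)\<close>,
  which converge strongly to \<open>r\<close>.\<close>

lemma symmetrization_centered_tail:
  "2 * Re (\<tau>2 (e_perp l (op_abs xh))) \<le> 4 * Re (\<tau> (e_perp (l / 2) (op_abs (x - \<alpha> *\<^sub>R id_blinfun))))"
proof -
  define y where "y = x - \<alpha> *\<^sub>R id_blinfun"
  have y: "selfadjoint y"
    unfolding y_def using x by (intro selfadjoint_closed)
  have ya: "selfadjoint (op_abs y)"
    by (rule selfadjoint_abs[OF y])
  have bya: "bicommuting x (op_abs y)"
    by (rule bicommuting_trans[OF bicommuting_shift(1)[of x \<alpha>, folded y_def] bicommuting_abs[OF y]])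
  have e: "projection (e_perp t (op_abs y))" "bicommuting x (e_perp t (op_abs y))" for t
    using projection_e_perp[OF ya] bicommuting_trans[OF bya bicommuting_e_perp[OF ya]] .
  define r where "r t = e_below t (op_abs y)" for t
  have r: "projection (r t)" "bicommuting x (r t)" for t
    using e[of t] proj_complement[of "e_perp t (op_abs y)"]
    by (auto simp: r_def e_below_eq projection_iff bicommuting_def intro!: commuting_diff)
  have sa: "selfadjoint (r t)" for t
    using r(1) by (simp add: projection_def)
  note mem = tensor_projection_mem[OF r r] and proj = op_tensor_projection(1)[OF T r(1) r(1)]
  let ?P = "e_perp l (op_abs xh)"
  have xha: "selfadjoint (op_abs xh)"
    by (rule selfadjoint_abs[OF xh])
  have bxa: "bicommuting xh (op_abs xh)"
    by (rule bicommuting_abs[OF xh])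
  have bP: "bicommuting xh ?P"
    by (rule bicommuting_trans[OF bxa bicommuting_e_perp[OF xha]])
  have P: "projection ?P" "?P \<in> vn_tensor T M M"
    using projection_e_perp[OF xha] tensor_bicommuting_mem[OF bP] .
  have r_bounds: "inner (x \<xi>) \<xi> \<le> (\<alpha> + t) * (norm \<xi>)\<^sup>2" "(\<alpha> - t) * (norm \<xi>)\<^sup>2 \<le> inner (x \<xi>) \<xi>"
    if "r t \<xi> = \<xi>" for t \<xi>
  proof -
    have "e_perp t (op_abs y) \<xi> = 0"
      using that by (simp add: r_def e_below_eq blinfun.bilinear_simps)
    then have "inner (op_abs y \<xi>) \<xi> \<le> t * (norm \<xi>)\<^sup>2"
      using e_perp_less[OF ya, of t \<xi>] by (cases "\<xi> = 0") auto
    then have "\<bar>inner (x \<xi>) \<xi> - \<alpha> * (norm \<xi>)\<^sup>2\<bar> \<le> t * (norm \<xi>)\<^sup>2"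
      using op_abs_ge[OF y, of \<xi>] unfolding y_def inner_shift by linarith
    then show "inner (x \<xi>) \<xi> \<le> (\<alpha> + t) * (norm \<xi>)\<^sup>2" "(\<alpha> - t) * (norm \<xi>)\<^sup>2 \<le> inner (x \<xi>) \<xi>"
      unfolding distrib_right left_diff_distrib by linarith+
  qed
  have P_less: "?P (op_tensor T (r t) (r t) u) = 0" if t: "t < l / 2" for t u
  proof (rule e_perp_annihilates[OF xha proj bicommutingD[OF bxa mem(3)]])
    show "inner (op_abs xh u) u < l * (norm u)\<^sup>2" if "op_tensor T (r t) (r t) u = u" "u \<noteq> 0" for u
    proof (rule op_abs_less[OF xh mem(3) _ that])
      fix v assume v: "op_tensor T (r t) (r t) v = v" "v \<noteq> 0"
      have "((\<alpha> - t) - (\<alpha> + t)) * (norm v)\<^sup>2 \<le> inner (xh v) v"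
        by (rule symmetrization_ge[OF T x r(1) r(1) _ _ v(1)]) (simp_all add: r_bounds)
      moreover have "inner (xh v) v \<le> ((\<alpha> + t) - (\<alpha> - t)) * (norm v)\<^sup>2"
        by (rule symmetrization_le[OF T x r(1) r(1) _ _ v(1)]) (simp_all add: r_bounds)
      \<comment> \<open>Both variables are within t of \<alpha>, so they differ by at most 2 t; as t
        < l / 2, the strict inequality now holds with a uniform gap.\<close>
      ultimately have "\<bar>inner (xh v) v\<bar> \<le> 2 * t * (norm v)\<^sup>2"
        by (simp add: abs_le_iff)
      also have "\<dots> < l * (norm v)\<^sup>2"
        using t v(2) by (intro mult_strict_right_mono) simp_all
      finally show "\<bar>inner (xh v) v\<bar> < l * (norm v)\<^sup>2" .
    qed
  qed
  define R where "R = op_tensor T (r (l / 2)) (r (l / 2))"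
  have "?P o\<^sub>L R = 0"
  proof (rule tensor_blinfun_ext[OF T])
    fix \<xi> \<eta>
    let ?r = "\<lambda>n. r (l / 2 - 1 / real (Suc n))"
    \<comment> \<open>On an elementary tensor the strong limit is taken in each factor, and
      elementary tensors determine the product of \<open>?P\<close> and \<open>R\<close>.\<close>
    have "(\<lambda>n. ?P (T (?r n \<xi>) (?r n \<eta>))) \<longlonglongrightarrow> ?P (T (r (l / 2) \<xi>) (r (l / 2) \<eta>))"
      unfolding r_def
      by (intro blinfun.tendsto tendsto_const bounded_bilinear.tendsto[OF bounded_bilinear_tensor[OF T]]
          e_below_left_continuous[OF ya])
    moreover have "?P (T (?r n \<xi>) (?r n \<eta>)) = 0" for n
      using P_less[of "l / 2 - 1 / real (Suc n)" "T \<xi> \<eta>"] by (simp add: op_tensor_apply[OF T sa sa])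
    ultimately show "(?P o\<^sub>L R) (T \<xi> \<eta>) = blinfun_apply 0 (T \<xi> \<eta>)"
      by (simp add: R_def op_tensor_apply[OF T sa sa] LIMSEQ_const_iff)
  qed
  then have PR: "?P (R u) = 0" for u
    by (metis blinfun_apply_blinfun_compose zero_blinfun.rep_eq)
  have "commuting ?P R"
    unfolding R_def by (rule bicommutingD[OF bP mem(3)])
  then have RP: "R (?P u) = 0" for u
    using PR by (simp add: commuting_iff)
  have PR_proj: "projection (?P + R)"
    using P(1) proj[of "l / 2" "l / 2"] PR RP by (auto simp: R_def projection_iff intro: proj_add)
  have id: "projection id_blinfun" "id_blinfun \<in> vn_tensor T M M" "\<tau>2 id_blinfun = 1" "\<tau> id_blinfun = 1"
    using \<tau> \<tau>2 xh_mem by (auto simp: projection_iff state_on_def vn_tensor_def intro: commutant_closed)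
  have RM: "R \<in> vn_tensor T M M"
    unfolding R_def by (rule mem)
  have "Re (\<tau>2 (?P + R)) \<le> Re (\<tau>2 id_blinfun)"
    using P RM by (intro state_mono[OF \<tau>2] PR_proj id tensor_closed) simp_all
  then have "Re (\<tau>2 ?P) + Re (\<tau> (r (l / 2))) * Re (\<tau> (r (l / 2))) \<le> 1"
    using P RM mem(2)[of "l / 2" "l / 2"] by (simp add: state_add[OF \<tau>2] id R_def)
  moreover have "Re (\<tau> (r (l / 2))) = 1 - Re (\<tau> (e_perp (l / 2) (op_abs y)))"
  proof -
    have "r (l / 2) = id_blinfun - e_perp (l / 2) (op_abs y)"
      by (simp add: r_def e_below_eq)
    moreover have "r (l / 2) \<in> M" "e_perp (l / 2) (op_abs y) \<in> M"
      using r e bicommuting_mem by blast+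
    ultimately show ?thesis
      using state_diff[OF \<tau>, of id_blinfun "e_perp (l / 2) (op_abs y)"] by (simp add: id)
  qed
  \<comment> \<open>Union bound: with a the trace of the tail at l / 2, the complement of the square
    has measure at most 2 a.\<close>
  moreover have "1 - (1 - a) * (1 - a) \<le> 2 * a" for a :: real
    using zero_le_square[of a] by (simp add: algebra_simps)
  ultimately have "Re (\<tau>2 ?P) \<le> 2 * Re (\<tau> (e_perp (l / 2) (op_abs y)))"
    by (smt (verit))
  then show ?thesis
    by (simp add: y_def)
qed

end

theorem corollary3p3:
  fixes M :: "('h::chilbert_space \<Rightarrow>\<^sub>L 'h) set"
    and \<tau> :: "('h \<Rightarrow>\<^sub>L 'h) \<Rightarrow> complex"
    and T :: "'h \<Rightarrow> 'h \<Rightarrow> 'k::chilbert_space"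
    and \<tau>2 :: "('k \<Rightarrow>\<^sub>L 'k) \<Rightarrow> complex"
    and x :: "'h \<Rightarrow>\<^sub>L 'h"
    and m :: real
  assumes "von_neumann_algebra M"
    and "normal_tracial_state M \<tau>"
    and "faithful_on M \<tau>"
    and "hilbert_tensor T"
    and "tensor_trace T M \<tau> M \<tau> \<tau>2"
    and "x \<in> M"
    and "selfadjoint x"
    and "is_median \<tau> x m"
  shows "(\<forall>l::real.
            Re (\<tau> (e_perp l (x - m *\<^sub>R id_blinfun)))
              \<le> 2 * Re (\<tau>2 (e_perp l (symmetrization T x)))) \<and>
         (\<forall>(l::real) (\<alpha>::real).
            Re (\<tau> (e_perp l (op_abs (x - m *\<^sub>R id_blinfun))))
              \<le> 2 * Re (\<tau>2 (e_perp l (op_abs (symmetrization T x)))) \<and>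
            2 * Re (\<tau>2 (e_perp l (op_abs (symmetrization T x))))
              \<le> 4 * Re (\<tau> (e_perp (l / 2) (op_abs (x - \<alpha> *\<^sub>R id_blinfun))))) \<and>
         (\<forall>l::real.
            Re (\<tau> (e_perp l (op_abs (x - m *\<^sub>R id_blinfun))))
              \<le> 2 * Re (\<tau>2 (e_perp l (op_abs (symmetrization T x)))) \<and>
            2 * Re (\<tau>2 (e_perp l (op_abs (symmetrization T x))))
              \<le> 4 * Re (\<tau> (e_perp (l / 2) (op_abs (x - m *\<^sub>R id_blinfun)))))"
proof -
  interpret symmetrization_setup M \<tau> T \<tau>2 x
    by unfold_locales
      (use assms in \<open>auto simp: von_neumann_algebra_def normal_tracial_state_def tensor_trace_def\<close>)
  show ?thesis
    \<comment> \<open>The last conjunct is the second one at \<alpha> = m.\<close>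
    using symmetrization_tail[OF assms(8)] symmetrization_abs_tail[OF assms(8)] symmetrization_centered_tail
    by blast
qed

end
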